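(* There is a constant $C_0>0$ such that \[ \int_0^1 |f(1/2+\sigma)|\,d\sigma\le C_0\|f\|_{\mathscr{H}^1}\qquad\text{for all } f\in\mathscr{H}^1 . \] Therefore, there is a constant $C_0'>0$ such that \[ \left|a_1+\sum_{n=2}^\infty \frac{a_n}{\sqrt n\,\log n}\right|\le C_0'\|f\|_{\mathscr{H}^1}\qquad\text{for all } f(s)=\sum_{n\ge 1}a_n n^{-s}\in\mathscr{H}^1 , \] where the infinite series on the left-hand side is convergent for every $f\in\mathscr{H}^1$.
   Context: $\mathbb{T}$ is the unit circle in $\mathbb{C}$, $\mathbb{T}^\infty$ is the countably infinite product of copies of $\mathbb{T}$, and $m$ is its normalized Haar measure. Each $z=(z_1,z_2,\ldots)\in\mathbb{T}^\infty$ is identified with the completely multiplicative function $z\colon\mathbb{N}\to\mathbb{T}$ determined by $z(p_j)=z_j$, where $p_j$ is the $j$th prime. The Bohr lift of a Dirichlet polynomial $f(s)=\sum_{n=1}^N a_n n^{-s}$ ($a_n\in\mathbb{C}$) is the polynomial $\mathscr{B}f(z)=F(z)=\sum_{n=1}^N a_n z(n)$, $z\in\mathbb{T}^\infty$. For $1\le p<\infty$, the norm of a Dirichlet polynomial is \[ \|f\|_{\mathscr{H}^p}^p=\int_{\mathbb{T}^\infty}|F(z)|^p\,dm(z)=\lim_{T\to\infty}\frac1{2T}\int_{-T}^T|f(it)|^p\,dt , \] and $\mathscr{H}^p$ is the completion of the Dirichlet polynomials in this norm. Elements of $\mathscr{H}^p$ are represented by Dirichlet series $f(s)=\sum_{n=1}^\infty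 a_n n^{-s}$ in the half-plane $\Re s>1/2$; $f(1/2+\sigma)$ denotes the value at $s=1/2+\sigma$, $\sigma>0$, and $a_n$ denotes the $n$th coefficient of $f$. *)

theory Defs
  imports "HOL-Probability.Probability" "HOL-Computational_Algebra.Primes"
begin

section \<open>The infinite torus and its normalized Haar measure\<close>

definition circle_measure :: "complex measure" where
  "circle_measure =
     distr (uniform_measure lborel {0..<1::real}) (restrict_space borel (sphere 0 1))
       (\<lambda>t. cis (2 * pi * t))"

definition torus_measure :: "(nat \<Rightarrow> complex) measure" where
  "torus_measure = PiM UNIV (\<lambda>_. circle_measure)"

text \<open>The coordinates are indexed from 0, so coordinate \<open>j\<close> belongs to the \<open>(j+1)\<close>-st
  prime \<open>enumerate {p. prime p} j\<close>. The following lemmas confirm that \<open>torus_measure\<close> is a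
  probability measure on the countable power of the unit circle which is invariant
  under the group translations, i.e. the normalized Haar measure.\<close>

lemma cis_measurable:
  "(\<lambda>t::real. cis (2 * pi * t)) \<in> lborel \<rightarrow>\<^sub>M restrict_space borel (sphere 0 1)"
proof (rule measurable_restrict_space2)
  have "(\<lambda>t::real. cis (2 * pi * t)) \<in> borel_measurable borel"
    by (intro borel_measurable_continuous_onI continuous_intros)
  then show "(\<lambda>t::real. cis (2 * pi * t)) \<in> lborel \<rightarrow>\<^sub>M borel" by simp
qed auto

lemma sets_circle_measure [measurable_cong]:
  "sets circle_measure = sets (restrict_space borel (sphere 0 1))"
  by (simp add: circle_measure_def)

lemma space_circle_measure: "space circle_measure = sphere 0 1"
  by (simp add: circle_measure_def space_restrict_space)

lemma emeasure_circle_measure: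
  assumes "A \<in> sets (restrict_space borel (sphere 0 1))"
  shows "emeasure circle_measure A = emeasure lborel {t \<in> {0..<1}. cis (2 * pi * t) \<in> A}"
proof -
  have "(\<lambda>t. cis (2 * pi * t)) \<in>
          uniform_measure lborel {0..<1::real} \<rightarrow>\<^sub>M restrict_space borel (sphere 0 1)"
    using cis_measurable by (simp cong: measurable_cong_sets)
  moreover have "(\<lambda>t::real. cis (2 * pi * t)) -` A \<in> sets borel"
    using measurable_sets[OF cis_measurable assms] by simp
  ultimately show ?thesis
    using assms by (simp add: circle_measure_def emeasure_distr vimage_def
        Int_def conj_commute divide_ennreal_def)
qed

lemma prob_space_circle_measure: "prob_space circle_measure"
proof -
  have "prob_space (uniform_measure lborel {0..<1::real})"
    by (rule prob_space_uniform_measure) auto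
  then show ?thesis unfolding circle_measure_def
    by (rule prob_space.prob_space_distr) (use cis_measurable in \<open>simp cong: measurable_cong_sets\<close>)
qed

lemma prob_space_torus_measure: "prob_space torus_measure"
  unfolding torus_measure_def
  by (rule prob_space_PiM) (rule prob_space_circle_measure)

lemma space_torus_measure: "space torus_measure = {z. \<forall>j. cmod (z j) = 1}"
  by (auto simp: torus_measure_def space_PiM space_circle_measure PiE_def extensional_def)

lemma mult_circle_measurable:
  assumes "cmod w = 1"
  shows "(\<lambda>z. w * z) \<in> restrict_space borel (sphere 0 1) \<rightarrow>\<^sub>M restrict_space borel (sphere 0 1)"
proof (rule measurable_restrict_space2)
  show "(\<lambda>z. w * z) \<in> space (restrict_space borel (sphere 0 1)) \<rightarrow> sphere 0 1"
    using assms by (simp add: space_restrict_space norm_mult)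
  show "(\<lambda>z. w * z) \<in> restrict_space borel (sphere 0 1) \<rightarrow>\<^sub>M borel"
    by (rule measurable_restrict_space1) simp
qed

lemma circle_measure_rotate:
  assumes w: "cmod w = 1"
  shows "distr circle_measure circle_measure (\<lambda>z. w * z) = circle_measure"
proof (rule measure_eqI)
  fix A assume "A \<in> sets (distr circle_measure circle_measure (\<lambda>z. w * z))"
  then have A: "A \<in> sets (restrict_space borel (sphere 0 1))"
    by (simp add: sets_circle_measure)
  define c where "c = frac (Arg w / (2 * pi))"
  have c: "0 \<le> c" "c < 1" by (auto simp: c_def frac_ge_0 frac_lt_1)
  have "cis (2 * pi * c) = cis (Arg w - 2 * pi * of_int \<lfloor>Arg w / (2 * pi)\<rfloor>)"
    by (simp add: c_def frac_def algebra_simps)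
  also have "\<dots> = w"
  proof -
    have "w \<noteq> 0" using w by auto
    then have "cis (Arg w) = w" using w by (simp add: cis_Arg sgn_div_norm)
    moreover have "cis (2 * pi * of_int \<lfloor>Arg w / (2 * pi)\<rfloor>) = 1"
      by (rule cis_multiple_2pi) simp
    ultimately show ?thesis by (simp only: cis_divide[symmetric] div_by_1)
  qed
  finally have wc: "w = cis (2 * pi * c)" ..
  define E where "E = {t::real. cis (2 * pi * t) \<in> A}"
  have Em [measurable]: "E \<in> sets borel"
    using measurable_sets[OF cis_measurable A] by (simp add: E_def vimage_def)
  have per: "t + 1 \<in> E \<longleftrightarrow> t \<in> E" for t
    by (simp add: E_def distrib_left cis_mult[symmetric])
  have shift: "emeasure lborel {t. t + d \<in> X} = emeasure lborel X"
    if X: "X \<in> sets borel" for d :: real and X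
  proof -
    have "emeasure lborel X = emeasure (distr lborel borel ((+) d)) X"
      by (simp add: lborel_distr_plus)
    also have "\<dots> = emeasure lborel ((+) d -` X)"
      using X by (simp add: emeasure_distr)
    finally show ?thesis by (simp add: vimage_def add.commute)
  qed
  have pre: "(\<lambda>z. w * z) -` A \<inter> space circle_measure \<in> sets (restrict_space borel (sphere 0 1))"
    using measurable_sets[OF mult_circle_measurable[OF w] A]
    by (simp add: space_circle_measure space_restrict_space)
  have "emeasure (distr circle_measure circle_measure (\<lambda>z. w * z)) A =
      emeasure circle_measure ((\<lambda>z. w * z) -` A \<inter> space circle_measure)"
    using A mult_circle_measurable[OF w]
    by (intro emeasure_distr) (simp_all add: sets_circle_measure cong: measurable_cong_sets)
  also have "\<dots> = emeasure lborel {t \<in> {0..<1}. t + c \<in> E}"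
    unfolding emeasure_circle_measure[OF pre]
    by (rule arg_cong[where f = "emeasure lborel"])
       (auto simp: E_def space_circle_measure wc cis_mult distrib_left add.commute)
  also have "{t \<in> {0..<1}. t + c \<in> E} = {t. t + c \<in> E \<inter> {c..<1 + c}}" by auto
  also have "emeasure lborel \<dots> = emeasure lborel (E \<inter> {c..<1 + c})" by (rule shift) simp
  also have "E \<inter> {c..<1 + c} = (E \<inter> {c..<1}) \<union> (E \<inter> {1..<1 + c})" using c by auto
  also have "emeasure lborel \<dots> = emeasure lborel (E \<inter> {c..<1}) + emeasure lborel (E \<inter> {1..<1 + c})"
    by (rule plus_emeasure[symmetric]) auto
  also have "emeasure lborel (E \<inter> {1..<1 + c}) = emeasure lborel {t. t + 1 \<in> E \<inter> {1..<1 + c}}"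
    by (rule shift[symmetric]) simp
  also have "{t. t + 1 \<in> E \<inter> {1..<1 + c}} = E \<inter> {0..<c}" by (auto simp: per)
  also have "emeasure lborel (E \<inter> {c..<1}) + emeasure lborel (E \<inter> {0..<c}) =
      emeasure lborel ((E \<inter> {c..<1}) \<union> (E \<inter> {0..<c}))"
    by (rule plus_emeasure) auto
  also have "(E \<inter> {c..<1}) \<union> (E \<inter> {0..<c}) = {t \<in> {0..<1}. cis (2 * pi * t) \<in> A}"
    using c by (auto simp: E_def)
  also have "emeasure lborel \<dots> = emeasure circle_measure A"
    by (rule emeasure_circle_measure[OF A, symmetric])
  finally show "emeasure (distr circle_measure circle_measure (\<lambda>z. w * z)) A =
      emeasure circle_measure A" .
qed simp

lemma torus_measure_translate:
  assumes w: "\<And>j. cmod (w j) = 1"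
  shows "distr torus_measure torus_measure (\<lambda>z j. w j * z j) = torus_measure"
proof -
  interpret product_prob_space "\<lambda>_::nat. circle_measure" UNIV
    by (intro product_prob_spaceI prob_space_circle_measure)
  have m1: "(\<lambda>z. w j * z) \<in> circle_measure \<rightarrow>\<^sub>M circle_measure" for j
    using mult_circle_measurable[OF w] by (simp cong: measurable_cong_sets add: sets_circle_measure)
  have m: "(\<lambda>z j. w j * z j) \<in> torus_measure \<rightarrow>\<^sub>M torus_measure"
    unfolding torus_measure_def
  proof (rule measurable_PiM_single')
    show "(\<lambda>z. w j * z j) \<in> PiM UNIV (\<lambda>_. circle_measure) \<rightarrow>\<^sub>M circle_measure" for j
      by (rule measurable_compose[OF _ m1]) simp
  qed (auto simp: space_PiM space_circle_measure norm_mult w PiE_iff)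
  show ?thesis
    unfolding torus_measure_def
  proof (rule PiM_eq)
    fix J and F :: "nat \<Rightarrow> complex set"
    assume J: "finite J" "J \<subseteq> UNIV" and F: "\<And>j. j \<in> J \<Longrightarrow> F j \<in> sets circle_measure"
    let ?G = "\<lambda>j. (\<lambda>z. w j * z) -` F j \<inter> space circle_measure"
    have G: "?G j \<in> sets circle_measure" if "j \<in> J" for j
      using measurable_sets[OF m1 F[OF that]] .
    let ?P = "PiM UNIV (\<lambda>_::nat. circle_measure)"
    have eq: "(\<lambda>z j. w j * z j) -` prod_emb UNIV (\<lambda>_. circle_measure) J (Pi\<^sub>E J F) \<inter> space ?P =
        prod_emb UNIV (\<lambda>_. circle_measure) J (Pi\<^sub>E J ?G)"
      by (auto simp: prod_emb_def space_PiM PiE_iff space_circle_measure norm_mult w restrict_def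
          extensional_def)
    have "emeasure (distr ?P ?P (\<lambda>z j. w j * z j))
          (prod_emb UNIV (\<lambda>_. circle_measure) J (Pi\<^sub>E J F)) =
        emeasure ?P (prod_emb UNIV (\<lambda>_. circle_measure) J (Pi\<^sub>E J ?G))"
      unfolding eq[symmetric] using m F J
      by (intro emeasure_distr) (auto simp: torus_measure_def intro!: sets_PiM_I)
    also have "\<dots> = (\<Prod>j\<in>J. emeasure circle_measure (?G j))"
      using J G by (intro emeasure_PiM_emb) auto
    also have "\<dots> = (\<Prod>j\<in>J. emeasure (distr circle_measure circle_measure (\<lambda>z. w j * z)) (F j))"
      using F m1 by (intro prod.cong refl emeasure_distr[symmetric]) auto
    also have "\<dots> = (\<Prod>j\<in>J. emeasure circle_measure (F j))"
      by (simp add: circle_measure_rotate w)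
    finally show "emeasure (distr ?P ?P (\<lambda>z j. w j * z j))
          (prod_emb UNIV (\<lambda>_. circle_measure) J (Pi\<^sub>E J F)) =
        (\<Prod>j\<in>J. emeasure circle_measure (F j))" .
  qed simp
qed


section \<open>Points of the torus as completely multiplicative functions\<close>

definition nth_prime :: "nat \<Rightarrow> nat" where
  "nth_prime j = enumerate {p. prime p} j"

definition mult_fun :: "(nat \<Rightarrow> complex) \<Rightarrow> nat \<Rightarrow> complex" where
  "mult_fun z n = (\<Prod>j | nth_prime j dvd n. z j ^ multiplicity (nth_prime j) n)"

lemma prime_nth_prime: "prime (nth_prime j)"
  using enumerate_in_set[OF primes_infinite, of j] by (simp add: nth_prime_def)

lemma inj_nth_prime: "inj nth_prime"
  unfolding nth_prime_def by (rule inj_enumerate[OF primes_infinite])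

lemma finite_nth_prime_dvd:
  assumes "n > 0" shows "finite {j. nth_prime j dvd n}"
proof -
  have "finite {d. d dvd n}" using assms by simp
  from finite_vimageI[OF this inj_nth_prime] show ?thesis by (simp add: vimage_def)
qed

lemma mult_fun_superset:
  assumes "n > 0" "finite S" "{j. nth_prime j dvd n} \<subseteq> S"
  shows "mult_fun z n = (\<Prod>j\<in>S. z j ^ multiplicity (nth_prime j) n)"
  unfolding mult_fun_def
  by (rule prod.mono_neutral_left) (use assms in \<open>auto simp: not_dvd_imp_multiplicity_0\<close>)

lemma mult_fun_mult:
  assumes "m > 0" "n > 0"
  shows "mult_fun z (m * n) = mult_fun z m * mult_fun z n"
proof -
  let ?S = "{j. nth_prime j dvd m * n}"
  have S: "finite ?S" using assms by (intro finite_nth_prime_dvd) auto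
  have "mult_fun z (m * n) = (\<Prod>j\<in>?S. z j ^ multiplicity (nth_prime j) (m * n))"
    by (simp add: mult_fun_def)
  also have "\<dots> = (\<Prod>j\<in>?S. z j ^ multiplicity (nth_prime j) m * z j ^ multiplicity (nth_prime j) n)"
    using assms prime_nth_prime
    by (intro prod.cong refl) (simp add: prime_elem_multiplicity_mult_distrib power_add)
  also have "\<dots> = mult_fun z m * mult_fun z n"
    using assms S by (simp add: prod.distrib mult_fun_superset[of m ?S] mult_fun_superset[of n ?S]
        subset_iff)
  finally show ?thesis .
qed

lemma mult_fun_1: "mult_fun z 1 = 1"
  by (simp add: mult_fun_def)

lemma mult_fun_nth_prime: "mult_fun z (nth_prime j) = z j"
proof -
  have "{i. nth_prime i dvd nth_prime j} = {j}"
    using prime_nth_prime inj_nth_prime by (auto simp: primes_dvd_imp_eq inj_def)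
  then show ?thesis
    using prime_nth_prime[of j] by (simp add: mult_fun_def)
qed


section \<open>Dirichlet polynomials and Hardy spaces\<close>

text \<open>A Dirichlet polynomial is given by its coefficient sequence; the value at index 0,
  which carries no meaning, is normalized to 0.\<close>

definition dirichlet_polys :: "(nat \<Rightarrow> complex) set" where
  "dirichlet_polys = {a. a 0 = 0 \<and> finite {n. a n \<noteq> 0}}"

definition bohr_lift :: "(nat \<Rightarrow> complex) \<Rightarrow> (nat \<Rightarrow> complex) \<Rightarrow> complex" where
  "bohr_lift a z = (\<Sum>n | a n \<noteq> 0. a n * mult_fun z n)"

definition poly_norm :: "real \<Rightarrow> (nat \<Rightarrow> complex) \<Rightarrow> real" where
  "poly_norm p a = (\<integral>z. cmod (bohr_lift a z) powr p \<partial>torus_measure) powr (1 / p)"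

text \<open>The completion is the usual one: Cauchy sequences of Dirichlet polynomials modulo null
  sequences. The coefficients of a Dirichlet polynomial and its norm are uniformly continuous
  for \<open>poly_norm p\<close>, and \<open>hardy_coeff\<close>, \<open>hardy_norm\<close> are their extensions to the completion
  (the limits exist and do not depend on the representative).\<close>

definition hardy_cauchy :: "real \<Rightarrow> (nat \<Rightarrow> nat \<Rightarrow> complex) set" where
  "hardy_cauchy p = {P. (\<forall>k. P k \<in> dirichlet_polys) \<and>
     (\<forall>e>0. \<exists>M. \<forall>k\<ge>M. \<forall>l\<ge>M. poly_norm p (\<lambda>n. P k n - P l n) < e)}"

definition hardy_rel :: "real \<Rightarrow> ((nat \<Rightarrow> nat \<Rightarrow> complex) \<times> (nat \<Rightarrow> nat \<Rightarrow> complex)) set" where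
  "hardy_rel p = {(P, Q). P \<in> hardy_cauchy p \<and> Q \<in> hardy_cauchy p \<and>
     (\<lambda>k. poly_norm p (\<lambda>n. P k n - Q k n)) \<longlonglongrightarrow> 0}"

definition hardy_space :: "real \<Rightarrow> (nat \<Rightarrow> nat \<Rightarrow> complex) set set" where
  "hardy_space p = hardy_cauchy p // hardy_rel p"

definition hardy_norm :: "real \<Rightarrow> (nat \<Rightarrow> nat \<Rightarrow> complex) set \<Rightarrow> real" where
  "hardy_norm p f = (THE r. \<forall>P\<in>f. (\<lambda>k. poly_norm p (P k)) \<longlonglongrightarrow> r)"

definition hardy_coeff :: "(nat \<Rightarrow> nat \<Rightarrow> complex) set \<Rightarrow> nat \<Rightarrow> complex" where
  "hardy_coeff f n = (THE c. \<forall>P\<in>f. (\<lambda>k. P k n) \<longlonglongrightarrow> c)"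

definition hardy_term :: "(nat \<Rightarrow> nat \<Rightarrow> complex) set \<Rightarrow> complex \<Rightarrow> nat \<Rightarrow> complex" where
  "hardy_term f s n = hardy_coeff f n * of_nat n powr (- s)"

definition hardy_value :: "(nat \<Rightarrow> nat \<Rightarrow> complex) set \<Rightarrow> complex \<Rightarrow> complex" where
  "hardy_value f s = (\<Sum>n. hardy_term f s (Suc n))"

end

theory Submission
  imports Defs "HOL-Complex_Analysis.Complex_Analysis"
    "HOL-Computational_Algebra.Fundamental_Theorem_Algebra"
begin

text \<open>
  Write \<open>K\<^sub>\<sigma>\<close> for the Szego kernel of the polydisc at the point with coordinates
  \<open>p powr - (1/2 + \<sigma>)\<close>. Subharmonicity of \<open>\<bar>F / K\<^sub>\<sigma>\<^sup>2\<bar>\<close> to the power \<open>1/2\<close> gives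
  \<open>\<bar>f(1/2 + \<sigma>)\<bar> \<le> (\<integral> \<bar>F\<bar> powr (1/2) * \<bar>K\<^sub>\<sigma>\<bar>)\<^sup>2\<close>, so the first inequality is an \<open>L\<^sup>2\<close> bound for
  the operator with kernel \<open>\<bar>K\<^sub>\<sigma>(z)\<bar>\<close>. Its Gram matrix \<open>\<integral> \<bar>K\<^sub>\<sigma>\<bar> * \<bar>K\<^sub>\<tau>\<bar>\<close> is dominated by a multiple of
  \<open>(\<sigma> * \<tau>) powr (-1/4) * (\<sigma> + \<tau>) powr (-1/2)\<close>, which is homogeneous of degree \<open>-1\<close> and passes
  Schur's test.

  For the second inequality, the bound \<open>\<Sum> \<bar>a\<^sub>n\<bar> n powr - (1/2 + \<sigma>) \<le> C (1 + 1/\<sigma>) \<parallel>f\<parallel>\<close>, obtained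
  one variable at a time, controls the difference between the partial sums up to \<open>N\<close> and the
  integral of \<open>f(1/2 + \<sigma>) - a\<^sub>1\<close> over \<open>1 / ln N \<le> \<sigma> \<le> 1\<close>. Uniformly bounded partial sums converge
  on the closure of the Dirichlet polynomials.
\<close>

section \<open>Integration over the torus\<close>

text \<open>The number of variables is unbounded, so no constant may be lost per variable: each
  prime must contribute a factor 1 + c r^2 + O(r^3), with r = p powr - (1/2 + \<sigma>). The cubic
  terms add up to a constant because the sum of p powr - (3/2) converges; this is why constants such
  as 254000 may be generous. The sum of r^2 over the primes, in contrast, is log (1/\<sigma>) up to
  a bounded amount as \<sigma> tends to 0, so c becomes the exponent of 1/\<sigma> and has to be
  exact. For the Gram matrix the quadratic term is (r + s)^2 / 4, which yields just the degree -1
  that Schur's test tolerates. For absolute sums it is r^2, giving growth 1/\<sigma>, and a factor 1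
  / ln N in the cut-off error compensates it at \<sigma> = 1 / ln N with no power to spare.

  The exponent 1/2 turns an L^1 question into an L^2 one, since the square root of |F| has square
  integral equal to the norm of F. Functions of several variables have no inner-outer factorization,
  so the analytic square root is taken in one coordinate at a time, the others being fixed.\<close>

lemma borel_measurable_circle:
  "f \<in> borel_measurable borel \<Longrightarrow> f \<in> borel_measurable circle_measure"
  unfolding measurable_cong_sets[OF sets_circle_measure refl] by (rule measurable_restrict_space1)

text \<open>The closed interval matches the parameter interval of \<open>circlepath\<close>, so that
  Cauchy's formula can be read as an integral over the circle; the extra endpoint is a null
  set.\<close>

lemma nn_integral_circle:
  assumes [measurable]: "f \<in> borel_measurable borel"
  shows "(\<integral>\<^sup>+x. f x \<partial>circle_measure) = (\<integral>\<^sup>+t. f (cis (2 * pi * t)) * indicator {0..1} t \<partial>lborel)"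
proof -
  have m: "(\<lambda>t. cis (2 * pi * t)) \<in>
      uniform_measure lborel {0..<1::real} \<rightarrow>\<^sub>M restrict_space borel (sphere 0 1)"
    using cis_measurable by (simp cong: measurable_cong_sets)
  have m': "(\<lambda>t. cis (2 * pi * t)) \<in> borel_measurable borel"
    by (intro borel_measurable_continuous_onI continuous_intros)
  note [measurable] = measurable_compose[OF m' assms]
  have "(\<integral>\<^sup>+x. f x \<partial>circle_measure) = (\<integral>\<^sup>+t. f (cis (2 * pi * t)) \<partial>uniform_measure lborel {0..<1})"
    unfolding circle_measure_def
    by (intro nn_integral_distr m) (use borel_measurable_circle[OF assms] in \<open>simp add: circle_measure_def\<close>)
  also have "\<dots> = (\<integral>\<^sup>+t. f (cis (2 * pi * t)) * indicator {0..<1} t \<partial>lborel)"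
    by (subst nn_integral_uniform_measure) (auto simp: divide_ennreal_def)
  also have "\<dots> = (\<integral>\<^sup>+t. f (cis (2 * pi * t)) * indicator {0..1} t \<partial>lborel)"
    by (intro nn_integral_cong_AE AE_I[of _ _ "{1}"]) (auto split: split_indicator)
  finally show ?thesis .
qed

lemma integrable_circle:
  fixes f :: "complex \<Rightarrow> 'b::{banach,second_countable_topology}"
  assumes "continuous_on UNIV f"
  shows "integrable circle_measure f"
proof -
  interpret prob_space circle_measure by (rule prob_space_circle_measure)
  have "compact (f ` sphere 0 1)"
    using assms by (intro compact_continuous_image) (auto intro: continuous_on_subset)
  then obtain B where "\<And>y. y \<in> f ` sphere 0 1 \<Longrightarrow> norm y \<le> B"
    using compact_imp_bounded bounded_iff by metis
  then show ?thesis
    using assms by (intro integrable_const_bound[of _ B] AE_I2 borel_measurable_circle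
        borel_measurable_continuous_onI) (auto simp: space_circle_measure)
qed

lemma integral_circle_rotate:
  fixes f :: "complex \<Rightarrow> 'b::{banach,second_countable_topology}"
  assumes "f \<in> borel_measurable borel" and w: "cmod w = 1"
  shows "(\<integral>x. f (w * x) \<partial>circle_measure) = (\<integral>x. f x \<partial>circle_measure)"
proof -
  have "(\<lambda>z. w * z) \<in> circle_measure \<rightarrow>\<^sub>M circle_measure"
    using mult_circle_measurable[OF w] by (simp cong: measurable_cong_sets add: sets_circle_measure)
  from integral_distr[OF this borel_measurable_circle[OF assms(1)]] show ?thesis
    by (simp add: circle_measure_rotate[OF w])
qed

lemma integral_circle_power_cnj_power:
  "(\<integral>x. x ^ k * cnj x ^ l \<partial>circle_measure) = (if k = l then 1 else 0)"
proof (cases "k = l")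
  case True
  interpret prob_space circle_measure by (rule prob_space_circle_measure)
  have "(\<integral>x. x ^ k * cnj x ^ l \<partial>circle_measure) = (\<integral>x. 1 \<partial>circle_measure)"
    using True by (intro Bochner_Integration.integral_cong)
      (auto simp: space_circle_measure power_mult_distrib[symmetric] complex_norm_square[symmetric])
  then show ?thesis using True prob_space by simp
next
  case False
  \<comment> \<open>Rotation by this angle multiplies the integrand by -1, so by invariance the
    integral equals its own negative.\<close>
  define w where "w = cis (pi / (real k - real l))"
  have "w ^ k * cnj w ^ l = cis (real k * (pi / (real k - real l)) - real l * (pi / (real k - real l)))"
    by (simp add: w_def Complex.DeMoivre cis_cnj cis_mult)
  also have "real k * (pi / (real k - real l)) - real l * (pi / (real k - real l)) = pi"
    using False by (simp flip: left_diff_distrib diff_divide_distrib)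
  finally have w: "w ^ k * cnj w ^ l = -1" by simp
  have "(\<integral>x. x ^ k * cnj x ^ l \<partial>circle_measure) = (\<integral>x. (w * x) ^ k * cnj (w * x) ^ l \<partial>circle_measure)"
    by (intro integral_circle_rotate[symmetric] borel_measurable_continuous_onI continuous_intros)
      (auto simp: w_def)
  also have "\<dots> = (\<integral>x. (w ^ k * cnj w ^ l) * (x ^ k * cnj x ^ l) \<partial>circle_measure)"
    by (simp add: power_mult_distrib mult_ac)
  also have "\<dots> = - (\<integral>x. x ^ k * cnj x ^ l \<partial>circle_measure)"
    by (simp add: w)
  finally show ?thesis using False by simp
qed

lemma measurable_torus_component [measurable]:
  "(\<lambda>z. z j) \<in> borel_measurable torus_measure"
proof -
  have "(\<lambda>z. z j) \<in> torus_measure \<rightarrow>\<^sub>M circle_measure"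
    unfolding torus_measure_def by measurable
  then show ?thesis
    by (rule measurable_compose[of _ _ circle_measure "\<lambda>x. x"]) (intro borel_measurable_circle, simp)
qed

text \<open>Freezing coordinates inside the disc leaves the torus, so the lifts are treated as
  measurable on the full product of planes; this inclusion carries that measurability back to the
  torus.\<close>

lemma measurable_torus_borel:
  "(\<lambda>z. z) \<in> torus_measure \<rightarrow>\<^sub>M PiM UNIV (\<lambda>_. borel)"
  by (rule measurable_PiM_single') (auto simp: PiE_def extensional_def)

text \<open>Resampling one coordinate does not change a product of probability measures. With the
  whole torus kept as the outer space, inductions over finite sets of coordinates never change the
  measure space.\<close>

lemma nn_integral_torus_coordinate:
  assumes "f \<in> borel_measurable torus_measure"
  shows "(\<integral>\<^sup>+z. f z \<partial>torus_measure) = (\<integral>\<^sup>+z. \<integral>\<^sup>+x. f (z(j := x)) \<partial>circle_measure \<partial>torus_measure)"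
proof -
  interpret C: prob_space circle_measure by (rule prob_space_circle_measure)
  interpret T: prob_space torus_measure by (rule prob_space_torus_measure)
  interpret P: pair_sigma_finite circle_measure torus_measure ..
  have eq: "torus_measure = distr (circle_measure \<Otimes>\<^sub>M torus_measure) torus_measure (\<lambda>(x, z). z(j := x))"
    using distr_pair_PiM_eq_PiM[of UNIV "\<lambda>_. circle_measure" j] prob_space_circle_measure
    by (simp add: torus_measure_def)
  have m: "(\<lambda>(x, z). z(j := x)) \<in> circle_measure \<Otimes>\<^sub>M torus_measure \<rightarrow>\<^sub>M torus_measure"
    unfolding torus_measure_def split_beta'
    by (rule measurable_fun_upd[where J=UNIV]) auto
  have "(\<integral>\<^sup>+z. f z \<partial>torus_measure) = (\<integral>\<^sup>+xz. f ((\<lambda>(x, z). z(j := x)) xz) \<partial>(circle_measure \<Otimes>\<^sub>M torus_measure))"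
    by (subst eq, subst nn_integral_distr[OF m]) (use assms in \<open>simp_all flip: eq\<close>)
  also have "\<dots> = (\<integral>\<^sup>+z. \<integral>\<^sup>+x. f (z(j := x)) \<partial>circle_measure \<partial>torus_measure)"
    by (subst P.nn_integral_snd[symmetric]) (use measurable_compose[OF m assms] in auto)
  finally show ?thesis .
qed

lemma mult_fun_measurable [measurable]:
  "(\<lambda>z. mult_fun z n) \<in> borel_measurable torus_measure"
  unfolding mult_fun_def by measurable

section \<open>Sums over primes\<close>

text \<open>A telescoping form of the comparison with an integral: by the mean value theorem each
  term from 2 on is at most an increment of - (t powr - x) / x. Arbitrary finite sets are allowed so
  that primes and squarefree numbers are covered alike.\<close>

lemma sum_powr_le:
  fixes x :: real
  assumes x: "x > 0" and A: "finite A" "0 \<notin> A"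
  shows "(\<Sum>n\<in>A. real n powr - (1 + x)) \<le> 1 + 1 / x"
proof -
  have step: "real (Suc n) powr - (1 + x) \<le> real n powr - x / x - real (Suc n) powr - x / x"
    if n: "n > 0" for n
  proof -
    have "\<exists>z. real n < z \<and> z < real (Suc n) \<and>
        real (Suc n) powr - x - real n powr - x = (real (Suc n) - real n) * (- x * z powr (- x - 1))"
      using n by (intro MVT2) (auto intro!: derivative_eq_intros)
    then obtain z where z: "real n < z" "z < real (Suc n)"
      and eq: "real (Suc n) powr - x - real n powr - x = - x * z powr (- x - 1)"
      by auto
    have "real (Suc n) powr - (1 + x) \<le> z powr - (1 + x)"
      using z n x by (intro powr_mono2') auto
    also have "\<dots> = real n powr - x / x - real (Suc n) powr - x / x"
    proof -
      have "- (1 + x) = - x - 1" by simp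
      moreover have "real n powr - x - real (Suc n) powr - x = x * z powr (- x - 1)"
        using eq by simp
      ultimately show ?thesis
        using x by (simp only: diff_divide_distrib[symmetric] nonzero_mult_div_cancel_left)
    qed
    finally show ?thesis .
  qed
  have partial: "(\<Sum>n=1..N. real n powr - (1 + x)) \<le> 1 + 1 / x - real N powr - x / x" if "N \<ge> 1" for N
    using that
  proof (induction N rule: dec_induct)
    case (step N)
    then show ?case using assms(1) that step.IH \<open>\<And>n. n > 0 \<Longrightarrow> _\<close>[of N] by simp
  qed simp
  define N where "N = Suc (Max (insert 0 A))"
  have "A \<subseteq> {1..N}"
    using A by (auto simp: N_def Suc_le_eq intro!: le_SucI Max_ge intro: gr0I)
  then have "(\<Sum>n\<in>A. real n powr - (1 + x)) \<le> (\<Sum>n=1..N. real n powr - (1 + x))"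
    by (intro sum_mono2) auto
  also have "\<dots> \<le> 1 + 1 / x - real N powr - x / x"
    by (rule partial) (simp add: N_def)
  also have "\<dots> \<le> 1 + 1 / x"
    using x by simp
  finally show ?thesis .
qed

lemma inj_on_prod_nth_prime: "inj_on (\<lambda>B. \<Prod>j\<in>B. nth_prime j) {B. finite B}"
proof (rule inj_onI)
  have eq: "nth_prime i dvd nth_prime j \<longleftrightarrow> i = j" for i j
    using primes_dvd_imp_eq[OF prime_nth_prime prime_nth_prime, of i j] injD[OF inj_nth_prime, of i j]
    by auto
  have dvd: "nth_prime i dvd (\<Prod>j\<in>B. nth_prime j) \<longleftrightarrow> i \<in> B" if "finite B" for i B
  proof -
    have "nth_prime i dvd (\<Prod>j\<in>B. nth_prime j) \<longleftrightarrow> (\<exists>j\<in>B. nth_prime i dvd nth_prime j)"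
      using that by (intro prime_dvd_prod_iff prime_nth_prime)
    also have "\<dots> \<longleftrightarrow> i \<in> B"
      using eq by simp
    finally show ?thesis .
  qed
  fix B B' assume "B \<in> {B. finite B}" "B' \<in> {B. finite B}"
    and "(\<Prod>j\<in>B. nth_prime j) = (\<Prod>j\<in>B'. nth_prime j)"
  then show "B = B'"
    using dvd[of B] dvd[of B'] by (intro set_eqI) simp
qed

text \<open>Euler's argument: the product of the factors \<open>a j + 1\<close> expands into a sum
  over distinct squarefree integers, hence is at most 1 + 1 / x, and taking logarithms costs only
  the convergent sum of squares. The coefficient 1 of the logarithm is what counts, as it decides
  the powers of \<sigma> later on. The second bound is crude and serves for the fixed exponent
  3/2.\<close>

lemma sum_nth_prime_powr_le:
  fixes x :: real
  assumes x: "x > 0" and J: "finite J"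
  shows "(\<Sum>j\<in>J. real (nth_prime j) powr - (1 + x)) \<le> ln (1 + 1 / x) + 2"
    and "(\<Sum>j\<in>J. real (nth_prime j) powr - (1 + x)) \<le> 1 + 1 / x"
proof -
  have pos: "nth_prime j > 0" for j
    using prime_nth_prime prime_gt_0_nat by blast
  have sub: "(\<Sum>j\<in>J. real (nth_prime j) powr - (1 + y)) \<le> 1 + 1 / y" if "y > 0" for y
  proof -
    have "(\<Sum>j\<in>J. real (nth_prime j) powr - (1 + y)) = (\<Sum>n\<in>nth_prime ` J. real n powr - (1 + y))"
      by (subst sum.reindex) (auto intro: inj_on_subset[OF inj_nth_prime])
    also have "\<dots> \<le> 1 + 1 / y"
      using J pos that by (intro sum_powr_le) (auto simp: image_iff)
    finally show ?thesis .
  qed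
  show "(\<Sum>j\<in>J. real (nth_prime j) powr - (1 + x)) \<le> 1 + 1 / x"
    by (rule sub) fact
  define a where "a j = real (nth_prime j) powr - (1 + x)" for j
  have ge1: "real (nth_prime j) \<ge> 1" for j
    using pos[of j] by linarith
  have a: "0 < a j" "a j \<le> 1" for j
    using pos[of j] ge1[of j] x powr_mono[of "- (1 + x)" 0 "real (nth_prime j)"] by (auto simp: a_def)
  have "(\<Prod>j\<in>J. a j + 1) = (\<Sum>B\<in>Pow J. \<Prod>j\<in>B. a j)"
    using J by (subst prod_add) auto
  also have "\<dots> = (\<Sum>B\<in>Pow J. real (\<Prod>j\<in>B. nth_prime j) powr - (1 + x))"
    by (simp add: a_def prod_powr_distrib)
  also have "\<dots> = (\<Sum>n\<in>(\<lambda>B. \<Prod>j\<in>B. nth_prime j) ` Pow J. real n powr - (1 + x))"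
    using J by (subst sum.reindex)
      (auto intro!: inj_on_subset[OF inj_on_prod_nth_prime] intro: finite_subset)
  also have "\<dots> \<le> 1 + 1 / x"
  proof (intro sum_powr_le x)
    have "(\<Prod>j\<in>B. nth_prime j) > 0" for B
      using pos by (rule prod_pos)
    then show "0 \<notin> (\<lambda>B. \<Prod>j\<in>B. nth_prime j) ` Pow J"
      by (metis imageE less_irrefl)
  qed (use J in simp)
  finally have P: "(\<Prod>j\<in>J. a j + 1) \<le> 1 + 1 / x" .
  have "(\<Sum>j\<in>J. a j) \<le> (\<Sum>j\<in>J. ln (a j + 1) + (a j)\<^sup>2)"
    using ln_one_plus_pos_lower_bound[of "a _"] a
    by (intro sum_mono) (smt (verit, best) less_imp_le)
  also have "\<dots> = ln (\<Prod>j\<in>J. a j + 1) + (\<Sum>j\<in>J. (a j)\<^sup>2)"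
  proof -
    have "a j + 1 \<noteq> 0" for j
      using a(1)[of j] by linarith
    then show ?thesis
      using J by (subst ln_prod) (auto simp: sum.distrib)
  qed
  also have "ln (\<Prod>j\<in>J. a j + 1) \<le> ln (1 + 1 / x)"
    using P a by (intro ln_mono) (auto intro!: prod_pos add_pos_pos)
  also have "(\<Sum>j\<in>J. (a j)\<^sup>2) \<le> (\<Sum>j\<in>J. real (nth_prime j) powr - (1 + 1))"
  proof (rule sum_mono)
    fix j
    have "(a j)\<^sup>2 = real (nth_prime j) powr - (2 + 2 * x)"
      using pos[of j] by (simp add: a_def powr_power algebra_simps)
    also have "\<dots> \<le> real (nth_prime j) powr - (1 + 1)"
      using ge1[of j] x by (intro powr_mono) auto
    finally show "(a j)\<^sup>2 \<le> real (nth_prime j) powr - (1 + 1)" .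
  qed
  also have "\<dots> \<le> 2"
    using sub[of 1] by simp
  finally show "(\<Sum>j\<in>J. real (nth_prime j) powr - (1 + x)) \<le> ln (1 + 1 / x) + 2"
    by (simp add: a_def)
qed

section \<open>Unique factorization along the enumerated primes\<close>

lemma range_nth_prime: "range nth_prime = {p. prime p}"
  using range_enumerate[OF primes_infinite] by (simp add: nth_prime_def)

lemma prod_nth_prime_power_multiplicity:
  assumes "n > 0" "finite J" "{j. nth_prime j dvd n} \<subseteq> J"
  shows "(\<Prod>j\<in>J. nth_prime j ^ multiplicity (nth_prime j) n) = n"
proof -
  have "(\<Prod>j\<in>J. nth_prime j ^ multiplicity (nth_prime j) n) =
      (\<Prod>j | nth_prime j dvd n. nth_prime j ^ multiplicity (nth_prime j) n)"
    using assms by (intro prod.mono_neutral_right) (auto simp: not_dvd_imp_multiplicity_0)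
  also have "\<dots> = (\<Prod>p\<in>nth_prime ` {j. nth_prime j dvd n}. p ^ multiplicity p n)"
    by (subst prod.reindex) (auto intro: inj_on_subset[OF inj_nth_prime])
  also have "nth_prime ` {j. nth_prime j dvd n} = prime_factors n"
  proof -
    have "{j. nth_prime j dvd n} = nth_prime -` {p. p dvd n}" by auto
    then have "nth_prime ` {j. nth_prime j dvd n} = {p. p dvd n} \<inter> {p. prime p}"
      by (simp only: image_vimage_eq range_nth_prime)
    also have "\<dots> = prime_factors n"
      using assms(1) by (auto simp: prime_factors_dvd)
    finally show ?thesis .
  qed
  also have "(\<Prod>p\<in>prime_factors n. p ^ multiplicity p n) = n"
    using assms(1) by (simp add: prod_prime_factors)
  finally show ?thesis .
qed

lemma prod_nth_prime_powr_multiplicity: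
  assumes "n > 0" "finite J" "{j. nth_prime j dvd n} \<subseteq> J"
  shows "(\<Prod>j\<in>J. (real (nth_prime j) powr s) ^ multiplicity (nth_prime j) n) = real n powr s"
proof -
  have "real n powr s = real (\<Prod>j\<in>J. nth_prime j ^ multiplicity (nth_prime j) n) powr s"
    using prod_nth_prime_power_multiplicity[OF assms] by simp
  also have "\<dots> = (\<Prod>j\<in>J. (real (nth_prime j) ^ multiplicity (nth_prime j) n) powr s)"
    by (simp add: prod_powr_distrib)
  also have "\<dots> = (\<Prod>j\<in>J. (real (nth_prime j) powr s) ^ multiplicity (nth_prime j) n)"
    using prime_gt_0_nat[OF prime_nth_prime]
    by (intro prod.cong refl) (simp add: powr_power powr_powr powr_realpow[symmetric] mult.commute)
  finally show ?thesis ..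
qed

section \<open>Subharmonicity\<close>

text \<open>Zeros of a polynomial on the unit circle make a factor 1 - b z vanish at a boundary
  point, so continuity of the principal root is needed at 0 as well, where it is not
  holomorphic.\<close>

lemma continuous_on_csqrt_halfplane: "continuous_on {z. 0 \<le> Re z} csqrt"
proof (rule continuous_on_eq_continuous_within[THEN iffD2], rule ballI)
  fix z assume "z \<in> {z. 0 \<le> Re z}"
  then have z: "0 \<le> Re z" by simp
  show "continuous (at z within {z. 0 \<le> Re z}) csqrt"
  proof (cases "z = 0")
    case True
    have "((\<lambda>w. sqrt (cmod w)) \<longlongrightarrow> sqrt (cmod 0)) (at 0)"
      by (intro tendsto_intros)
    then have "(csqrt \<longlongrightarrow> 0) (at 0)"
      by (subst tendsto_norm_zero_iff[symmetric]) simp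
    then have "isCont csqrt 0"
      by (simp add: isCont_def)
    then show ?thesis
      using True continuous_at_imp_continuous_at_within by blast
  next
    case False
    then have "z \<notin> \<real>\<^sub>\<le>\<^sub>0"
      using z by (auto simp: complex_nonpos_Reals_iff complex_eq_iff)
    then show ?thesis by (rule continuous_within_csqrt)
  qed
qed

lemma norm_csqrt_squared: "(cmod (csqrt z))\<^sup>2 = cmod z"
  by (metis norm_power power2_csqrt)

text \<open>The values 1 - b z have nonnegative real part on the closed disc and positive real part
  inside, so the principal branch applies to each linear factor. A product of such roots replaces
  the choice of a branch for a whole polynomial.\<close>

lemma csqrt_linear_factor:
  assumes "cmod b \<le> 1"
  shows "continuous_on (cball 0 1) (\<lambda>z. csqrt (1 - b * z))"
    and "(\<lambda>z. csqrt (1 - b * z)) holomorphic_on ball 0 1"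
proof -
  have le: "Re (b * z) \<le> cmod z" for z
    by (rule order_trans[OF complex_Re_le_cmod]) (use assms in \<open>auto simp: norm_mult mult_left_le_one_le\<close>)
  show "continuous_on (cball 0 1) (\<lambda>z. csqrt (1 - b * z))"
  proof (rule continuous_on_compose2[OF continuous_on_csqrt_halfplane])
    have "0 \<le> Re (1 - b * z)" if "cmod z \<le> 1" for z
      using le[of z] that by (simp del: times_complex.sel)
    then show "(\<lambda>z. 1 - b * z) ` cball 0 1 \<subseteq> {z. 0 \<le> Re z}"
      by (auto simp del: times_complex.sel minus_complex.sel)
  qed (intro continuous_intros)
  show "(\<lambda>z. csqrt (1 - b * z)) holomorphic_on ball 0 1"
  proof (rule holomorphic_on_csqrt')
    fix z :: complex assume "z \<in> ball 0 1"
    then have "0 < Re (1 - b * z)"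
      using le[of z] by (auto simp del: times_complex.sel)
    then show "1 - b * z \<notin> \<real>\<^sub>\<le>\<^sub>0"
      by (auto simp: complex_nonpos_Reals_iff simp del: times_complex.sel)
  qed (intro holomorphic_intros)
qed

text \<open>This inequality and its equality case on the circle both rest on the identity |1 - cnj a
  z|^2 - |z - a|^2 = (1 - |a|^2) (1 - |z|^2).\<close>

lemma norm_diff_le_reflected:
  assumes "cmod a \<le> 1" "cmod z \<le> 1"
  shows "cmod (z - a) \<le> cmod (1 - cnj a * z)"
proof -
  have "(cmod (1 - cnj a * z))\<^sup>2 - (cmod (z - a))\<^sup>2 = (1 - (cmod a)\<^sup>2) * (1 - (cmod z)\<^sup>2)"
    unfolding cmod_power2 by (simp add: algebra_simps power2_eq_square)
  also have "\<dots> \<ge> 0"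
    using assms by (intro mult_nonneg_nonneg) (auto simp: power_le_one)
  finally show ?thesis
    by (intro power2_le_imp_le[OF _ norm_ge_zero]) simp
qed

lemma norm_diff_eq_reflected:
  assumes "cmod z = 1"
  shows "cmod (z - a) = cmod (1 - cnj a * z)"
proof -
  have "(cmod (1 - cnj a * z))\<^sup>2 - (cmod (z - a))\<^sup>2 = (1 - (cmod a)\<^sup>2) * (1 - (cmod z)\<^sup>2)"
    unfolding cmod_power2 by (simp add: algebra_simps power2_eq_square)
  also have "\<dots> = 0" using assms by simp
  finally have "(cmod (z - a))\<^sup>2 = (cmod (1 - cnj a * z))\<^sup>2" by simp
  then show ?thesis
    by (simp add: power2_eq_iff_nonneg)
qed

text \<open>The square root of the outer part of a polynomial: the zeros inside the disc are
  reflected in the circle.\<close>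

lemma poly_outer_sqrt:
  fixes p :: "complex poly"
  shows "\<exists>h. continuous_on (cball 0 1) h \<and> h holomorphic_on ball 0 1 \<and>
    (\<forall>z. cmod z = 1 \<longrightarrow> (cmod (h z))\<^sup>2 = cmod (poly p z)) \<and>
    (\<forall>z. cmod z \<le> 1 \<longrightarrow> cmod (poly p z) \<le> (cmod (h z))\<^sup>2)"
proof (induction "degree p" arbitrary: p rule: less_induct)
  case less
  show ?case
  proof (cases "degree p = 0")
    case True
    then obtain c where "p = [:c:]" using degree_eq_zeroE by blast
    then show ?thesis
      by (intro exI[of _ "\<lambda>_. csqrt c"]) (auto simp: norm_csqrt_squared)
  next
    case False
    then obtain a where "poly p a = 0"
      using Fundamental_Theorem_Algebra.fundamental_theorem_of_algebra[of p] by (auto simp: constant_degree)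
    then obtain q where q: "p = [:- a, 1:] * q"
      by (auto simp: poly_eq_0_iff_dvd)
    have "q \<noteq> 0" using q False by auto
    then have "degree q < degree p"
      unfolding q by (subst degree_mult_eq) auto
    from less.hyps[OF this] obtain h where h: "continuous_on (cball 0 1) h" "h holomorphic_on ball 0 1"
      "\<And>z. cmod z = 1 \<Longrightarrow> (cmod (h z))\<^sup>2 = cmod (poly q z)"
      "\<And>z. cmod z \<le> 1 \<Longrightarrow> cmod (poly q z) \<le> (cmod (h z))\<^sup>2"
      by blast
    \<comment> \<open>A zero inside the disc is reflected, which keeps the modulus on the circle and
      can only increase it inside. Otherwise the factor is kept exactly, as z - a = - a (1 - z / a),
      and merely normalized so that \<open>cmod b \<le> 1\<close>.\<close>
    define b c where "b = (if cmod a < 1 then cnj a else 1 / a)"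
      and "c = (if cmod a < 1 then 1 else - a)"
    have b: "cmod b \<le> 1" by (auto simp: b_def norm_divide divide_simps)
    have 1: "cmod (z - a) = cmod c * cmod (1 - b * z)" if "cmod z = 1" for z
    proof (cases "cmod a < 1")
      case False
      then have "z - a = (- a) * (1 - 1 / a * z)" by (auto simp: field_simps)
      then show ?thesis
        using False by (simp only: b_def c_def if_False norm_mult)
    qed (use norm_diff_eq_reflected[OF that, of a] in \<open>simp add: b_def c_def\<close>)
    have 2: "cmod (z - a) \<le> cmod c * cmod (1 - b * z)" if "cmod z \<le> 1" for z
    proof (cases "cmod a < 1")
      case False
      then have "z - a = (- a) * (1 - 1 / a * z)" by (auto simp: field_simps)
      then show ?thesis
        using False by (simp only: b_def c_def if_False norm_mult order_refl)
    qed (use norm_diff_le_reflected[OF _ that, of a] in \<open>simp add: b_def c_def\<close>)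
    let ?h = "\<lambda>z. csqrt c * csqrt (1 - b * z) * h z"
    have sq: "(cmod (?h z))\<^sup>2 = cmod c * cmod (1 - b * z) * (cmod (h z))\<^sup>2" for z
      by (simp add: norm_mult power_mult_distrib norm_csqrt_squared)
    have pz: "cmod (poly p z) = cmod (z - a) * cmod (poly q z)" for z
    proof -
      have "poly p z = (z - a) * poly q z" by (simp add: q algebra_simps)
      then show ?thesis by (simp only: norm_mult)
    qed
    show ?thesis
    proof (intro exI[of _ ?h] conjI allI impI)
      show "continuous_on (cball 0 1) ?h" "?h holomorphic_on ball 0 1"
        using csqrt_linear_factor[OF b] h by (auto intro!: continuous_intros holomorphic_intros)
      show "(cmod (?h z))\<^sup>2 = cmod (poly p z)" if "cmod z = 1" for z
        using h(3)[OF that] 1[OF that] by (simp add: sq pz)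
      show "cmod (poly p z) \<le> (cmod (?h z))\<^sup>2" if "cmod z \<le> 1" for z
        unfolding sq pz using h(4)[OF that] 2[OF that] by (intro mult_mono) auto
    qed
  qed
qed

text \<open>On the circle |u - w| = |1 - cnj w u|, so the modulus of the Cauchy kernel is that of
  the Szego kernel.\<close>

lemma norm_Cauchy_integral_le:
  assumes h: "continuous_on (cball 0 1) h" "h holomorphic_on ball 0 1" and w: "cmod w < 1"
  shows "ennreal (cmod (h w)) \<le>
    (\<integral>\<^sup>+t. ennreal (cmod (h (cis (2 * pi * t))) / cmod (1 - cnj w * cis (2 * pi * t))) * indicator {0..1} t \<partial>lborel)"
proof -
  let ?c = "\<lambda>t. cis (2 * pi * t)"
  let ?g = "\<lambda>t. cmod (h (?c t)) / cmod (1 - cnj w * ?c t)"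
  have "((\<lambda>u. h u / (u - w)) has_contour_integral (2 * of_real pi * \<i> * h w)) (circlepath 0 1)"
    using h w by (intro Cauchy_integral_circlepath) auto
  then have "((\<lambda>t. h (circlepath 0 1 t) / (circlepath 0 1 t - w) *
      vector_derivative (circlepath 0 1) (at t within {0..1})) has_integral (2 * of_real pi * \<i> * h w)) {0..1}"
    by (simp only: has_contour_integral_def)
  then have int: "((\<lambda>t. h (?c t) / (?c t - w) * (2 * pi * \<i> * ?c t)) has_integral (2 * of_real pi * \<i> * h w)) {0..1}"
    by (rule has_integral_eq[rotated])
      (simp add: vector_derivative_circlepath01, simp add: circlepath cis_conv_exp mult_ac)
  have nz: "1 - cnj w * ?c t \<noteq> 0" for t
  proof
    assume "1 - cnj w * ?c t = 0"
    then have "cmod (cnj w * ?c t) = 1" by simp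
    then show False using w by (simp add: norm_mult)
  qed
  have "continuous_on {0..1} (\<lambda>t. h (?c t))"
    by (rule continuous_on_compose2[OF h(1)]) (auto intro!: continuous_intros)
  then have "continuous_on {0..1} ?g"
    using nz by (intro continuous_intros) auto
  then have g: "?g integrable_on {0..1}"
    by (rule integrable_continuous_interval)
  have "2 * pi * cmod (h w) = cmod (integral {0..1} (\<lambda>t. h (?c t) / (?c t - w) * (2 * pi * \<i> * ?c t)))"
    using int by (simp add: integral_unique norm_mult)
  also have "\<dots> \<le> integral {0..1} (\<lambda>t. 2 * pi * ?g t)"
  proof (rule integral_norm_bound_integral)
    show "(\<lambda>t. 2 * pi * ?g t) integrable_on {0..1}"
      by (intro integrable_on_mult_right g)
    show "cmod (h (?c t) / (?c t - w) * (2 * pi * \<i> * ?c t)) \<le> 2 * pi * ?g t" for t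
      using norm_diff_eq_reflected[of "?c t" w] by (simp add: norm_mult norm_divide mult.commute)
  qed (use int in blast)
  also have "\<dots> = 2 * pi * integral {0..1} ?g" by (rule integral_mult_right)
  finally have "cmod (h w) \<le> integral {0..1} ?g" by simp
  then have "ennreal (cmod (h w)) \<le> ennreal (integral {0..1} ?g)" by (rule ennreal_leI)
  also have "\<dots> = (\<integral>\<^sup>+t. ennreal (?g t) * indicator {0..1} t \<partial>lborel)"
    using g by (intro nn_integral_has_integral_lebesgue'[symmetric]) (simp_all add: integrable_integral)
  finally show ?thesis .
qed

text \<open>Cauchy's formula is applied to the outer root h instead of p, with |p| \<le> |h|^2 at w
  and |p| = |h|^2 on the circle. The Szego kernel thus enters to the first power while |p| enters to
  the power 1/2.\<close>

lemma sqrt_norm_poly_le: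
  fixes p :: "complex poly"
  assumes w: "cmod w < 1"
  shows "ennreal (sqrt (cmod (poly p w))) \<le>
    (\<integral>\<^sup>+x. ennreal (sqrt (cmod (poly p x)) * (1 / cmod (1 - cnj w * x))) \<partial>circle_measure)"
proof -
  obtain h where h: "continuous_on (cball 0 1) h" "h holomorphic_on ball 0 1"
      "\<And>z. cmod z = 1 \<Longrightarrow> (cmod (h z))\<^sup>2 = cmod (poly p z)"
      "\<And>z. cmod z \<le> 1 \<Longrightarrow> cmod (poly p z) \<le> (cmod (h z))\<^sup>2"
    using poly_outer_sqrt[of p] by blast
  have "sqrt (cmod (poly p w)) \<le> cmod (h w)"
    using h(4)[of w] w by (intro real_le_lsqrt) auto
  then have "ennreal (sqrt (cmod (poly p w))) \<le> ennreal (cmod (h w))" by (rule ennreal_leI)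
  also note norm_Cauchy_integral_le[OF h(1,2) w]
  also have "(\<integral>\<^sup>+t. ennreal (cmod (h (cis (2 * pi * t))) / cmod (1 - cnj w * cis (2 * pi * t))) * indicator {0..1} t \<partial>lborel)
    = (\<integral>\<^sup>+t. ennreal (sqrt (cmod (poly p (cis (2 * pi * t)))) * (1 / cmod (1 - cnj w * cis (2 * pi * t)))) * indicator {0..1} t \<partial>lborel)"
    by (simp flip: h(3))
  also have "\<dots> = (\<integral>\<^sup>+x. ennreal (sqrt (cmod (poly p x)) * (1 / cmod (1 - cnj w * x))) \<partial>circle_measure)"
  proof (rule nn_integral_circle[symmetric])
    have [measurable]: "(\<lambda>x. poly p x) \<in> borel_measurable borel"
      by (intro borel_measurable_continuous_onI continuous_intros)
    show "(\<lambda>x. ennreal (sqrt (cmod (poly p x)) * (1 / cmod (1 - cnj w * x)))) \<in> borel_measurable borel"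
      by measurable
  qed
  finally show ?thesis .
qed

section \<open>Iteration of the disc inequality over the coordinates\<close>

text \<open>Being a polynomial in each coordinate, the others held fixed, is all that the
  one-variable inequality asks for, and it survives the freezing of a coordinate.\<close>

definition sep_poly :: "(('i \<Rightarrow> complex) \<Rightarrow> complex) \<Rightarrow> bool" where
  "sep_poly F \<longleftrightarrow> (\<forall>z j. \<exists>p. \<forall>x. F (z(j := x)) = poly p x)"

lemma sep_poly_const: "sep_poly (\<lambda>z. c)"
  unfolding sep_poly_def by (auto intro!: exI[of _ "[:c:]"])

lemma sep_poly_component: "sep_poly (\<lambda>z. z i)"
  unfolding sep_poly_def
proof (intro allI)
  fix z :: "'a \<Rightarrow> complex" and j
  show "\<exists>p. \<forall>x. (z(j := x)) i = poly p x"
    by (cases "i = j") (auto intro: exI[of _ "[:0, 1:]"] exI[of _ "[:z i:]"])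
qed

lemma sep_poly_add: "sep_poly F \<Longrightarrow> sep_poly G \<Longrightarrow> sep_poly (\<lambda>z. F z + G z)"
  unfolding sep_poly_def by (metis poly_add)

lemma sep_poly_mult: "sep_poly F \<Longrightarrow> sep_poly G \<Longrightarrow> sep_poly (\<lambda>z. F z * G z)"
  unfolding sep_poly_def by (metis poly_mult)

lemma sep_poly_sum: "(\<And>i. i \<in> A \<Longrightarrow> sep_poly (F i)) \<Longrightarrow> sep_poly (\<lambda>z. \<Sum>i\<in>A. F i z)"
  by (induction A rule: infinite_finite_induct) (auto intro: sep_poly_const sep_poly_add)

lemma sep_poly_prod: "(\<And>i. i \<in> A \<Longrightarrow> sep_poly (F i)) \<Longrightarrow> sep_poly (\<lambda>z. \<Prod>i\<in>A. F i z)"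
  by (induction A rule: infinite_finite_induct) (auto intro: sep_poly_const sep_poly_mult)

lemma sep_poly_power: "sep_poly F \<Longrightarrow> sep_poly (\<lambda>z. F z ^ n)"
  by (induction n) (auto intro: sep_poly_const sep_poly_mult)

lemma sep_poly_bohr_lift: "sep_poly (bohr_lift a)"
  unfolding bohr_lift_def mult_fun_def
  by (rule sep_poly_sum, rule sep_poly_mult, rule sep_poly_const, rule sep_poly_prod,
      rule sep_poly_power, rule sep_poly_component)

text \<open>The point at which the kernel reproduces has real coordinates \<open>r j\<close>, so the
  conjugate in 1 / (1 - cnj w z) disappears.\<close>

definition abs_szego :: "nat set \<Rightarrow> (nat \<Rightarrow> real) \<Rightarrow> (nat \<Rightarrow> complex) \<Rightarrow> real" where
  "abs_szego J r z = (\<Prod>j\<in>J. 1 / cmod (1 - of_real (r j) * z j))"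

lemma abs_szego_nonneg: "abs_szego J r z \<ge> 0"
  by (auto simp: abs_szego_def intro: prod_nonneg)

lemma abs_szego_measurable [measurable]: "abs_szego J r \<in> borel_measurable torus_measure"
  unfolding abs_szego_def by measurable

text \<open>Coordinates are frozen one at a time, each at the price of one kernel factor. The left
  side stays an integral because coordinates outside \<open>J\<close> remain free; once
  \<open>J\<close> contains all variables of \<open>F\<close> its integrand is constant.\<close>

lemma sqrt_norm_sep_poly_le:
  assumes "finite J" "F \<in> borel_measurable (PiM UNIV (\<lambda>_. borel))" "sep_poly F"
    and r: "\<And>j. j \<in> J \<Longrightarrow> \<bar>r j\<bar> < 1"
  shows "(\<integral>\<^sup>+z. ennreal (sqrt (cmod (F (override_on z (\<lambda>j. of_real (r j)) J)))) \<partial>torus_measure) \<le>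
    (\<integral>\<^sup>+z. ennreal (sqrt (cmod (F z)) * abs_szego J r z) \<partial>torus_measure)"
  using assms
proof (induction J arbitrary: F rule: finite_induct)
  case empty
  then show ?case by (simp add: abs_szego_def)
next
  case (insert j J)
  let ?r = "\<lambda>j. complex_of_real (r j)"
  note [measurable] = insert.prems(1) measurable_compose[OF measurable_torus_borel insert.prems(1)]
  \<comment> \<open>The new coordinate is frozen before the induction hypothesis is applied; the
    one-variable inequality then releases it under the integral sign.\<close>
  define F' where "F' = (\<lambda>z. F (z(j := ?r j)))"
  have F': "F' \<in> borel_measurable (PiM UNIV (\<lambda>_. borel))"
    unfolding F'_def
    by (rule measurable_compose[OF _ insert.prems(1)], rule measurable_fun_upd[where J=UNIV]) auto
  have "\<exists>p. \<forall>x. F' (z(i := x)) = poly p x" for z i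
  proof (cases "i = j")
    case True
    then show ?thesis by (intro exI[of _ "[:F (z(j := ?r j)):]"]) (simp add: F'_def)
  next
    case False
    then have "F' (z(i := x)) = F ((z(j := ?r j))(i := x))" for x
      by (simp add: F'_def fun_upd_twist)
    then show ?thesis using insert.prems(2) unfolding sep_poly_def by metis
  qed
  then have sF': "sep_poly F'" by (simp add: sep_poly_def)
  have ov: "override_on z ?r (insert j J) = (override_on z ?r J)(j := ?r j)" for z
    by (auto simp: override_on_def fun_eq_iff)
  have "(\<integral>\<^sup>+z. ennreal (sqrt (cmod (F (override_on z ?r (insert j J))))) \<partial>torus_measure) =
      (\<integral>\<^sup>+z. ennreal (sqrt (cmod (F' (override_on z ?r J)))) \<partial>torus_measure)"
    by (simp add: F'_def ov)
  also have "\<dots> \<le> (\<integral>\<^sup>+z. ennreal (sqrt (cmod (F' z)) * abs_szego J r z) \<partial>torus_measure)"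
    using insert.prems by (intro insert.IH F' sF') auto
  also have "\<dots> \<le> (\<integral>\<^sup>+z. \<integral>\<^sup>+x. ennreal (sqrt (cmod (F (z(j := x)))) * abs_szego (insert j J) r (z(j := x)))
      \<partial>circle_measure \<partial>torus_measure)"
  proof (rule nn_integral_mono)
    fix z :: "nat \<Rightarrow> complex"
    obtain p where p: "\<And>x. F (z(j := x)) = poly p x"
      using insert.prems(2) unfolding sep_poly_def by metis
    have [measurable]: "(\<lambda>x. poly p x) \<in> borel_measurable circle_measure"
      by (intro borel_measurable_circle borel_measurable_continuous_onI continuous_intros)
    have [measurable]: "(\<lambda>x. x) \<in> borel_measurable circle_measure"
      by (intro borel_measurable_circle) simp
    have K: "abs_szego (insert j J) r (z(j := x)) = 1 / cmod (1 - ?r j * x) * abs_szego J r z" for x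
      using insert.hyps by (auto simp: abs_szego_def intro!: prod.cong)
    have "ennreal (sqrt (cmod (F' z)) * abs_szego J r z) =
        ennreal (sqrt (cmod (poly p (?r j)))) * ennreal (abs_szego J r z)"
      by (simp add: F'_def p ennreal_mult abs_szego_nonneg)
    also have "\<dots> \<le> (\<integral>\<^sup>+x. ennreal (sqrt (cmod (poly p x)) * (1 / cmod (1 - ?r j * x))) \<partial>circle_measure) *
        ennreal (abs_szego J r z)"
      using sqrt_norm_poly_le[of "?r j" p] insert.prems(3)[of j] by (intro mult_right_mono) auto
    also have "\<dots> = (\<integral>\<^sup>+x. ennreal (sqrt (cmod (poly p x)) * (1 / cmod (1 - ?r j * x))) *
        ennreal (abs_szego J r z) \<partial>circle_measure)"
      by (intro nn_integral_multc[symmetric]) measurable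
    also have "\<dots> = (\<integral>\<^sup>+x. ennreal (sqrt (cmod (F (z(j := x)))) * abs_szego (insert j J) r (z(j := x))) \<partial>circle_measure)"
      by (simp add: p K abs_szego_nonneg mult.assoc flip: ennreal_mult)
    finally show "ennreal (sqrt (cmod (F' z)) * abs_szego J r z) \<le> \<dots>" .
  qed
  also have "\<dots> = (\<integral>\<^sup>+z. ennreal (sqrt (cmod (F z)) * abs_szego (insert j J) r z) \<partial>torus_measure)"
    by (rule nn_integral_torus_coordinate[symmetric]) measurable
  finally show ?case .
qed

section \<open>The Gram matrix of the kernels\<close>

text \<open>The Taylor polynomial s and the error e satisfy the claim as soon as (s + e)^2 (1 - u)
  \<ge> 1. Here s^2 (1 - u) falls short of 1 by at most 2 |u|^3, while s \<ge> 5/6 and 1 - u \<ge>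
  8/100 give 2 e s (1 - u) \<ge> 2 e / 15, which repays the deficit for e = 16 |u|^3.\<close>

lemma inverse_sqrt_taylor_le:
  fixes u :: real
  assumes "-2 \<le> u" "u \<le> 92/100"
  shows "1 / sqrt (1 - u) \<le> 1 + u / 2 + 3 * u\<^sup>2 / 8 + 16 * \<bar>u\<bar> ^ 3"
proof -
  define s e where "s = 1 + u / 2 + 3 * u\<^sup>2 / 8" and "e = 16 * \<bar>u\<bar> ^ 3"
  have e: "e \<ge> 0" by (simp add: e_def)
  have "s = 5 / 6 + 3 / 8 * (u + 2 / 3)\<^sup>2"
    by (simp add: s_def power2_eq_square field_simps)
  then have s: "s \<ge> 5 / 6" by simp
  have "\<bar>u\<bar> \<le> 2" using assms by linarith
  then have u2: "u\<^sup>2 \<le> 2\<^sup>2" by (metis abs_ge_zero power2_abs power_mono)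
  have "\<bar>5/8 + 15/64 * u + 9/64 * u\<^sup>2\<bar> \<le> 2"
    using assms u2 zero_le_power2[of u] by (simp add: abs_le_iff)
  then have "\<bar>u\<bar> ^ 3 * \<bar>5/8 + 15/64 * u + 9/64 * u\<^sup>2\<bar> \<le> \<bar>u\<bar> ^ 3 * 2"
    by (intro mult_left_mono) auto
  then have "u ^ 3 * (5/8 + 15/64 * u + 9/64 * u\<^sup>2) \<le> 2 * \<bar>u\<bar> ^ 3"
    using abs_ge_self[of "u ^ 3 * (5/8 + 15/64 * u + 9/64 * u\<^sup>2)"] by (simp add: abs_mult power_abs)
  moreover have "s\<^sup>2 * (1 - u) = 1 - u ^ 3 * (5/8 + 15/64 * u + 9/64 * u\<^sup>2)"
    by (simp add: s_def power2_eq_square power3_eq_cube field_simps)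
  ultimately have 1: "s\<^sup>2 * (1 - u) \<ge> 1 - 2 * \<bar>u\<bar> ^ 3" by linarith
  have "(5 / 6) * (8 / 100) \<le> s * (1 - u)"
    using s assms by (intro mult_mono) auto
  then have "e * ((5 / 6) * (8 / 100)) \<le> e * (s * (1 - u))"
    using e by (intro mult_left_mono)
  moreover have "\<bar>u\<bar> ^ 3 \<le> e * ((5 / 6) * (8 / 100))"
    by (simp add: e_def)
  ultimately have 2: "2 * (e * (s * (1 - u))) \<ge> 2 * \<bar>u\<bar> ^ 3"
    by linarith
  have "(s + e)\<^sup>2 * (1 - u) = s\<^sup>2 * (1 - u) + 2 * (e * (s * (1 - u))) + e\<^sup>2 * (1 - u)"
    by (simp add: power2_eq_square algebra_simps)
  also have "\<dots> \<ge> 1"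
  proof -
    have "e\<^sup>2 * (1 - u) \<ge> 0" using assms by simp
    then show ?thesis using 1 2 by linarith
  qed
  finally have "1 \<le> (s + e)\<^sup>2 * (1 - u)" .
  then have "1 \<le> sqrt ((s + e)\<^sup>2 * (1 - u))" by simp
  also have "\<dots> = (s + e) * sqrt (1 - u)"
    using s e by (simp add: real_sqrt_mult)
  finally have "1 \<le> (s + e) * sqrt (1 - u)" .
  then show ?thesis
    using assms by (simp add: divide_le_eq s_def e_def)
qed

lemma norm_one_minus_circle:
  assumes "cmod z = 1"
  shows "cmod (1 - of_real r * z) = sqrt (1 - (2 * r * Re z - r\<^sup>2))"
proof -
  have "(Re z)\<^sup>2 + (Im z)\<^sup>2 = 1"
    using assms by (simp add: cmod_power2[symmetric])
  then have "(1 - r * Re z)\<^sup>2 + (r * Im z)\<^sup>2 = 1 - 2 * r * Re z + r\<^sup>2 * 1"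
    by (simp add: power2_eq_square algebra_simps flip: distrib_left)
  then show ?thesis by (simp add: cmod_def)
qed

text \<open>With x = Re z the left side is (1 - 2 r x + r^2) to the power -1/2, the generating
  function of the Legendre polynomials; the terms kept are 1, x and (3 x^2 - 1) / 2.\<close>

lemma inverse_norm_one_minus_le:
  assumes z: "cmod z = 1" and r: "0 \<le> r" "r\<^sup>2 \<le> 1 / 2"
  shows "1 / cmod (1 - of_real r * z) \<le>
    1 + r * Re z + r\<^sup>2 * ((3 * (Re z)\<^sup>2 - 1) / 2) + 500 * r ^ 3"
proof -
  define x where "x = Re z"
  have x: "\<bar>x\<bar> \<le> 1" using abs_Re_le_cmod[of z] z by (simp add: x_def)
  \<comment> \<open>A rational slightly above 1 / sqrt 2, the coordinate of the prime 2 at \<sigma>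
    = 0; it keeps u below 92/100.\<close>
  have "r\<^sup>2 \<le> (708 / 1000)\<^sup>2" using r by (simp add: power2_eq_square)
  then have r': "r \<le> 708 / 1000" by (rule power2_le_imp_le) simp
  define u where "u = 2 * r * x - r\<^sup>2"
  have rx: "\<bar>r * x\<bar> \<le> r" using x r by (simp add: abs_mult mult_left_le)
  have "r\<^sup>2 \<ge> 0" by simp
  have "(1 - r)\<^sup>2 \<ge> (292 / 1000)\<^sup>2"
    using r' by (intro power_mono) auto
  then have "2 * r - r\<^sup>2 \<le> 92 / 100"
    by (simp add: power2_eq_square algebra_simps)
  then have u1: "u \<le> 92 / 100" using rx by (simp add: u_def)
  have u2: "u \<ge> - 2" using rx r r' by (simp add: u_def)
  have "r\<^sup>2 \<le> r" using r' r by (simp add: power2_eq_square mult_left_le)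
  then have "\<bar>u\<bar> \<le> 3 * r" using rx \<open>r\<^sup>2 \<ge> 0\<close> unfolding u_def by linarith
  then have "\<bar>u\<bar> ^ 3 \<le> (3 * r) ^ 3" by (intro power_mono) auto
  then have u3: "\<bar>u\<bar> ^ 3 \<le> 27 * r ^ 3" by (simp add: power_mult_distrib)
  have "1 / cmod (1 - of_real r * z) = 1 / sqrt (1 - u)"
    by (simp add: norm_one_minus_circle[OF z] u_def x_def)
  also have "\<dots> \<le> 1 + u / 2 + 3 * u\<^sup>2 / 8 + 16 * \<bar>u\<bar> ^ 3"
    by (rule inverse_sqrt_taylor_le[OF u2 u1])
  also have "\<dots> \<le> 1 + u / 2 + 3 * u\<^sup>2 / 8 + 432 * r ^ 3" using u3 by simp
  also have "1 + u / 2 + 3 * u\<^sup>2 / 8 =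
      1 + r * x + r\<^sup>2 * ((3 * x\<^sup>2 - 1) / 2) - 3 / 2 * (r ^ 3 * x) + 3 / 8 * r ^ 4"
    by (simp add: u_def power2_eq_square power3_eq_cube power4_eq_xxxx field_simps)
  finally have "1 / cmod (1 - of_real r * z) \<le> 1 + r * x + r\<^sup>2 * ((3 * x\<^sup>2 - 1) / 2)
      - 3 / 2 * (r ^ 3 * x) + 3 / 8 * r ^ 4 + 432 * r ^ 3" .
  moreover have "r ^ 4 \<le> r ^ 3" using r r' by (intro power_decreasing) auto
  moreover have "- (r ^ 3 * x) \<le> r ^ 3"
    using x mult_left_mono[of "- x" 1 "r ^ 3"] r by simp
  moreover have "0 \<le> r ^ 3" using r by simp
  ultimately show ?thesis unfolding x_def by linarith
qed

lemma integral_circle_Re: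
  "(\<integral>z. Re z \<partial>circle_measure) = 0" "(\<integral>z. (Re z)\<^sup>2 \<partial>circle_measure) = 1 / 2"
proof -
  interpret prob_space circle_measure by (rule prob_space_circle_measure)
  have i: "integrable circle_measure (\<lambda>x. x ^ k * cnj x ^ l)" for k l
    by (intro integrable_circle continuous_intros)
  note i' = i[of 1 0, simplified] i[of 0 1, simplified] i[of 2 0, simplified] i[of 0 2, simplified] i[of 1 1, simplified]
  note o = integral_circle_power_cnj_power
  note o' = o[of 1 0, simplified] o[of 0 1, simplified] o[of 2 0, simplified] o[of 0 2, simplified] o[of 1 1, simplified]
  have "complex_of_real (\<integral>z. Re z \<partial>circle_measure) = (\<integral>z. complex_of_real (Re z) \<partial>circle_measure)"
    by simp
  also have "\<dots> = (\<integral>z. (z + cnj z) / 2 \<partial>circle_measure)"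
    by (simp add: complex_add_cnj)
  also have "\<dots> = 0" using i' o' by simp
  finally show "(\<integral>z. Re z \<partial>circle_measure) = 0" by simp
  have "complex_of_real (\<integral>z. (Re z)\<^sup>2 \<partial>circle_measure) = (\<integral>z. complex_of_real ((Re z)\<^sup>2) \<partial>circle_measure)"
    by (rule integral_complex_of_real[symmetric])
  also have "\<dots> = (\<integral>z. (z\<^sup>2 + 2 * (z * cnj z) + (cnj z)\<^sup>2) / 4 \<partial>circle_measure)"
    by (intro Bochner_Integration.integral_cong) (auto simp: complex_eq_iff power2_eq_square)
  also have "\<dots> = 1 / 2" using i' o' by simp
  also have "\<dots> = complex_of_real (1 / 2)" by simp
  finally show "(\<integral>z. (Re z)\<^sup>2 \<partial>circle_measure) = 1 / 2" by (simp only: of_real_eq_iff)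
qed

text \<open>Terms up to order two stay exact and all others are charged to
  \<open>\<rho> ^ 3\<close>: the three mixed terms of order three and four cost 1 each, the two
  remainders 500 * 503 and 500 * 3, and 254000 covers the total.\<close>

lemma taylor_product_le:
  fixes r s x q :: real
  assumes r: "0 \<le> r" "r \<le> \<rho>" and s: "0 \<le> s" "s \<le> \<rho>" and \<rho>: "\<rho> \<le> 1"
    and x: "\<bar>x\<bar> \<le> 1" and q: "\<bar>q\<bar> \<le> 1"
  shows "(1 + r * x + r\<^sup>2 * q + 500 * r ^ 3) * (1 + s * x + s\<^sup>2 * q + 500 * s ^ 3) \<le>
    1 + (r + s) * x + r * s * x\<^sup>2 + (r\<^sup>2 + s\<^sup>2) * q + 254000 * \<rho> ^ 3"
proof -
  have \<rho>0: "0 \<le> \<rho>" using r by linarith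
  have pw: "r ^ k \<le> 1" "s ^ k \<le> 1" for k
    using r s \<rho> by (auto intro!: power_le_one)
  have m: "c \<le> \<rho> ^ 3" if "\<bar>c\<bar> \<le> a * b * d" "0 \<le> a" "a \<le> \<rho>" "0 \<le> b" "b \<le> \<rho>" "0 \<le> d" "d \<le> \<rho>" for a b c d
  proof -
    have "a * b * d \<le> \<rho> * \<rho> * \<rho>" using that \<rho>0 by (intro mult_mono) auto
    then show ?thesis using that(1) by (simp add: power3_eq_cube)
  qed
  have xq: "\<bar>x\<bar> * \<bar>q\<bar> \<le> 1" "\<bar>q\<bar> * \<bar>q\<bar> \<le> 1"
    using x q by (auto simp: mult_le_one simp del: abs_mult_self_eq)
  have c1: "r * s\<^sup>2 * (x * q) \<le> \<rho> ^ 3"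
    using mult_left_le[OF xq(1), of "r * s * s"] r s
    by (intro m[of _ r s s]) (auto simp: abs_mult power2_eq_square mult_ac)
  have c2: "r\<^sup>2 * s * (x * q) \<le> \<rho> ^ 3"
    using mult_left_le[OF xq(1), of "r * r * s"] r s
    by (intro m[of _ r r s]) (auto simp: abs_mult power2_eq_square mult_ac)
  have "s * (\<bar>q\<bar> * \<bar>q\<bar>) \<le> 1"
    using s pw(2)[of 1] xq by (intro mult_le_one[of s "\<bar>q\<bar> * \<bar>q\<bar>"]) (simp_all del: abs_mult_self_eq)
  then have c3: "r\<^sup>2 * s\<^sup>2 * q\<^sup>2 \<le> \<rho> ^ 3"
    using mult_left_le[of "s * (\<bar>q\<bar> * \<bar>q\<bar>)" "r * r * s"] r s
    by (intro m[of _ r r s]) (auto simp: abs_mult power2_eq_square mult_ac)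
  have b: "s * x \<le> 1" "s\<^sup>2 * q \<le> 1" "r * x \<le> 1" "r\<^sup>2 * q \<le> 1"
  proof -
    have "a * c \<le> 1" if "0 \<le> a" "a \<le> 1" "\<bar>c\<bar> \<le> 1" for a c :: real
    proof -
      have "a * c \<le> a * 1" using that by (intro mult_left_mono) auto
      then show ?thesis using that by simp
    qed
    then show "s * x \<le> 1" "s\<^sup>2 * q \<le> 1" "r * x \<le> 1" "r\<^sup>2 * q \<le> 1"
      using r s pw(1)[of 1] pw(2)[of 1] pw(1)[of 2] pw(2)[of 2] x q by simp_all
  qed
  have r3: "0 \<le> r ^ 3" "r ^ 3 \<le> \<rho> ^ 3" and s3: "0 \<le> s ^ 3" "s ^ 3 \<le> \<rho> ^ 3"
    using r s by (auto intro: power_mono)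
  have "500 * r ^ 3 * (1 + s * x + s\<^sup>2 * q + 500 * s ^ 3) \<le> 500 * r ^ 3 * 503"
    using b pw(2)[of 3] r3 by (intro mult_left_mono) auto
  then have d1: "500 * r ^ 3 * (1 + s * x + s\<^sup>2 * q + 500 * s ^ 3) \<le> 251500 * \<rho> ^ 3"
    using r3 by linarith
  have "500 * s ^ 3 * (1 + r * x + r\<^sup>2 * q) \<le> 500 * s ^ 3 * 3"
    using b s3 by (intro mult_left_mono) auto
  then have d2: "500 * s ^ 3 * (1 + r * x + r\<^sup>2 * q) \<le> 1500 * \<rho> ^ 3"
    using s3 by linarith
  have "(1 + r * x + r\<^sup>2 * q + 500 * r ^ 3) * (1 + s * x + s\<^sup>2 * q + 500 * s ^ 3) =
     1 + (r + s) * x + r * s * x\<^sup>2 + (r\<^sup>2 + s\<^sup>2) * q + r * s\<^sup>2 * (x * q) + r\<^sup>2 * s * (x * q)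
     + r\<^sup>2 * s\<^sup>2 * q\<^sup>2 + 500 * r ^ 3 * (1 + s * x + s\<^sup>2 * q + 500 * s ^ 3)
     + 500 * s ^ 3 * (1 + r * x + r\<^sup>2 * q)"
    by (simp add: power2_eq_square algebra_simps)
  also have "\<dots> \<le> 1 + (r + s) * x + r * s * x\<^sup>2 + (r\<^sup>2 + s\<^sup>2) * q + 254000 * \<rho> ^ 3"
    using c1 c2 c3 d1 d2 zero_le_power[OF \<rho>0, of 3] by linarith
  finally show ?thesis .
qed

text \<open>Re z has mean 0 and its square has mean 1/2, so the quadratic terms average to r s / 2 +
  (r^2 + s^2) / 4 = (r + s)^2 / 4. Passing to the exponential lets the factors of different primes
  multiply by adding exponents.\<close>

lemma nn_integral_circle_szego_product_le:
  assumes r: "0 \<le> r" "r \<le> \<rho>" and s: "0 \<le> s" "s \<le> \<rho>" and \<rho>: "\<rho>\<^sup>2 \<le> 1 / 2"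
  shows "(\<integral>\<^sup>+z. ennreal (1 / cmod (1 - of_real r * z) * (1 / cmod (1 - of_real s * z))) \<partial>circle_measure)
    \<le> ennreal (exp ((r + s)\<^sup>2 / 4 + 254000 * \<rho> ^ 3))"
proof -
  interpret prob_space circle_measure by (rule prob_space_circle_measure)
  have "\<rho> \<le> 1" using \<rho> by (intro power2_le_imp_le[of \<rho> 1]) auto
  have sq: "r\<^sup>2 \<le> 1 / 2" "s\<^sup>2 \<le> 1 / 2"
    using order_trans[OF power_mono[OF r(2,1), of 2] \<rho>] order_trans[OF power_mono[OF s(2,1), of 2] \<rho>]
    by simp_all
  define G where "G z = 1 + (r + s) * Re z + r * s * (Re z)\<^sup>2 +
    (r\<^sup>2 + s\<^sup>2) * ((3 * (Re z)\<^sup>2 - 1) / 2) + 254000 * \<rho> ^ 3" for z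
  have le: "1 / cmod (1 - of_real r * z) * (1 / cmod (1 - of_real s * z)) \<le> G z" if z: "cmod z = 1" for z
  proof -
    have x: "\<bar>Re z\<bar> \<le> 1" using abs_Re_le_cmod[of z] z by simp
    define t where "t = (Re z)\<^sup>2"
    have "0 \<le> t" "t \<le> 1" using x by (simp_all add: t_def abs_square_le_1)
    then have "\<bar>(3 * t - 1) / 2\<bar> \<le> 1" by (simp add: abs_le_iff)
    then have q: "\<bar>(3 * (Re z)\<^sup>2 - 1) / 2\<bar> \<le> 1" by (simp only: t_def)
    have "1 / cmod (1 - of_real r * z) * (1 / cmod (1 - of_real s * z)) \<le>
      (1 + r * Re z + r\<^sup>2 * ((3 * (Re z)\<^sup>2 - 1) / 2) + 500 * r ^ 3) *
      (1 + s * Re z + s\<^sup>2 * ((3 * (Re z)\<^sup>2 - 1) / 2) + 500 * s ^ 3)"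
      using inverse_norm_one_minus_le[OF z r(1) sq(1)] inverse_norm_one_minus_le[OF z s(1) sq(2)]
      by (intro mult_mono) (auto intro: order_trans[of 0 "1 / cmod _"])
    also have "\<dots> \<le> G z"
      unfolding G_def by (rule taylor_product_le) fact+
    finally show ?thesis .
  qed
  have int: "integrable circle_measure G"
    unfolding G_def by (intro integrable_circle continuous_intros) auto
  have i: "integrable circle_measure Re" "integrable circle_measure (\<lambda>z. (Re z)\<^sup>2)"
    by (intro integrable_circle continuous_intros)+
  have "(\<integral>\<^sup>+z. ennreal (1 / cmod (1 - of_real r * z) * (1 / cmod (1 - of_real s * z))) \<partial>circle_measure)
      \<le> (\<integral>\<^sup>+z. ennreal (G z) \<partial>circle_measure)"
    by (intro nn_integral_mono ennreal_leI le) (simp add: space_circle_measure)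
  also have "\<dots> = ennreal (\<integral>z. G z \<partial>circle_measure)"
    by (intro nn_integral_eq_integral int AE_I2 order_trans[OF _ le]) (auto simp: space_circle_measure)
  also have "(\<integral>z. G z \<partial>circle_measure) = 1 + ((r + s)\<^sup>2 / 4 + 254000 * \<rho> ^ 3)"
    unfolding G_def using i prob_space
    by (simp add: integral_circle_Re) (simp add: power2_eq_square field_simps)
  also have "\<dots> \<le> exp ((r + s)\<^sup>2 / 4 + 254000 * \<rho> ^ 3)"
    by (rule exp_ge_add_one_self)
  finally show ?thesis by (simp add: ennreal_leI)
qed

lemma nn_integral_abs_szego_product_le:
  assumes "finite J"
    and "\<And>j. j \<in> J \<Longrightarrow> 0 \<le> r j \<and> r j \<le> \<rho> j \<and> 0 \<le> s j \<and> s j \<le> \<rho> j \<and> (\<rho> j)\<^sup>2 \<le> 1 / 2"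
  shows "(\<integral>\<^sup>+z. ennreal (abs_szego J r z) * ennreal (abs_szego J s z) \<partial>torus_measure) \<le>
    ennreal (exp (\<Sum>j\<in>J. (r j + s j)\<^sup>2 / 4 + 254000 * \<rho> j ^ 3))"
  using assms
proof (induction J rule: finite_induct)
  case empty
  interpret prob_space torus_measure by (rule prob_space_torus_measure)
  show ?case by (simp add: abs_szego_def emeasure_space_1)
next
  case (insert j J)
  let ?k = "\<lambda>x. 1 / cmod (1 - of_real (r j) * x) * (1 / cmod (1 - of_real (s j) * x))"
  let ?E = "\<lambda>j. (r j + s j)\<^sup>2 / 4 + 254000 * \<rho> j ^ 3"
  have [measurable]: "(\<lambda>x. x) \<in> borel_measurable circle_measure"
    by (intro borel_measurable_circle) simp
  have K: "abs_szego (insert j J) q (z(j := x)) = 1 / cmod (1 - of_real (q j) * x) * abs_szego J q z" for q z x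
    using insert.hyps by (auto simp: abs_szego_def intro!: prod.cong)
  have "(\<integral>\<^sup>+z. ennreal (abs_szego (insert j J) r z) * ennreal (abs_szego (insert j J) s z) \<partial>torus_measure) =
      (\<integral>\<^sup>+z. \<integral>\<^sup>+x. ennreal (abs_szego (insert j J) r (z(j := x))) * ennreal (abs_szego (insert j J) s (z(j := x)))
        \<partial>circle_measure \<partial>torus_measure)"
    by (rule nn_integral_torus_coordinate) measurable
  also have "\<dots> = (\<integral>\<^sup>+z. \<integral>\<^sup>+x. ennreal (?k x) * (ennreal (abs_szego J r z) * ennreal (abs_szego J s z)) \<partial>circle_measure \<partial>torus_measure)"
  proof -
    have "ennreal (a * b) * ennreal (c * d) = ennreal (a * c) * (ennreal b * ennreal d)"
      if "0 \<le> a" "0 \<le> b" "0 \<le> c" "0 \<le> d" for a b c d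
      using that by (simp add: ennreal_mult mult_ac)
    then show ?thesis
      unfolding K by (intro nn_integral_cong) (simp only: abs_szego_nonneg norm_ge_zero zero_le_divide_1_iff)
  qed
  also have "\<dots> = (\<integral>\<^sup>+z. (\<integral>\<^sup>+x. ennreal (?k x) \<partial>circle_measure) * (ennreal (abs_szego J r z) * ennreal (abs_szego J s z)) \<partial>torus_measure)"
    by (intro nn_integral_cong nn_integral_multc) measurable
  also have "\<dots> = (\<integral>\<^sup>+x. ennreal (?k x) \<partial>circle_measure) * (\<integral>\<^sup>+z. ennreal (abs_szego J r z) * ennreal (abs_szego J s z) \<partial>torus_measure)"
    by (intro nn_integral_cmult) measurable
  also have "\<dots> \<le> ennreal (exp (?E j)) * ennreal (exp (\<Sum>j\<in>J. ?E j))"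
    using insert.prems by (intro mult_mono insert.IH nn_integral_circle_szego_product_le) auto
  also have "\<dots> = ennreal (exp (\<Sum>j\<in>insert j J. ?E j))"
    using insert.hyps by (simp add: exp_add ennreal_mult)
  finally show ?case .
qed

section \<open>Kernels at the points of the half-line\<close>

definition halfline_point :: "real \<Rightarrow> nat \<Rightarrow> real" where
  "halfline_point \<sigma> j = real (nth_prime j) powr - (1/2 + \<sigma>)"

lemma nth_prime_ge_2: "nth_prime j \<ge> 2"
  using prime_ge_2_nat[OF prime_nth_prime] .

lemma halfline_point_mult: "halfline_point \<sigma> j * halfline_point \<tau> j = real (nth_prime j) powr - (1 + (\<sigma> + \<tau>))"
  by (simp add: halfline_point_def flip: powr_add)

text \<open>The bound 1/2 for the square comes from the smallest prime and is what the one-variable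
  estimates require; the exponent 3/2 for the cube makes their errors summable over all
  primes.\<close>

lemma halfline_point_bounds:
  assumes "\<sigma> \<ge> 0"
  shows "0 \<le> halfline_point \<sigma> j" "halfline_point \<sigma> j \<le> halfline_point 0 j"
    "(halfline_point \<sigma> j)\<^sup>2 \<le> 1 / 2" "halfline_point \<sigma> j ^ 3 \<le> real (nth_prime j) powr - (1 + 1/2)"
proof -
  show nn: "0 \<le> halfline_point \<sigma> j" by (simp add: halfline_point_def)
  show le: "halfline_point \<sigma> j \<le> halfline_point 0 j"
    using assms nth_prime_ge_2[of j] unfolding halfline_point_def by (intro powr_mono) auto
  have "(halfline_point \<sigma> j)\<^sup>2 \<le> (halfline_point 0 j)\<^sup>2"
    using nn le by (intro power_mono)
  also have "\<dots> = 1 / real (nth_prime j)"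
    unfolding power2_eq_square halfline_point_mult using nth_prime_ge_2[of j] by (simp add: powr_minus_divide)
  also have "\<dots> \<le> 1 / 2" using nth_prime_ge_2[of j] by (intro divide_left_mono) auto
  finally show "(halfline_point \<sigma> j)\<^sup>2 \<le> 1 / 2" .
  have "halfline_point \<sigma> j ^ 3 \<le> halfline_point 0 j ^ 3"
    using nn le by (intro power_mono)
  also have "\<dots> = real (nth_prime j) powr - (1 + 1/2)"
    using nth_prime_ge_2[of j] by (simp add: halfline_point_def powr_power)
  finally show "halfline_point \<sigma> j ^ 3 \<le> real (nth_prime j) powr - (1 + 1/2)" .
qed

lemma halfline_point_less_1:
  assumes "\<sigma> \<ge> 0"
  shows "\<bar>halfline_point \<sigma> j\<bar> < 1"
proof -
  have "\<bar>halfline_point \<sigma> j\<bar>\<^sup>2 < 1\<^sup>2"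
    using halfline_point_bounds(3)[OF assms, of j] by simp
  then show ?thesis by (rule power2_less_imp_less) simp
qed

text \<open>Expanding (r + s)^2 / 4 gives prime sums with weights 1/4, 1/4 and 1/2. Each sum is
  logarithmic, so the weights become the exponents of \<sigma>, \<tau> and \<sigma> + \<tau>. In the
  constant, 762000 = 254000 * 3 comes from the cubes and 4 bounds the remaining additive
  terms.\<close>

lemma szego_Gram_le:
  assumes J: "finite J" and \<sigma>: "0 < \<sigma>" "\<sigma> \<le> 1" and \<tau>: "0 < \<tau>" "\<tau> \<le> 1"
  shows "(\<integral>\<^sup>+z. ennreal (abs_szego J (halfline_point \<sigma>) z) * ennreal (abs_szego J (halfline_point \<tau>) z) \<partial>torus_measure)
    \<le> ennreal (exp 762004 * (\<sigma> powr (-1/4) * \<tau> powr (-1/4) * (\<sigma> + \<tau>) powr (-1/2)))"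
proof -
  have "(\<Sum>j\<in>J. (halfline_point \<sigma> j + halfline_point \<tau> j)\<^sup>2 / 4 + 254000 * halfline_point 0 j ^ 3) \<le>
     (\<Sum>j\<in>J. 1/4 * real (nth_prime j) powr - (1 + (\<sigma> + \<sigma>)) + 1/4 * real (nth_prime j) powr - (1 + (\<tau> + \<tau>))
       + 1/2 * real (nth_prime j) powr - (1 + (\<sigma> + \<tau>)) + 254000 * real (nth_prime j) powr - (1 + 1/2))"
  proof (rule sum_mono)
    fix j
    have "(halfline_point \<sigma> j + halfline_point \<tau> j)\<^sup>2 / 4 = 1/4 * (halfline_point \<sigma> j * halfline_point \<sigma> j) +
        1/4 * (halfline_point \<tau> j * halfline_point \<tau> j) + 1/2 * (halfline_point \<sigma> j * halfline_point \<tau> j)"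
      by (simp add: power2_eq_square algebra_simps)
    then show "(halfline_point \<sigma> j + halfline_point \<tau> j)\<^sup>2 / 4 + 254000 * halfline_point 0 j ^ 3 \<le>
       1/4 * real (nth_prime j) powr - (1 + (\<sigma> + \<sigma>)) + 1/4 * real (nth_prime j) powr - (1 + (\<tau> + \<tau>))
       + 1/2 * real (nth_prime j) powr - (1 + (\<sigma> + \<tau>)) + 254000 * real (nth_prime j) powr - (1 + 1/2)"
      unfolding halfline_point_mult using halfline_point_bounds(4)[of 0 j] by linarith
  qed
  also have "\<dots> = 1/4 * (\<Sum>j\<in>J. real (nth_prime j) powr - (1 + (\<sigma> + \<sigma>)))
      + 1/4 * (\<Sum>j\<in>J. real (nth_prime j) powr - (1 + (\<tau> + \<tau>)))
      + 1/2 * (\<Sum>j\<in>J. real (nth_prime j) powr - (1 + (\<sigma> + \<tau>)))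
      + 254000 * (\<Sum>j\<in>J. real (nth_prime j) powr - (1 + 1/2))"
    by (simp only: sum.distrib sum_distrib_left)
  also have "\<dots> \<le> 1/4 * (ln (1 + 1 / (\<sigma> + \<sigma>)) + 2) + 1/4 * (ln (1 + 1 / (\<tau> + \<tau>)) + 2)
      + 1/2 * (ln (1 + 1 / (\<sigma> + \<tau>)) + 2) + 254000 * (1 + 1 / (1/2))"
    using \<sigma> \<tau> J by (intro add_mono mult_left_mono sum_nth_prime_powr_le) auto
  also have "\<dots> \<le> 1/4 * (ln 2 - ln \<sigma> + 2) + 1/4 * (ln 2 - ln \<tau> + 2) + 1/2 * (ln 3 - ln (\<sigma> + \<tau>) + 2) + 762000"
  proof -
    have ln_le: "ln (1 + 1 / y) \<le> ln c - ln x" if "0 < x" "0 < y" "0 < c" "1 + 1 / y \<le> c / x" for x y c :: real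
    proof -
      have "0 < 1 + 1 / y" using that by (simp add: add_pos_pos)
      then have "ln (1 + 1 / y) \<le> ln (c / x)" using that by (intro ln_mono) auto
      also have "\<dots> = ln c - ln x" using that by (simp add: ln_div)
      finally show ?thesis .
    qed
    \<comment> \<open>The upper bound 1 on \<sigma> and \<tau> lets the summand 1 be absorbed into
      the pole.\<close>
    have 1: "ln (1 + 1 / (x + x)) \<le> ln 2 - ln x" if "0 < x" "x \<le> 1" for x :: real
      using that by (intro ln_le) (auto simp: field_simps)
    have 2: "ln (1 + 1 / (\<sigma> + \<tau>)) \<le> ln 3 - ln (\<sigma> + \<tau>)"
    proof (rule ln_le)
      have "1 + 1 / u \<le> 3 / u" if "0 < u" "u \<le> 2" for u :: real
        using that by (simp add: field_simps)
      then show "1 + 1 / (\<sigma> + \<tau>) \<le> 3 / (\<sigma> + \<tau>)" using \<sigma> \<tau> by simp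
    qed (use \<sigma> \<tau> in auto)
    show ?thesis by (intro add_mono mult_left_mono 1 2 \<sigma> \<tau>) auto
  qed
  also have "\<dots> \<le> 762004 - 1/4 * ln \<sigma> - 1/4 * ln \<tau> - 1/2 * ln (\<sigma> + \<tau>)"
  proof -
    have "ln (2::real) \<le> 1" "ln (3::real) \<le> 2"
      using ln_le_minus_one[of "2::real"] ln_le_minus_one[of "3::real"] by simp_all
    then show ?thesis by (simp add: field_simps)
  qed
  finally have le: "(\<Sum>j\<in>J. (halfline_point \<sigma> j + halfline_point \<tau> j)\<^sup>2 / 4 + 254000 * halfline_point 0 j ^ 3)
    \<le> 762004 - 1/4 * ln \<sigma> - 1/4 * ln \<tau> - 1/2 * ln (\<sigma> + \<tau>)" .
  have "(\<integral>\<^sup>+z. ennreal (abs_szego J (halfline_point \<sigma>) z) * ennreal (abs_szego J (halfline_point \<tau>) z) \<partial>torus_measure)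
      \<le> ennreal (exp (\<Sum>j\<in>J. (halfline_point \<sigma> j + halfline_point \<tau> j)\<^sup>2 / 4 + 254000 * halfline_point 0 j ^ 3))"
    using \<sigma> \<tau> halfline_point_bounds[of 0] halfline_point_bounds[of \<sigma>] halfline_point_bounds[of \<tau>]
    by (intro nn_integral_abs_szego_product_le J) auto
  also have "\<dots> \<le> ennreal (exp (762004 - 1/4 * ln \<sigma> - 1/4 * ln \<tau> - 1/2 * ln (\<sigma> + \<tau>)))"
    using le by (intro ennreal_leI) simp
  also have "exp (762004 - 1/4 * ln \<sigma> - 1/4 * ln \<tau> - 1/2 * ln (\<sigma> + \<tau>)) =
      exp 762004 * (\<sigma> powr (-1/4) * \<tau> powr (-1/4) * (\<sigma> + \<tau>) powr (-1/2))"
    using \<sigma> \<tau> by (simp add: powr_def flip: exp_add)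
  finally show ?thesis .
qed

section \<open>Schur's test\<close>

lemma ennreal_weighted_amgm:
  fixes u v :: ennreal and p :: real
  assumes "p > 0"
  shows "2 * (u * v) \<le> ennreal p * u\<^sup>2 + ennreal (1 / p) * v\<^sup>2"
proof (cases u; cases v)
  fix a b assume ab: "u = ennreal a" "0 \<le> a" "v = ennreal b" "0 \<le> b"
  have "0 \<le> (p * a - b)\<^sup>2 / p" using assms by simp
  also have "\<dots> = p * a\<^sup>2 + 1 / p * b\<^sup>2 - 2 * (a * b)"
    using assms by (simp add: power2_eq_square field_simps)
  finally have "2 * (a * b) \<le> p * a\<^sup>2 + 1 / p * b\<^sup>2" by simp
  then have "ennreal (2 * (a * b)) \<le> ennreal (p * a\<^sup>2 + 1 / p * b\<^sup>2)" by (rule ennreal_leI)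
  then show ?thesis
    using ab assms by (simp add: ennreal_mult ennreal_plus ennreal_power del: times_divide_eq_left)
qed (use assms in \<open>auto simp: ennreal_mult_top ennreal_mult_eq_top_iff ennreal_top_mult power2_eq_square\<close>)

text \<open>Let T be the operator with kernel \<open>K\<close>, u = T h, and v the image of u under
  the adjoint of T. Then \<open>U\<close> is the squared norm of u and equals the pairing of h with
  v, so its square is at most the product of the squared norms of h and v. The condition on the Gram
  kernel bounds the squared norm of v by C times \<open>U\<close>, and finiteness allows
  \<open>U\<close> to be cancelled.\<close>

lemma Schur_test:
  fixes K :: "'a \<Rightarrow> 'b \<Rightarrow> ennreal" and h :: "'b \<Rightarrow> ennreal" and w :: "'a \<Rightarrow> real"
  assumes "sigma_finite_measure M" "sigma_finite_measure N"
    and K [measurable]: "case_prod K \<in> borel_measurable (M \<Otimes>\<^sub>M N)"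
    and h [measurable]: "h \<in> borel_measurable N"
    and w [measurable]: "w \<in> borel_measurable M" and w_pos: "\<And>s. s \<in> space M \<Longrightarrow> w s > 0"
    and Schur: "\<And>s. s \<in> space M \<Longrightarrow>
      (\<integral>\<^sup>+t. (\<integral>\<^sup>+z. K s z * K t z \<partial>N) * ennreal (w t) \<partial>M) \<le> ennreal C * ennreal (w s)"
    and fin: "(\<integral>\<^sup>+s. (\<integral>\<^sup>+z. h z * K s z \<partial>N)\<^sup>2 \<partial>M) < \<infinity>"
  shows "(\<integral>\<^sup>+s. (\<integral>\<^sup>+z. h z * K s z \<partial>N)\<^sup>2 \<partial>M) \<le> ennreal C * (\<integral>\<^sup>+z. (h z)\<^sup>2 \<partial>N)"
proof -
  interpret M: sigma_finite_measure M by fact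
  interpret N: sigma_finite_measure N by fact
  interpret MN: pair_sigma_finite M N ..
  interpret MM: pair_sigma_finite M M ..
  define u where "u s = (\<integral>\<^sup>+z. h z * K s z \<partial>N)" for s
  define S where "S s t = (\<integral>\<^sup>+z. K s z * K t z \<partial>N)" for s t
  define v where "v z = (\<integral>\<^sup>+s. u s * K s z \<partial>M)" for z
  have u [measurable]: "u \<in> borel_measurable M"
    unfolding u_def by measurable
  have v [measurable]: "v \<in> borel_measurable N"
    unfolding v_def by measurable
  have K1 [measurable]: "K s \<in> borel_measurable N" if "s \<in> space M" for s
    using measurable_compose[OF measurable_Pair1'[OF that] K] by simp
  have S [measurable]: "case_prod S \<in> borel_measurable (M \<Otimes>\<^sub>M M)"
    unfolding S_def by measurable
  define U where "U = (\<integral>\<^sup>+s. (u s)\<^sup>2 \<partial>M)"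
  have "U = (\<integral>\<^sup>+s. \<integral>\<^sup>+z. u s * (h z * K s z) \<partial>N \<partial>M)"
    unfolding U_def by (intro nn_integral_cong) (simp add: nn_integral_cmult u_def[symmetric] power2_eq_square)
  also have "\<dots> = (\<integral>\<^sup>+z. \<integral>\<^sup>+s. u s * (h z * K s z) \<partial>M \<partial>N)"
    by (rule MN.Fubini'[symmetric]) measurable
  also have "\<dots> = (\<integral>\<^sup>+z. h z * v z \<partial>N)"
    unfolding v_def
    by (intro nn_integral_cong) (simp add: nn_integral_cmult[symmetric] mult_ac)
  finally have "U\<^sup>2 = (\<integral>\<^sup>+z. h z * v z \<partial>N)\<^sup>2" by simp
  also have "\<dots> \<le> (\<integral>\<^sup>+z. (h z)\<^sup>2 \<partial>N) * (\<integral>\<^sup>+z. (v z)\<^sup>2 \<partial>N)"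
    by (rule Cauchy_Schwarz_nn_integral) measurable
  also have "(\<integral>\<^sup>+z. (v z)\<^sup>2 \<partial>N) \<le> ennreal C * U"
  proof -
    have "(\<integral>\<^sup>+z. (v z)\<^sup>2 \<partial>N) = (\<integral>\<^sup>+z. \<integral>\<^sup>+s. v z * (u s * K s z) \<partial>M \<partial>N)"
      by (intro nn_integral_cong) (simp add: nn_integral_cmult v_def[symmetric] power2_eq_square)
    also have "\<dots> = (\<integral>\<^sup>+s. \<integral>\<^sup>+z. v z * (u s * K s z) \<partial>N \<partial>M)"
      by (rule MN.Fubini') measurable
    also have "\<dots> = (\<integral>\<^sup>+s. \<integral>\<^sup>+t. u s * u t * S s t \<partial>M \<partial>M)"
    proof (intro nn_integral_cong)
      fix s assume s: "s \<in> space M"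
      note [measurable] = K1[OF s]
      have "(\<integral>\<^sup>+z. v z * (u s * K s z) \<partial>N) = (\<integral>\<^sup>+z. \<integral>\<^sup>+t. u t * K t z * (u s * K s z) \<partial>M \<partial>N)"
        unfolding v_def by (intro nn_integral_cong nn_integral_multc[symmetric]) measurable
      also have "\<dots> = (\<integral>\<^sup>+t. \<integral>\<^sup>+z. u t * K t z * (u s * K s z) \<partial>N \<partial>M)"
        by (rule MN.Fubini') measurable
      also have "\<dots> = (\<integral>\<^sup>+t. u s * u t * S s t \<partial>M)"
        unfolding S_def
        by (intro nn_integral_cong) (simp add: nn_integral_cmult[symmetric] mult_ac)
      finally show "(\<integral>\<^sup>+z. v z * (u s * K s z) \<partial>N) = \<dots>" .
    qed
    finally have eq: "(\<integral>\<^sup>+z. (v z)\<^sup>2 \<partial>N) = (\<integral>\<^sup>+s. \<integral>\<^sup>+t. u s * u t * S s t \<partial>M \<partial>M)" .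
    have bound: "(\<integral>\<^sup>+s. \<integral>\<^sup>+t. S s t * (ennreal (w t / w s) * (u s)\<^sup>2) \<partial>M \<partial>M) \<le> ennreal C * U"
    proof -
      have "(\<integral>\<^sup>+s. \<integral>\<^sup>+t. S s t * (ennreal (w t / w s) * (u s)\<^sup>2) \<partial>M \<partial>M) \<le>
          (\<integral>\<^sup>+s. ennreal C * (u s)\<^sup>2 \<partial>M)"
      proof (intro nn_integral_mono)
        fix s assume s: "s \<in> space M"
        have [measurable]: "S s \<in> borel_measurable M"
          using measurable_compose[OF measurable_Pair1'[OF s] S] by simp
        have "(\<integral>\<^sup>+t. S s t * (ennreal (w t / w s) * (u s)\<^sup>2) \<partial>M) =
            (\<integral>\<^sup>+t. (ennreal (1 / w s) * (u s)\<^sup>2) * (S s t * ennreal (w t)) \<partial>M)"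
        proof (intro nn_integral_cong)
          fix t assume "t \<in> space M"
          have "ennreal (w t / w s) = ennreal (1 / w s) * ennreal (w t)"
            using w_pos[OF s] w_pos[OF \<open>t \<in> space M\<close>] by (simp flip: ennreal_mult)
          then show "S s t * (ennreal (w t / w s) * (u s)\<^sup>2) =
              (ennreal (1 / w s) * (u s)\<^sup>2) * (S s t * ennreal (w t))"
            by (simp add: mult_ac)
        qed
        also have "\<dots> = (ennreal (1 / w s) * (u s)\<^sup>2) * (\<integral>\<^sup>+t. S s t * ennreal (w t) \<partial>M)"
          by (intro nn_integral_cmult) measurable
        also have "\<dots> \<le> (ennreal (1 / w s) * (u s)\<^sup>2) * (ennreal C * ennreal (w s))"
          unfolding S_def by (intro mult_left_mono Schur s) auto
        also have "\<dots> = (ennreal (1 / w s) * ennreal (w s)) * (ennreal C * (u s)\<^sup>2)"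
          by (simp add: mult_ac)
        also have "ennreal (1 / w s) * ennreal (w s) = 1"
          using w_pos[OF s] by (simp flip: ennreal_mult)
        finally show "(\<integral>\<^sup>+t. S s t * (ennreal (w t / w s) * (u s)\<^sup>2) \<partial>M) \<le> ennreal C * (u s)\<^sup>2" by simp
      qed
      also have "\<dots> = ennreal C * U"
        unfolding U_def by (intro nn_integral_cmult) measurable
      finally show ?thesis .
    qed
    have "2 * (\<integral>\<^sup>+z. (v z)\<^sup>2 \<partial>N) = (\<integral>\<^sup>+s. \<integral>\<^sup>+t. S s t * (2 * (u s * u t)) \<partial>M \<partial>M)"
    proof -
      have "2 * (\<integral>\<^sup>+t. u s * u t * S s t \<partial>M) = (\<integral>\<^sup>+t. S s t * (2 * (u s * u t)) \<partial>M)"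
        if s: "s \<in> space M" for s
      proof -
        have [measurable]: "S s \<in> borel_measurable M"
          using measurable_compose[OF measurable_Pair1'[OF s] S] by simp
        show ?thesis by (subst nn_integral_cmult[symmetric]) (measurable, simp add: mult_ac)
      qed
      then show ?thesis
        unfolding eq by (subst nn_integral_cmult[symmetric]) (measurable, auto intro!: nn_integral_cong)
    qed
    also have "\<dots> \<le> (\<integral>\<^sup>+s. \<integral>\<^sup>+t. S s t * (ennreal (w t / w s) * (u s)\<^sup>2) +
        S s t * (ennreal (w s / w t) * (u t)\<^sup>2) \<partial>M \<partial>M)"
    proof (intro nn_integral_mono)
      fix s t assume st: "s \<in> space M" "t \<in> space M"
      \<comment> \<open>With the ratio \<open>w t / w s\<close> the half containing
        \<open>u s\<close> carries \<open>w t\<close>, to be integrated in t against the Gram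
        kernel, which is the shape of the Schur condition.\<close>
      have "S s t * (2 * (u s * u t)) \<le> S s t * (ennreal (w t / w s) * (u s)\<^sup>2 + ennreal (w s / w t) * (u t)\<^sup>2)"
        using ennreal_weighted_amgm[of "w t / w s" "u s" "u t"] w_pos[OF st(1)] w_pos[OF st(2)]
        by (intro mult_left_mono) auto
      then show "S s t * (2 * (u s * u t)) \<le> S s t * (ennreal (w t / w s) * (u s)\<^sup>2) +
        S s t * (ennreal (w s / w t) * (u t)\<^sup>2)"
        by (simp add: distrib_left)
    qed
    also have "\<dots> = (\<integral>\<^sup>+s. \<integral>\<^sup>+t. S s t * (ennreal (w t / w s) * (u s)\<^sup>2) \<partial>M \<partial>M) +
        (\<integral>\<^sup>+s. \<integral>\<^sup>+t. S s t * (ennreal (w s / w t) * (u t)\<^sup>2) \<partial>M \<partial>M)"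
    proof -
      have "(\<integral>\<^sup>+t. S s t * (ennreal (w t / w s) * (u s)\<^sup>2) + S s t * (ennreal (w s / w t) * (u t)\<^sup>2) \<partial>M) =
          (\<integral>\<^sup>+t. S s t * (ennreal (w t / w s) * (u s)\<^sup>2) \<partial>M) + (\<integral>\<^sup>+t. S s t * (ennreal (w s / w t) * (u t)\<^sup>2) \<partial>M)"
        if s: "s \<in> space M" for s
      proof -
        have [measurable]: "S s \<in> borel_measurable M"
          using measurable_compose[OF measurable_Pair1'[OF s] S] by simp
        show ?thesis by (intro nn_integral_add) measurable
      qed
      then show ?thesis
        by (subst nn_integral_add[symmetric]) (measurable, auto intro!: nn_integral_cong)
    qed
    \<comment> \<open>By Tonelli and the symmetry of \<open>S\<close> the second half equals the
      first.\<close>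
    also have "(\<integral>\<^sup>+s. \<integral>\<^sup>+t. S s t * (ennreal (w s / w t) * (u t)\<^sup>2) \<partial>M \<partial>M) =
        (\<integral>\<^sup>+t. \<integral>\<^sup>+s. S s t * (ennreal (w s / w t) * (u t)\<^sup>2) \<partial>M \<partial>M)"
      by (rule MM.Fubini'[symmetric]) measurable
    also have "\<dots> = (\<integral>\<^sup>+s. \<integral>\<^sup>+t. S s t * (ennreal (w t / w s) * (u s)\<^sup>2) \<partial>M \<partial>M)"
      by (simp add: S_def mult.commute)
    finally have "2 * (\<integral>\<^sup>+z. (v z)\<^sup>2 \<partial>N) \<le>
        2 * (\<integral>\<^sup>+s. \<integral>\<^sup>+t. S s t * (ennreal (w t / w s) * (u s)\<^sup>2) \<partial>M \<partial>M)"
      by (simp add: mult_2)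
    then have "(\<integral>\<^sup>+z. (v z)\<^sup>2 \<partial>N) \<le> (\<integral>\<^sup>+s. \<integral>\<^sup>+t. S s t * (ennreal (w t / w s) * (u s)\<^sup>2) \<partial>M \<partial>M)"
      by (simp add: ennreal_mult_le_mult_iff)
    also note bound
    finally show ?thesis .
  qed
  finally have UU: "U\<^sup>2 \<le> (\<integral>\<^sup>+z. (h z)\<^sup>2 \<partial>N) * (ennreal C * U)"
    by (simp add: mult_left_mono)
  have "U < \<infinity>" using fin by (simp add: U_def u_def)
  have "U \<le> ennreal C * (\<integral>\<^sup>+z. (h z)\<^sup>2 \<partial>N)"
  proof (cases "U = 0")
    case False
    have "U * U \<le> U * (ennreal C * (\<integral>\<^sup>+z. (h z)\<^sup>2 \<partial>N))"
      using UU by (simp add: power2_eq_square mult_ac)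
    then show ?thesis
      using False \<open>U < \<infinity>\<close> by (subst (asm) ennreal_mult_le_mult_iff) auto
  qed simp
  then show ?thesis by (simp add: U_def u_def)
qed

text \<open>Splitting at t = s and replacing s + t by the larger of the two leaves t powr (-3/4) on
  [0, s] and t powr (-5/4) on [s, \<infinity>). The weight t powr (-1/2) is chosen so that the first
  is integrable at 0 and the second at infinity; each part gives 4 s powr (-1/2).\<close>

lemma nn_integral_Schur_kernel_le:
  fixes s :: real
  assumes s: "s > 0"
  shows "(\<integral>\<^sup>+t. ennreal (s powr (-1/4) * t powr (-1/4) * (s + t) powr (-1/2) * t powr (-1/2)) *
      indicator {0<..<1} t \<partial>lborel) \<le> ennreal (8 * s powr (-1/2))"
proof -
  have 1: "(\<integral>\<^sup>+t. ennreal (s powr (-3/4) * t powr (-3/4)) * indicator {0..s} t \<partial>lborel) = ennreal (4 * s powr (-1/2))"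
  proof -
    have "((\<lambda>t. s powr (-3/4) * t powr (-3/4)) has_integral s powr (-3/4) * (s powr (-3/4 + 1) / (-3/4 + 1))) {0..s}"
      using s by (intro has_integral_mult_right has_integral_powr_from_0) auto
    then have "(\<integral>\<^sup>+t. ennreal (s powr (-3/4) * t powr (-3/4)) * indicator {0..s} t \<partial>lborel) =
        ennreal (s powr (-3/4) * (s powr (-3/4 + 1) / (-3/4 + 1)))"
      by (intro nn_integral_has_integral_lebesgue') auto
    also have "s powr (-3/4) * (s powr (-3/4 + 1) / (-3/4 + 1)) = 4 * s powr (-1/2)"
      using s powr_add[of s "-3/4" "1/4"] by simp
    finally show ?thesis .
  qed
  have 2: "(\<integral>\<^sup>+t. ennreal (s powr (-1/4) * t powr (-5/4) * s powr 0) * indicator {s..} t \<partial>lborel) = ennreal (4 * s powr (-1/2))"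
  proof -
    have "((\<lambda>t. s powr (-1/4) * t powr (-5/4)) has_integral s powr (-1/4) * (- (s powr (-5/4 + 1)) / (-5/4 + 1))) {s..}"
      using s by (intro has_integral_mult_right has_integral_powr_to_inf) auto
    then have "(\<integral>\<^sup>+t. ennreal (s powr (-1/4) * t powr (-5/4)) * indicator {s..} t \<partial>lborel) =
        ennreal (s powr (-1/4) * (- (s powr (-5/4 + 1)) / (-5/4 + 1)))"
      by (intro nn_integral_has_integral_lebesgue') auto
    also have "s powr (-1/4) * (- (s powr (-5/4 + 1)) / (-5/4 + 1)) = 4 * s powr (-1/2)"
      using s powr_add[of s "-1/4" "-1/4"] by simp
    finally show ?thesis using s by simp
  qed
  have "(\<integral>\<^sup>+t. ennreal (s powr (-1/4) * t powr (-1/4) * (s + t) powr (-1/2) * t powr (-1/2)) *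
      indicator {0<..<1} t \<partial>lborel) \<le>
    (\<integral>\<^sup>+t. ennreal (s powr (-3/4) * t powr (-3/4)) * indicator {0..s} t +
        ennreal (s powr (-1/4) * t powr (-5/4) * s powr 0) * indicator {s..} t \<partial>lborel)"
  proof (intro nn_integral_mono)
    fix t :: real
    show "ennreal (s powr (-1/4) * t powr (-1/4) * (s + t) powr (-1/2) * t powr (-1/2)) * indicator {0<..<1} t \<le>
      ennreal (s powr (-3/4) * t powr (-3/4)) * indicator {0..s} t +
        ennreal (s powr (-1/4) * t powr (-5/4) * s powr 0) * indicator {s..} t"
    proof (cases "t > 0")
      case t: True
      have e: "s powr (-1/4) * t powr (-1/4) * c * t powr (-1/2) = s powr (-1/4) * t powr (-3/4) * c" for c
        using t powr_add[of t "-1/4" "-1/2"] by simp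
      show ?thesis
      proof (cases "t \<le> s")
        case True
        have "(s + t) powr (-1/2) \<le> s powr (-1/2)" using s t by (intro powr_mono2') auto
        then have "s powr (-1/4) * t powr (-3/4) * (s + t) powr (-1/2) \<le> s powr (-1/4) * t powr (-3/4) * s powr (-1/2)"
          by (intro mult_left_mono) auto
        also have "\<dots> = s powr (-3/4) * t powr (-3/4)"
          using s powr_add[of s "-1/4" "-1/2"] by simp
        finally have "ennreal (s powr (-1/4) * t powr (-1/4) * (s + t) powr (-1/2) * t powr (-1/2)) \<le>
            ennreal (s powr (-3/4) * t powr (-3/4))"
          unfolding e by (rule ennreal_leI)
        then show ?thesis
          using t True by (auto split: split_indicator intro: order_trans add_increasing2)
      next
        case False
        have "(s + t) powr (-1/2) \<le> t powr (-1/2)" using s t by (intro powr_mono2') auto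
        then have "s powr (-1/4) * t powr (-3/4) * (s + t) powr (-1/2) \<le> s powr (-1/4) * t powr (-3/4) * t powr (-1/2)"
          by (intro mult_left_mono) auto
        also have "\<dots> = s powr (-1/4) * t powr (-5/4) * s powr 0"
          using s t powr_add[of t "-3/4" "-1/2"] by simp
        finally have "ennreal (s powr (-1/4) * t powr (-1/4) * (s + t) powr (-1/2) * t powr (-1/2)) \<le>
            ennreal (s powr (-1/4) * t powr (-5/4) * s powr 0)"
          unfolding e by (rule ennreal_leI)
        then show ?thesis
          using t False by (auto split: split_indicator)
      qed
    qed simp
  qed
  also have "\<dots> = ennreal (4 * s powr (-1/2)) + ennreal (4 * s powr (-1/2))"
    using s by (subst nn_integral_add) (simp_all only: 1 2, measurable)
  also have "\<dots> = ennreal (8 * s powr (-1/2))"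
    by (subst ennreal_plus[symmetric]) auto
  finally show ?thesis .
qed

section \<open>The embedding for Dirichlet polynomials\<close>

text \<open>For a Dirichlet polynomial this is the finite set of variables that its Bohr lift
  involves.\<close>

definition prime_support :: "(nat \<Rightarrow> complex) \<Rightarrow> nat set" where
  "prime_support a = {j. \<exists>n. a n \<noteq> 0 \<and> nth_prime j dvd n}"

lemma dirichlet_polys_D:
  assumes "a \<in> dirichlet_polys"
  shows "finite {n. a n \<noteq> 0}" "a n \<noteq> 0 \<Longrightarrow> n > 0"
  using assms by (auto simp: dirichlet_polys_def) (cases n; simp)

lemma finite_prime_support:
  assumes "a \<in> dirichlet_polys"
  shows "finite (prime_support a)"
proof -
  have "prime_support a = (\<Union>n\<in>{n. a n \<noteq> 0}. {j. nth_prime j dvd n})"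
    by (auto simp: prime_support_def)
  then show ?thesis
    using dirichlet_polys_D[OF assms] by (auto intro!: finite_nth_prime_dvd)
qed

definition dirichlet_value :: "(nat \<Rightarrow> complex) \<Rightarrow> real \<Rightarrow> complex" where
  "dirichlet_value a \<sigma> = (\<Sum>n | a n \<noteq> 0. a n * of_real (real n powr - (1/2 + \<sigma>)))"

lemma mult_fun_prime_support:
  assumes "a \<in> dirichlet_polys" "a n \<noteq> 0"
  shows "mult_fun z n = (\<Prod>j\<in>prime_support a. z j ^ multiplicity (nth_prime j) n)"
  using assms dirichlet_polys_D[OF assms(1)]
  by (intro mult_fun_superset finite_prime_support) (auto simp: prime_support_def)

lemma prod_halfline_point:
  assumes "a \<in> dirichlet_polys" "a n \<noteq> 0"
  shows "(\<Prod>j\<in>prime_support a. halfline_point \<sigma> j ^ multiplicity (nth_prime j) n) = real n powr - (1/2 + \<sigma>)"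
  unfolding halfline_point_def
  using assms dirichlet_polys_D[OF assms(1)]
  by (intro prod_nth_prime_powr_multiplicity finite_prime_support) (auto simp: prime_support_def)

text \<open>Complete multiplicativity turns the prime coordinates into powers of n; all variables of
  the lift are frozen, so z has no influence.\<close>

lemma bohr_lift_override_halfline:
  assumes "a \<in> dirichlet_polys"
  shows "bohr_lift a (override_on z (\<lambda>j. of_real (halfline_point \<sigma> j)) (prime_support a)) = dirichlet_value a \<sigma>"
  unfolding bohr_lift_def dirichlet_value_def
proof (intro sum.cong refl arg_cong2[where f = "(*)"])
  fix n assume "n \<in> {n. a n \<noteq> 0}"
  then have n: "a n \<noteq> 0" by simp
  show "mult_fun (override_on z (\<lambda>j. of_real (halfline_point \<sigma> j)) (prime_support a)) n =
      of_real (real n powr - (1/2 + \<sigma>))"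
    by (simp only: mult_fun_prime_support[OF assms n] prod_halfline_point[OF assms n, symmetric] of_real_prod of_real_power)
      (auto intro!: prod.cong simp: override_on_def)
qed

lemma bohr_lift_measurable [measurable]: "bohr_lift a \<in> borel_measurable torus_measure"
  unfolding bohr_lift_def by measurable

lemma bohr_lift_measurable_borel: "bohr_lift a \<in> borel_measurable (PiM UNIV (\<lambda>_. borel))"
  unfolding bohr_lift_def mult_fun_def by measurable

lemma norm_bohr_lift_le:
  assumes "z \<in> space torus_measure"
  shows "cmod (bohr_lift a z) \<le> (\<Sum>n | a n \<noteq> 0. cmod (a n))"
proof -
  have "cmod (mult_fun z n) = 1" for n
    using assms by (simp add: mult_fun_def space_torus_measure norm_power flip: prod_norm)
  then show ?thesis
    unfolding bohr_lift_def by (intro sum_norm_le) (simp add: norm_mult)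
qed

lemma integrable_bohr_lift: "integrable torus_measure (bohr_lift a)"
proof -
  interpret prob_space torus_measure by (rule prob_space_torus_measure)
  show ?thesis
    using norm_bohr_lift_le by (intro integrable_const_bound AE_I2) auto
qed

lemma poly_norm_1: "poly_norm 1 a = (\<integral>z. cmod (bohr_lift a z) \<partial>torus_measure)"
  by (simp add: poly_norm_def)

lemma nn_integral_bohr_lift: "(\<integral>\<^sup>+z. ennreal (cmod (bohr_lift a z)) \<partial>torus_measure) = ennreal (poly_norm 1 a)"
  unfolding poly_norm_1 by (intro nn_integral_eq_integral integrable_norm integrable_bohr_lift) auto

text \<open>Schur's test on (0, 1) with the weight s powr (-1/2): the constants of the Gram bound
  and of the kernel integral multiply, and neither depends on \<open>J\<close>.\<close>

lemma nn_integral_szego_transform_le: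
  assumes J: "finite J" and h: "h \<in> borel_measurable torus_measure"
  shows "(\<integral>\<^sup>+\<sigma>. (\<integral>\<^sup>+z. h z * ennreal (abs_szego J (halfline_point \<sigma>) z) \<partial>torus_measure)\<^sup>2 * indicator {0<..<1} \<sigma> \<partial>lborel)
    \<le> ennreal (8 * exp 762004) * (\<integral>\<^sup>+z. (h z)\<^sup>2 \<partial>torus_measure)"
proof (cases "(\<integral>\<^sup>+z. (h z)\<^sup>2 \<partial>torus_measure) = \<infinity>")
  case True
  then show ?thesis by (simp add: ennreal_mult_top)
next
  case False
  interpret T: prob_space torus_measure by (rule prob_space_torus_measure)
  note [measurable] = h
  define M where "M = restrict_space lborel {0<..<1::real}"
  define K where "K \<sigma> z = ennreal (abs_szego J (halfline_point \<sigma>) z)" for \<sigma> z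
  have space: "space M = {0<..<1}" by (simp add: M_def space_restrict_space)
  have to_M: "(\<integral>\<^sup>+\<sigma>. f \<sigma> \<partial>M) = (\<integral>\<^sup>+\<sigma>. f \<sigma> * indicator {0<..<1} \<sigma> \<partial>lborel)" for f
    unfolding M_def by (rule nn_integral_restrict_space) simp
  have mM: "(\<lambda>x. x) \<in> borel_measurable M"
    unfolding M_def by (rule measurable_restrict_space1) simp
  have fM: "sigma_finite_measure M"
  proof -
    have "finite_measure M"
      by (rule finite_measureI) (simp add: space, simp add: M_def emeasure_restrict_space)
    then show ?thesis by (simp add: finite_measure_def)
  qed
  have Km: "case_prod K \<in> borel_measurable (M \<Otimes>\<^sub>M torus_measure)"
  proof -
    have [measurable]: "(\<lambda>x. fst x) \<in> borel_measurable (M \<Otimes>\<^sub>M torus_measure)"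
      by (rule measurable_compose[OF measurable_fst mM])
    have [measurable]: "(\<lambda>x. snd x j) \<in> borel_measurable (M \<Otimes>\<^sub>M torus_measure)" for j
      by (rule measurable_compose[OF measurable_snd measurable_torus_component])
    show ?thesis
      unfolding K_def abs_szego_def halfline_point_def split_beta' by measurable
  qed
  have Schur: "(\<integral>\<^sup>+t. (\<integral>\<^sup>+z. K s z * K t z \<partial>torus_measure) * ennreal (t powr (-1/2)) \<partial>M) \<le>
      ennreal (8 * exp 762004) * ennreal (s powr (-1/2))" if s: "s \<in> space M" for s
  proof -
    have s: "0 < s" "s \<le> 1" using s space by auto
    let ?g = "\<lambda>t. ennreal (s powr (-1/4) * t powr (-1/4) * (s + t) powr (-1/2) * t powr (-1/2)) * indicator {0<..<1} t"
    have "(\<integral>\<^sup>+t. (\<integral>\<^sup>+z. K s z * K t z \<partial>torus_measure) * ennreal (t powr (-1/2)) \<partial>M) \<le>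
        (\<integral>\<^sup>+t. ennreal (exp 762004) * ?g t \<partial>lborel)"
      unfolding to_M
    proof (intro nn_integral_mono)
      fix t :: real
      show "(\<integral>\<^sup>+z. K s z * K t z \<partial>torus_measure) * ennreal (t powr (-1/2)) * indicator {0<..<1} t \<le>
          ennreal (exp 762004) * ?g t"
      proof (cases "t \<in> {0<..<1}")
        case True
        have "(\<integral>\<^sup>+z. K s z * K t z \<partial>torus_measure) * ennreal (t powr (-1/2)) \<le>
            ennreal (exp 762004 * (s powr (-1/4) * t powr (-1/4) * (s + t) powr (-1/2))) * ennreal (t powr (-1/2))"
          unfolding K_def using True s by (intro mult_right_mono szego_Gram_le J) auto
        also have "\<dots> = ennreal (exp 762004) * ennreal (s powr (-1/4) * t powr (-1/4) * (s + t) powr (-1/2) * t powr (-1/2))"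
          by (simp add: ennreal_mult mult.assoc)
        finally show ?thesis using True by simp
      qed simp
    qed
    also have "\<dots> = ennreal (exp 762004) * (\<integral>\<^sup>+t. ?g t \<partial>lborel)"
      by (intro nn_integral_cmult) measurable
    also have "\<dots> \<le> ennreal (exp 762004) * ennreal (8 * s powr (-1/2))"
      using s by (intro mult_left_mono nn_integral_Schur_kernel_le) auto
    also have "\<dots> = ennreal (8 * exp 762004) * ennreal (s powr (-1/2))"
      by (simp add: ennreal_mult mult_ac)
    finally show ?thesis .
  qed
  \<comment> \<open>This bound of the kernel depends on \<open>J\<close> and is used only
    qualitatively, to supply the finiteness that Schur's test asks for.\<close>
  define B where "B = (\<Prod>j\<in>J. 1 / (1 - halfline_point 0 j))"
  have hp: "halfline_point 0 j < 1" for j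
    using halfline_point_less_1[of 0 j] by simp
  have KB: "K s z \<le> ennreal B" if s: "s \<in> space M" and z: "z \<in> space torus_measure" for s z
  proof -
    have "abs_szego J (halfline_point s) z \<le> B"
      unfolding abs_szego_def B_def
    proof (intro prod_mono conjI)
      fix j assume "j \<in> J"
      have "1 - halfline_point 0 j \<le> 1 - cmod (of_real (halfline_point s j) * z j)"
        using s z halfline_point_bounds[of s j] by (simp add: space space_torus_measure norm_mult)
      also have "\<dots> \<le> cmod (1 - of_real (halfline_point s j) * z j)"
        using norm_triangle_ineq2[of 1 "of_real (halfline_point s j) * z j"] by simp
      finally show "1 / cmod (1 - of_real (halfline_point s j) * z j) \<le> 1 / (1 - halfline_point 0 j)"
        using hp[of j] by (intro frac_le) auto
    qed simp
    then show ?thesis unfolding K_def by (rule ennreal_leI)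
  qed
  have "(\<integral>\<^sup>+s. (\<integral>\<^sup>+z. h z * K s z \<partial>torus_measure)\<^sup>2 \<partial>M) \<le>
      (\<integral>\<^sup>+s. (\<integral>\<^sup>+z. (h z)\<^sup>2 \<partial>torus_measure) * (ennreal B)\<^sup>2 \<partial>M)"
  proof (intro nn_integral_mono)
    fix s assume s: "s \<in> space M"
    have [measurable]: "K s \<in> borel_measurable torus_measure" unfolding K_def by measurable
    have "(\<integral>\<^sup>+z. h z * K s z \<partial>torus_measure)\<^sup>2 \<le>
        (\<integral>\<^sup>+z. (h z)\<^sup>2 \<partial>torus_measure) * (\<integral>\<^sup>+z. (K s z)\<^sup>2 \<partial>torus_measure)"
      by (rule Cauchy_Schwarz_nn_integral) measurable
    also have "(\<integral>\<^sup>+z. (K s z)\<^sup>2 \<partial>torus_measure) \<le> (\<integral>\<^sup>+z. (ennreal B)\<^sup>2 \<partial>torus_measure)"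
      by (intro nn_integral_mono power_mono KB s) auto
    also have "\<dots> = (ennreal B)\<^sup>2" by (simp add: T.emeasure_space_1)
    finally show "(\<integral>\<^sup>+z. h z * K s z \<partial>torus_measure)\<^sup>2 \<le> (\<integral>\<^sup>+z. (h z)\<^sup>2 \<partial>torus_measure) * (ennreal B)\<^sup>2"
      by (simp add: mult_left_mono)
  qed
  also have "\<dots> < \<infinity>"
    unfolding to_M using False
    by (simp add: nn_integral_cmult_indicator ennreal_mult_less_top less_top ennreal_power power_less_top_ennreal)
  finally have fin: "(\<integral>\<^sup>+s. (\<integral>\<^sup>+z. h z * K s z \<partial>torus_measure)\<^sup>2 \<partial>M) < \<infinity>" .
  have "(\<integral>\<^sup>+s. (\<integral>\<^sup>+z. h z * K s z \<partial>torus_measure)\<^sup>2 \<partial>M) \<le>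
      ennreal (8 * exp 762004) * (\<integral>\<^sup>+z. (h z)\<^sup>2 \<partial>torus_measure)"
  proof (rule Schur_test[where w = "\<lambda>s. s powr (-1/2)"])
    show "(\<lambda>s. s powr (-1/2)) \<in> borel_measurable M" using mM by measurable
  qed (use fM Km h Schur fin space T.sigma_finite_measure_axioms in auto)
  then show ?thesis unfolding to_M K_def .
qed

text \<open>The function transformed is the square root of |F|, whose square integrates to
  \<open>poly_norm 1 a\<close>; squaring the pointwise bound recovers the value of the polynomial
  itself.\<close>

lemma nn_integral_dirichlet_value_le:
  assumes a: "a \<in> dirichlet_polys"
  shows "(\<integral>\<^sup>+\<sigma>. ennreal (cmod (dirichlet_value a \<sigma>)) * indicator {0<..<1} \<sigma> \<partial>lborel) \<le>
    ennreal (8 * exp 762004 * poly_norm 1 a)"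
proof -
  interpret T: prob_space torus_measure by (rule prob_space_torus_measure)
  let ?J = "prime_support a"
  let ?h = "\<lambda>z. ennreal (sqrt (cmod (bohr_lift a z)))"
  have "(\<integral>\<^sup>+\<sigma>. ennreal (cmod (dirichlet_value a \<sigma>)) * indicator {0<..<1} \<sigma> \<partial>lborel) \<le>
    (\<integral>\<^sup>+\<sigma>. (\<integral>\<^sup>+z. ?h z * ennreal (abs_szego ?J (halfline_point \<sigma>) z) \<partial>torus_measure)\<^sup>2 * indicator {0<..<1} \<sigma> \<partial>lborel)"
  proof (intro nn_integral_mono)
    fix \<sigma> :: real
    show "ennreal (cmod (dirichlet_value a \<sigma>)) * indicator {0<..<1} \<sigma> \<le>
      (\<integral>\<^sup>+z. ?h z * ennreal (abs_szego ?J (halfline_point \<sigma>) z) \<partial>torus_measure)\<^sup>2 * indicator {0<..<1} \<sigma>"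
    proof (cases "\<sigma> \<in> {0<..<1}")
      case True
      then have "\<bar>halfline_point \<sigma> j\<bar> < 1" for j
        by (intro halfline_point_less_1) simp
      then have "(\<integral>\<^sup>+z. ennreal (sqrt (cmod (bohr_lift a (override_on z (\<lambda>j. of_real (halfline_point \<sigma> j)) ?J)))) \<partial>torus_measure)
          \<le> (\<integral>\<^sup>+z. ennreal (sqrt (cmod (bohr_lift a z)) * abs_szego ?J (halfline_point \<sigma>) z) \<partial>torus_measure)"
        by (intro sqrt_norm_sep_poly_le finite_prime_support a bohr_lift_measurable_borel sep_poly_bohr_lift)
      then have "ennreal (sqrt (cmod (dirichlet_value a \<sigma>))) \<le>
          (\<integral>\<^sup>+z. ?h z * ennreal (abs_szego ?J (halfline_point \<sigma>) z) \<partial>torus_measure)"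
        by (simp add: bohr_lift_override_halfline[OF a] T.emeasure_space_1 ennreal_mult abs_szego_nonneg)
      then have "(ennreal (sqrt (cmod (dirichlet_value a \<sigma>))))\<^sup>2 \<le>
          (\<integral>\<^sup>+z. ?h z * ennreal (abs_szego ?J (halfline_point \<sigma>) z) \<partial>torus_measure)\<^sup>2"
        by (intro power_mono) auto
      then show ?thesis using True by (simp add: ennreal_power)
    qed simp
  qed
  also have "\<dots> \<le> ennreal (8 * exp 762004) * (\<integral>\<^sup>+z. (?h z)\<^sup>2 \<partial>torus_measure)"
    by (intro nn_integral_szego_transform_le finite_prime_support a) measurable
  also have "\<dots> = ennreal (8 * exp 762004 * poly_norm 1 a)"
    by (simp add: ennreal_power nn_integral_bohr_lift ennreal_mult poly_norm_1)
  finally show ?thesis .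
qed

section \<open>Absolute sums of coefficients\<close>

text \<open>A test function with prescribed coefficients at the frequencies \<open>0\<close>, \<open>-1\<close>, \<open>-2\<close> of \<open>z\<close>; here
  \<open>y\<close> and \<open>b\<close> stand for unimodular multiples of \<open>cnj z\<close> and \<open>(cnj z)\<^sup>2\<close>. The terms in \<open>cnj y\<close> and
  \<open>cnj b\<close> make the first correction imaginary, and \<open>(cnj y)\<^sup>2\<close> cancels the oscillation of
  its square, so that the modulus is constant up to third order in \<open>r\<close>.\<close>

lemma norm_dual_symbol_le:
  assumes y: "cmod y = 1" and b: "cmod b = 1" and r: "0 \<le> r" "r \<le> 1"
  shows "cmod (1 + of_real r * (y - cnj y) + of_real (r\<^sup>2) * (b - cnj b + (cnj y)\<^sup>2)) \<le> 1 + r\<^sup>2 + 11 * r ^ 3"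
proof -
  define \<eta> \<xi> where "\<eta> = Im y" and "\<xi> = 2 * Im b - 2 * Re y * Im y"
  have sq: "(Re y)\<^sup>2 + \<eta>\<^sup>2 = 1" using y by (simp add: cmod_power2[symmetric] \<eta>_def)
  have \<eta>: "\<bar>\<eta>\<bar> \<le> 1" using abs_Im_le_cmod[of y] y by (simp add: \<eta>_def)
  have "\<bar>Im (y\<^sup>2)\<bar> \<le> 1" using abs_Im_le_cmod[of "y\<^sup>2"] y by (simp add: norm_power)
  moreover have "Im (y\<^sup>2) = 2 * Re y * Im y" by (simp add: power2_eq_square)
  ultimately have \<xi>: "\<bar>\<xi>\<bar> \<le> 3"
    using abs_Im_le_cmod[of b] b unfolding \<xi>_def by linarith
  have r4: "r ^ 4 \<le> r ^ 3" using r by (intro power_decreasing) auto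
  have "\<eta>\<^sup>2 \<le> 1" using \<eta> by (simp add: abs_square_le_1)
  then have q: "(1 - 2 * \<eta>\<^sup>2)\<^sup>2 \<le> 1" by (simp add: abs_square_le_1 abs_le_iff)
  have "\<xi>\<^sup>2 \<le> 3\<^sup>2" using \<xi> by (metis abs_ge_zero power2_abs power_mono)
  then have "r ^ 4 * ((1 - 2 * \<eta>\<^sup>2)\<^sup>2 + \<xi>\<^sup>2) \<le> r ^ 4 * 10"
    using q r by (intro mult_left_mono) auto
  moreover have "\<bar>\<eta> * \<xi>\<bar> \<le> 1 * 3" unfolding abs_mult using \<eta> \<xi> by (intro mult_mono) auto
  then have "r ^ 3 * (\<eta> * \<xi>) \<le> r ^ 3 * 3" using r by (intro mult_left_mono) auto
  ultimately have up: "1 + 2 * r\<^sup>2 + r ^ 4 * ((1 - 2 * \<eta>\<^sup>2)\<^sup>2 + \<xi>\<^sup>2) + 4 * (r ^ 3 * (\<eta> * \<xi>)) \<le> 1 + 2 * r\<^sup>2 + 22 * r ^ 3"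
    using r4 by linarith
  have re: "Re (1 + of_real r * (y - cnj y) + of_real (r\<^sup>2) * (b - cnj b + (cnj y)\<^sup>2)) = 1 + r\<^sup>2 * (1 - 2 * \<eta>\<^sup>2)"
  proof -
    have "Re ((cnj y)\<^sup>2) = 1 - 2 * \<eta>\<^sup>2" using sq by (simp add: \<eta>_def power2_eq_square)
    then show ?thesis by simp
  qed
  have im: "Im (1 + of_real r * (y - cnj y) + of_real (r\<^sup>2) * (b - cnj b + (cnj y)\<^sup>2)) = 2 * r * \<eta> + r\<^sup>2 * \<xi>"
    by (simp add: \<eta>_def \<xi>_def power2_eq_square algebra_simps)
  \<comment> \<open>The squares contribute 2 r^2 (1 - 2 \<eta>^2) from the real part and 4 r^2
    \<eta>^2 from the imaginary part: the oscillation cancels and 2 r^2 remains.\<close>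
  have "(cmod (1 + of_real r * (y - cnj y) + of_real (r\<^sup>2) * (b - cnj b + (cnj y)\<^sup>2)))\<^sup>2 =
     1 + 2 * r\<^sup>2 + r ^ 4 * ((1 - 2 * \<eta>\<^sup>2)\<^sup>2 + \<xi>\<^sup>2) + 4 * (r ^ 3 * (\<eta> * \<xi>))"
    unfolding cmod_power2 re im
    by (simp add: power2_eq_square power3_eq_cube power4_eq_xxxx algebra_simps)
  also note up
  also have "1 + 2 * r\<^sup>2 + 22 * r ^ 3 \<le> (1 + r\<^sup>2 + 11 * r ^ 3)\<^sup>2"
  proof -
    have "(1 + r\<^sup>2 + 11 * r ^ 3)\<^sup>2 = 1 + 2 * r\<^sup>2 + 22 * r ^ 3 + (r\<^sup>2 + 11 * r ^ 3)\<^sup>2"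
      by (simp add: power2_eq_square algebra_simps)
    then show ?thesis by simp
  qed
  finally show ?thesis
    by (rule power2_le_imp_le) (use r in simp)
qed

text \<open>By duality: f is paired with \<phi>, whose coefficients at the frequencies 0, -1, -2 are
  1, r, r^2 up to phases matched to the first coefficients of f. The positive frequencies of \<phi>
  are invisible to f and only keep its sup norm at 1 + r^2 + 11 r^3. Coefficients of index 3 and
  above are bounded by the norm of f, and their geometric tail adds 4 r^3 because r \<le> 3/4. A
  term linear in r would ruin the bound, as the sum of p powr - (1/2 + \<sigma>) over the primes
  diverges for \<sigma> \<le> 1/2.\<close>

lemma sum_norm_coeff_power_le:
  fixes c :: "nat \<Rightarrow> complex"
  assumes A: "finite A" and r: "0 \<le> r" "r\<^sup>2 \<le> 1 / 2"
  shows "(\<Sum>k\<in>A. cmod (c k) * r ^ k) \<le> (1 + r\<^sup>2 + 15 * r ^ 3) * (\<integral>x. cmod (\<Sum>k\<in>A. c k * x ^ k) \<partial>circle_measure)"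
proof -
  interpret prob_space circle_measure by (rule prob_space_circle_measure)
  define f where "f x = (\<Sum>k\<in>A. c k * x ^ k)" for x
  define I where "I = (\<integral>x. cmod (f x) \<partial>circle_measure)"
  define d where "d k = (if k \<in> A then c k else 0)" for k
  have cont: "continuous_on UNIV f" unfolding f_def by (intro continuous_intros)
  have I0: "I \<ge> 0" unfolding I_def by simp
  have r1: "r \<le> 3 / 4"
  proof (rule power2_le_imp_le)
    show "r\<^sup>2 \<le> (3 / 4)\<^sup>2" using r(2) by (simp add: power2_eq_square)
  qed simp
  \<comment> \<open>The pairing reads off the coefficient of index \<open>l - m\<close>, and
    vanishes for m > l because f has no negative frequencies.\<close>
  have test: "(\<integral>x. f x * (x ^ m * cnj x ^ l) \<partial>circle_measure) = (if m \<le> l then d (l - m) else 0)" for m l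
  proof -
    have "(\<integral>x. f x * (x ^ m * cnj x ^ l) \<partial>circle_measure) = (\<integral>x. (\<Sum>k\<in>A. c k * (x ^ (k + m) * cnj x ^ l)) \<partial>circle_measure)"
      by (simp add: f_def sum_distrib_left sum_distrib_right power_add mult_ac)
    also have "\<dots> = (\<Sum>k\<in>A. c k * (\<integral>x. x ^ (k + m) * cnj x ^ l \<partial>circle_measure))"
      by (subst Bochner_Integration.integral_sum)
        (auto intro!: integrable_circle continuous_intros)
    also have "\<dots> = (\<Sum>k\<in>A. if k = l - m \<and> m \<le> l then c k else 0)"
      by (intro sum.cong) (auto simp: integral_circle_power_cnj_power)
    also have "\<dots> = (if m \<le> l then d (l - m) else 0)"
      using A by (simp add: d_def)
    finally show ?thesis .
  qed
  have bound: "cmod (\<integral>x. f x * \<phi> x \<partial>circle_measure) \<le> B * I"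
    if "continuous_on UNIV \<phi>" "\<And>x. cmod x = 1 \<Longrightarrow> cmod (\<phi> x) \<le> B" for \<phi> B
  proof -
    have "cmod (\<integral>x. f x * \<phi> x \<partial>circle_measure) \<le> (\<integral>x. cmod (f x * \<phi> x) \<partial>circle_measure)"
      by (rule integral_norm_bound)
    also have "\<dots> \<le> (\<integral>x. B * cmod (f x) \<partial>circle_measure)"
      using cont that
      by (intro integral_mono_AE integrable_circle continuous_intros AE_I2)
        (auto simp: space_circle_measure norm_mult mult.commute intro!: mult_right_mono)
    finally show ?thesis by (simp add: I_def)
  qed
  have coeff: "cmod (d l) \<le> I" for l
  proof -
    have "cmod (\<integral>x. f x * cnj x ^ l \<partial>circle_measure) \<le> 1 * I"
      by (rule bound) (auto intro!: continuous_intros simp: norm_power)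
    then show ?thesis using test[of 0 l] by simp
  qed
  \<comment> \<open>The value 1 at a vanishing coefficient keeps every phase unimodular.\<close>
  define \<epsilon> where "\<epsilon> k = (if d k = 0 then 1 else cnj (sgn (d k)))" for k
  have \<epsilon>: "cmod (\<epsilon> k) = 1" "\<epsilon> k * d k = of_real (cmod (d k))" for k
    by (auto simp: \<epsilon>_def norm_sgn sgn_div_norm complex_norm_square[symmetric] scaleR_conv_of_real norm_divide
        power2_eq_square mult.commute divide_simps)
  \<comment> \<open>Phases relative to \<open>\<epsilon> 0\<close>, which is factored out of the
    test function so that the remaining symbol has constant term 1.\<close>
  define \<alpha> \<beta> where "\<alpha> = \<epsilon> 1 * cnj (\<epsilon> 0)" and "\<beta> = \<epsilon> 2 * cnj (\<epsilon> 0)"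
  have ab: "cmod \<alpha> = 1" "cmod \<beta> = 1" by (auto simp: \<alpha>_def \<beta>_def norm_mult \<epsilon>)
  have e0: "\<epsilon> 0 * cnj (\<epsilon> 0) = 1"
    using \<epsilon>(1)[of 0] by (simp add: complex_norm_square[symmetric])
  have e: "\<epsilon> 0 * \<alpha> = \<epsilon> 1" "\<epsilon> 0 * \<beta> = \<epsilon> 2"
    unfolding \<alpha>_def \<beta>_def using e0 by (simp_all add: mult.left_commute[of "\<epsilon> 0"])
  define \<phi> where "\<phi> x = \<epsilon> 0 * (1 + of_real r * (\<alpha> * cnj x - cnj (\<alpha> * cnj x)) +
      of_real (r\<^sup>2) * (\<beta> * (cnj x)\<^sup>2 - cnj (\<beta> * (cnj x)\<^sup>2) + (cnj (\<alpha> * cnj x))\<^sup>2))" for x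
  have \<phi>c: "continuous_on UNIV \<phi>" unfolding \<phi>_def by (intro continuous_intros)
  have "(\<integral>x. f x * \<phi> x \<partial>circle_measure) = (\<integral>x.
      \<epsilon> 0 * (f x * (x ^ 0 * cnj x ^ 0)) + of_real r * \<epsilon> 1 * (f x * (x ^ 0 * cnj x ^ 1))
      + of_real (r\<^sup>2) * \<epsilon> 2 * (f x * (x ^ 0 * cnj x ^ 2))
      + (- (\<epsilon> 0 * of_real r * cnj \<alpha>)) * (f x * (x ^ 1 * cnj x ^ 0))
      + \<epsilon> 0 * of_real (r\<^sup>2) * ((cnj \<alpha>)\<^sup>2 - cnj \<beta>) * (f x * (x ^ 2 * cnj x ^ 0)) \<partial>circle_measure)"
    by (intro Bochner_Integration.integral_cong refl)
      (simp add: \<phi>_def e[symmetric] power_mult_distrib algebra_simps del: One_nat_def)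
  also have "\<dots> = \<epsilon> 0 * d 0 + of_real r * \<epsilon> 1 * d 1 + of_real (r\<^sup>2) * \<epsilon> 2 * d 2"
  proof -
    have i: "integrable circle_measure (\<lambda>x. z * (f x * (x ^ m * cnj x ^ l)))" for z m l
      using cont by (intro integrable_circle continuous_intros)
    show ?thesis
      by (simp only: Bochner_Integration.integral_add i Bochner_Integration.integrable_add
          integral_mult_right_zero test) simp
  qed
  also have "\<dots> = of_real (cmod (d 0) + r * cmod (d 1) + r\<^sup>2 * cmod (d 2))"
    by (simp add: \<epsilon>(2) mult.assoc)
  finally have "cmod (d 0) + r * cmod (d 1) + r\<^sup>2 * cmod (d 2) \<le> cmod (\<integral>x. f x * \<phi> x \<partial>circle_measure)"
    by (simp only: norm_of_real)
  also have "\<dots> \<le> (1 + r\<^sup>2 + 11 * r ^ 3) * I"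
  proof (rule bound[OF \<phi>c])
    fix x assume "cmod x = 1"
    then show "cmod (\<phi> x) \<le> 1 + r\<^sup>2 + 11 * r ^ 3"
      unfolding \<phi>_def norm_mult \<epsilon>(1) mult_1 using r r1 ab
      by (intro norm_dual_symbol_le) (auto simp: norm_mult norm_power)
  qed
  finally have low: "cmod (d 0) + r * cmod (d 1) + r\<^sup>2 * cmod (d 2) \<le> (1 + r\<^sup>2 + 11 * r ^ 3) * I" .
  have geo: "(\<Sum>k<N. r ^ k) \<le> 4" for N
  proof -
    have "(\<Sum>k<N. r ^ k) = (1 - r ^ N) / (1 - r)" using r1 by (subst sum_gp_strict) auto
    also have "\<dots> \<le> 1 / (1 - r)" using r r1 by (intro divide_right_mono) auto
    also have "\<dots> \<le> 4" using r1 by (simp add: divide_le_eq)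
    finally show ?thesis .
  qed
  obtain N where N: "A \<subseteq> {..<N + 3}"
  proof -
    obtain N where "A \<subseteq> {..<N}" using A finite_nat_iff_bounded by auto
    then show ?thesis by (intro that[of N]) auto
  qed
  have "(\<Sum>k\<in>A. cmod (c k) * r ^ k) = (\<Sum>k\<in>A. cmod (d k) * r ^ k)"
    by (simp add: d_def)
  also have "\<dots> \<le> (\<Sum>k<N + 3. cmod (d k) * r ^ k)"
    using N r by (intro sum_mono2) auto
  also have "\<dots> = (cmod (d 0) + r * cmod (d 1) + r\<^sup>2 * cmod (d 2)) + (\<Sum>k<N. cmod (d (k + 3)) * r ^ (k + 3))"
    by (induction N) (simp_all add: eval_nat_numeral algebra_simps)
  also have "(\<Sum>k<N. cmod (d (k + 3)) * r ^ (k + 3)) \<le> (\<Sum>k<N. I * r ^ 3 * r ^ k)"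
  proof (rule sum_mono)
    fix k
    have "cmod (d (k + 3)) * (r ^ 3 * r ^ k) \<le> I * (r ^ 3 * r ^ k)"
      using r by (intro mult_right_mono coeff) auto
    then show "cmod (d (k + 3)) * r ^ (k + 3) \<le> I * r ^ 3 * r ^ k"
      by (simp add: power_add mult_ac)
  qed
  also have "\<dots> = I * r ^ 3 * (\<Sum>k<N. r ^ k)" by (simp add: sum_distrib_left)
  also have "\<dots> \<le> I * r ^ 3 * 4" using geo I0 r by (intro mult_left_mono) auto
  also note low
  finally have "(\<Sum>k\<in>A. cmod (c k) * r ^ k) \<le> (1 + r\<^sup>2 + 11 * r ^ 3) * I + I * r ^ 3 * 4" by simp
  then show ?thesis by (simp add: I_def f_def algebra_simps)
qed

lemma nn_sum_norm_coeff_power_le: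
  fixes c :: "nat \<Rightarrow> complex"
  assumes A: "finite A" and r: "0 \<le> r" "r\<^sup>2 \<le> 1 / 2"
  shows "ennreal (\<Sum>k\<in>A. cmod (c k) * r ^ k) \<le>
    ennreal (1 + r\<^sup>2 + 15 * r ^ 3) * (\<integral>\<^sup>+x. ennreal (cmod (\<Sum>k\<in>A. c k * x ^ k)) \<partial>circle_measure)"
proof -
  have "(\<integral>\<^sup>+x. ennreal (cmod (\<Sum>k\<in>A. c k * x ^ k)) \<partial>circle_measure) = ennreal (\<integral>x. cmod (\<Sum>k\<in>A. c k * x ^ k) \<partial>circle_measure)"
    by (intro nn_integral_eq_integral integrable_circle continuous_intros) auto
  moreover have "ennreal (\<Sum>k\<in>A. cmod (c k) * r ^ k) \<le>
      ennreal ((1 + r\<^sup>2 + 15 * r ^ 3) * (\<integral>x. cmod (\<Sum>k\<in>A. c k * x ^ k) \<partial>circle_measure))"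
    by (intro ennreal_leI sum_norm_coeff_power_le assms)
  moreover have "\<dots> = ennreal (1 + r\<^sup>2 + 15 * r ^ 3) * ennreal (\<integral>x. cmod (\<Sum>k\<in>A. c k * x ^ k) \<partial>circle_measure)"
    using r by (intro ennreal_mult) auto
  ultimately show ?thesis by simp
qed

text \<open>The terms are sliced by the exponent k of the new variable. The induction hypothesis
  bounds each slice by the norm of \<open>F k\<close>, and for fixed other variables the
  one-variable bound sums |F k z| with the weights r j ^ k. Distinct exponent vectors on
  \<open>A\<close> ensure that each slice again consists of distinct monomials.\<close>

lemma sum_norm_multivariate_coeff_le:
  fixes c :: "nat \<Rightarrow> complex" and e :: "nat \<Rightarrow> nat \<Rightarrow> nat"
  assumes "finite J" "finite A" "\<And>m n. m \<in> A \<Longrightarrow> n \<in> A \<Longrightarrow> (\<And>j. j \<in> J \<Longrightarrow> e m j = e n j) \<Longrightarrow> m = n"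
    and r: "\<And>j. j \<in> J \<Longrightarrow> 0 \<le> r j" "\<And>j. j \<in> J \<Longrightarrow> (r j)\<^sup>2 \<le> 1 / 2"
  shows "ennreal (\<Sum>n\<in>A. cmod (c n) * (\<Prod>j\<in>J. r j ^ e n j)) \<le>
    ennreal (\<Prod>j\<in>J. 1 + (r j)\<^sup>2 + 15 * r j ^ 3) *
      (\<integral>\<^sup>+z. ennreal (cmod (\<Sum>n\<in>A. c n * (\<Prod>j\<in>J. z j ^ e n j))) \<partial>torus_measure)"
  using assms
proof (induction J arbitrary: A rule: finite_induct)
  case empty
  interpret prob_space torus_measure by (rule prob_space_torus_measure)
  \<comment> \<open>Without variables all exponent vectors agree, so at most one term is
    left.\<close>
  consider "A = {}" | n where "A = {n}"
    using empty.prems(2) by (metis all_not_in_conv empty_iff insertI1 singletonI subsetI subset_singletonD)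
  then show ?case by cases (simp_all add: emeasure_space_1)
next
  case (insert j J)
  define B where "B k = {n \<in> A. e n j = k}" for k
  define Ks where "Ks = (\<lambda>n. e n j) ` A"
  have fin: "finite Ks" "\<And>k. finite (B k)" using insert.prems by (auto simp: Ks_def B_def)
  define F where "F k z = (\<Sum>n\<in>B k. c n * (\<Prod>j\<in>J. z j ^ e n j))" for k and z :: "nat \<Rightarrow> complex"
  define P where "P = (\<Prod>j\<in>J. 1 + (r j)\<^sup>2 + 15 * r j ^ 3)"
  have P: "P \<ge> 0" unfolding P_def using insert.prems by (intro prod_nonneg) auto
  have rj: "0 \<le> r j" "(r j)\<^sup>2 \<le> 1 / 2" using insert.prems by auto
  have [measurable]: "F k \<in> borel_measurable torus_measure" for k
    unfolding F_def by measurable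
  have G: "(\<Sum>n\<in>A. c n * (\<Prod>i\<in>insert j J. (z(j := x)) i ^ e n i)) = (\<Sum>k\<in>Ks. F k z * x ^ k)" for z x
  proof -
    have "(\<Sum>n\<in>A. c n * (\<Prod>i\<in>insert j J. (z(j := x)) i ^ e n i)) =
        (\<Sum>n\<in>A. c n * (\<Prod>i\<in>J. z i ^ e n i) * x ^ e n j)"
    proof (intro sum.cong refl)
      fix n
      have "(\<Prod>i\<in>J. (z(j := x)) i ^ e n i) = (\<Prod>i\<in>J. z i ^ e n i)"
        using insert.hyps by (intro prod.cong) auto
      then show "c n * (\<Prod>i\<in>insert j J. (z(j := x)) i ^ e n i) = c n * (\<Prod>i\<in>J. z i ^ e n i) * x ^ e n j"
        using insert.hyps by simp
    qed
    also have "\<dots> = (\<Sum>k\<in>Ks. \<Sum>n\<in>B k. c n * (\<Prod>i\<in>J. z i ^ e n i) * x ^ e n j)"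
      unfolding Ks_def B_def using insert.prems(1) by (rule sum.image_gen)
    also have "\<dots> = (\<Sum>k\<in>Ks. F k z * x ^ k)"
      unfolding F_def sum_distrib_right by (intro sum.cong refl) (simp add: B_def)
    finally show ?thesis .
  qed
  have "(\<Sum>n\<in>A. cmod (c n) * (\<Prod>i\<in>insert j J. r i ^ e n i)) =
      (\<Sum>k\<in>Ks. \<Sum>n\<in>B k. cmod (c n) * (\<Prod>i\<in>insert j J. r i ^ e n i))"
    unfolding Ks_def B_def using insert.prems(1) by (rule sum.image_gen)
  also have "\<dots> = (\<Sum>k\<in>Ks. r j ^ k * (\<Sum>n\<in>B k. cmod (c n) * (\<Prod>i\<in>J. r i ^ e n i)))"
    unfolding sum_distrib_left using insert.hyps by (intro sum.cong refl) (simp add: B_def mult_ac)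
  finally have "ennreal (\<Sum>n\<in>A. cmod (c n) * (\<Prod>i\<in>insert j J. r i ^ e n i)) =
      (\<Sum>k\<in>Ks. ennreal (r j ^ k) * ennreal (\<Sum>n\<in>B k. cmod (c n) * (\<Prod>i\<in>J. r i ^ e n i)))"
    using insert.prems
    by (simp add: ennreal_mult[symmetric] sum_nonneg prod_nonneg)
  also have "\<dots> \<le> (\<Sum>k\<in>Ks. ennreal (r j ^ k) * (ennreal P * (\<integral>\<^sup>+z. ennreal (cmod (F k z)) \<partial>torus_measure)))"
  proof (intro sum_mono mult_left_mono)
    fix k assume "k \<in> Ks"
    show "ennreal (\<Sum>n\<in>B k. cmod (c n) * (\<Prod>i\<in>J. r i ^ e n i)) \<le>
        ennreal P * (\<integral>\<^sup>+z. ennreal (cmod (F k z)) \<partial>torus_measure)"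
      unfolding P_def F_def
    proof (rule insert.IH)
      fix m n assume mn: "m \<in> B k" "n \<in> B k" "\<And>i. i \<in> J \<Longrightarrow> e m i = e n i"
      show "m = n"
      proof (rule insert.prems(2))
        show "e m i = e n i" if "i \<in> insert j J" for i
          using that mn by (auto simp: B_def)
      qed (use mn in \<open>auto simp: B_def\<close>)
    qed (use insert.prems fin in auto)
  qed auto
  also have "\<dots> = ennreal P * (\<Sum>k\<in>Ks. ennreal (r j ^ k) * (\<integral>\<^sup>+z. ennreal (cmod (F k z)) \<partial>torus_measure))"
    by (simp add: sum_distrib_left mult_ac)
  also have "(\<Sum>k\<in>Ks. ennreal (r j ^ k) * (\<integral>\<^sup>+z. ennreal (cmod (F k z)) \<partial>torus_measure)) =
      (\<integral>\<^sup>+z. (\<Sum>k\<in>Ks. ennreal (r j ^ k) * ennreal (cmod (F k z))) \<partial>torus_measure)"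
    by (simp add: nn_integral_sum nn_integral_cmult)
  also have "\<dots> = (\<integral>\<^sup>+z. ennreal (\<Sum>k\<in>Ks. cmod (F k z) * r j ^ k) \<partial>torus_measure)"
    using rj by (simp add: ennreal_mult[symmetric] mult.commute)
  also have "\<dots> \<le> (\<integral>\<^sup>+z. ennreal (1 + (r j)\<^sup>2 + 15 * r j ^ 3) *
      (\<integral>\<^sup>+x. ennreal (cmod (\<Sum>k\<in>Ks. F k z * x ^ k)) \<partial>circle_measure) \<partial>torus_measure)"
    by (intro nn_integral_mono nn_sum_norm_coeff_power_le fin rj)
  also have "\<dots> = (\<integral>\<^sup>+z. ennreal (1 + (r j)\<^sup>2 + 15 * r j ^ 3) *
      (\<integral>\<^sup>+x. ennreal (cmod (\<Sum>n\<in>A. c n * (\<Prod>i\<in>insert j J. (z(j := x)) i ^ e n i))) \<partial>circle_measure) \<partial>torus_measure)"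
    by (simp only: G)
  also have "\<dots> = ennreal (1 + (r j)\<^sup>2 + 15 * r j ^ 3) * (\<integral>\<^sup>+z.
      (\<integral>\<^sup>+x. ennreal (cmod (\<Sum>n\<in>A. c n * (\<Prod>i\<in>insert j J. (z(j := x)) i ^ e n i))) \<partial>circle_measure) \<partial>torus_measure)"
  proof (rule nn_integral_cmult)
    interpret C: prob_space circle_measure by (rule prob_space_circle_measure)
    have [measurable]: "(\<lambda>x. x) \<in> borel_measurable circle_measure"
      by (intro borel_measurable_circle) simp
    show "(\<lambda>z. \<integral>\<^sup>+x. ennreal (cmod (\<Sum>n\<in>A. c n * (\<Prod>i\<in>insert j J. (z(j := x)) i ^ e n i))) \<partial>circle_measure)
      \<in> borel_measurable torus_measure"
      unfolding G by measurable
  qed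
  also have "(\<integral>\<^sup>+z. (\<integral>\<^sup>+x. ennreal (cmod (\<Sum>n\<in>A. c n * (\<Prod>i\<in>insert j J. (z(j := x)) i ^ e n i))) \<partial>circle_measure) \<partial>torus_measure)
      = (\<integral>\<^sup>+z. ennreal (cmod (\<Sum>n\<in>A. c n * (\<Prod>i\<in>insert j J. z i ^ e n i))) \<partial>torus_measure)"
    by (rule nn_integral_torus_coordinate[symmetric]) measurable
  also have "ennreal P * (ennreal (1 + (r j)\<^sup>2 + 15 * r j ^ 3) * \<dots>) =
      ennreal (\<Prod>i\<in>insert j J. 1 + (r i)\<^sup>2 + 15 * r i ^ 3) * \<dots>"
    using insert.hyps P rj by (simp add: P_def[symmetric] ennreal_mult mult_ac)
  finally show ?case by (simp add: mult_left_mono)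
qed

section \<open>Linearity of the lift and the norm of Dirichlet polynomials\<close>

lemma bohr_lift_superset:
  assumes "finite A" "{n. a n \<noteq> 0} \<subseteq> A"
  shows "bohr_lift a z = (\<Sum>n\<in>A. a n * mult_fun z n)"
  unfolding bohr_lift_def by (rule sum.mono_neutral_left) (use assms in auto)

lemma dirichlet_polys_diff:
  assumes "a \<in> dirichlet_polys" "b \<in> dirichlet_polys"
  shows "(\<lambda>n. a n - b n) \<in> dirichlet_polys"
proof -
  have "{n. a n - b n \<noteq> 0} \<subseteq> {n. a n \<noteq> 0} \<union> {n. b n \<noteq> 0}" by auto
  then show ?thesis
    using assms by (auto simp: dirichlet_polys_def intro: finite_subset)
qed

lemma bohr_lift_diff:
  assumes "a \<in> dirichlet_polys" "b \<in> dirichlet_polys"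
  shows "bohr_lift (\<lambda>n. a n - b n) z = bohr_lift a z - bohr_lift b z"
proof -
  let ?A = "{n. a n \<noteq> 0} \<union> {n. b n \<noteq> 0}"
  have A: "finite ?A" using assms by (simp add: dirichlet_polys_def)
  have "bohr_lift (\<lambda>n. a n - b n) z = (\<Sum>n\<in>?A. (a n - b n) * mult_fun z n)"
    by (rule bohr_lift_superset[OF A]) auto
  also have "\<dots> = (\<Sum>n\<in>?A. a n * mult_fun z n) - (\<Sum>n\<in>?A. b n * mult_fun z n)"
    by (simp add: left_diff_distrib sum_subtractf)
  also have "\<dots> = bohr_lift a z - bohr_lift b z"
    by (subst (1 2) bohr_lift_superset[OF A]) auto
  finally show ?thesis .
qed

lemma poly_norm_nonneg: "poly_norm 1 a \<ge> 0"
  by (simp add: poly_norm_1)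

lemma poly_norm_minus_commute:
  assumes "a \<in> dirichlet_polys" "b \<in> dirichlet_polys"
  shows "poly_norm 1 (\<lambda>n. a n - b n) = poly_norm 1 (\<lambda>n. b n - a n)"
  unfolding poly_norm_1 bohr_lift_diff[OF assms] bohr_lift_diff[OF assms(2,1)]
  by (simp add: norm_minus_commute)

lemma poly_norm_diff_bound:
  assumes "a \<in> dirichlet_polys" "b \<in> dirichlet_polys"
  shows "\<bar>poly_norm 1 a - poly_norm 1 b\<bar> \<le> poly_norm 1 (\<lambda>n. a n - b n)"
proof -
  have "poly_norm 1 a - poly_norm 1 b \<le> poly_norm 1 (\<lambda>n. a n - b n)"
    if "a \<in> dirichlet_polys" "b \<in> dirichlet_polys" for a b
  proof -
    have "poly_norm 1 a - poly_norm 1 b = (\<integral>z. cmod (bohr_lift a z) - cmod (bohr_lift b z) \<partial>torus_measure)"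
      unfolding poly_norm_1
      by (intro Bochner_Integration.integral_diff[symmetric] integrable_norm integrable_bohr_lift)
    also have "\<dots> \<le> poly_norm 1 (\<lambda>n. a n - b n)"
      unfolding poly_norm_1
    proof (rule integral_mono)
      show "cmod (bohr_lift a z) - cmod (bohr_lift b z) \<le> cmod (bohr_lift (\<lambda>n. a n - b n) z)" for z
        unfolding bohr_lift_diff[OF that] by (rule norm_triangle_ineq2)
    qed (intro Bochner_Integration.integrable_diff integrable_norm integrable_bohr_lift)+
    finally show ?thesis .
  qed
  from this[OF assms] this[OF assms(2,1)] show ?thesis
    using poly_norm_minus_commute[OF assms] by linarith
qed

text \<open>The product of 1 + r^2 + 15 r^3 over the primes is at most the exponential of (ln (1 + 1
  / (2 \<sigma>)) + 2) + 15 * 3, where 3 = 1 + 1 / (1/2) bounds the sum of p powr - (3/2); hence 47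
  = 2 + 45.\<close>

definition abs_sum_const :: "real \<Rightarrow> real" where
  "abs_sum_const \<sigma> = exp 47 * (1 + 1 / (\<sigma> + \<sigma>))"

lemma abs_sum_const_nonneg: "\<sigma> > 0 \<Longrightarrow> abs_sum_const \<sigma> \<ge> 0"
  by (simp add: abs_sum_const_def)

text \<open>Unique factorization makes distinct integers distinct monomials, so the absolute sum can
  be treated one variable at a time. For fixed \<sigma> the estimate also yields continuity of the
  coefficients and of the values on the half-line.\<close>

lemma sum_norm_dirichlet_coeff_le:
  assumes a: "a \<in> dirichlet_polys" and \<sigma>: "\<sigma> > 0" and A: "finite A"
  shows "(\<Sum>n\<in>A. cmod (a n) * real n powr - (1/2 + \<sigma>)) \<le> abs_sum_const \<sigma> * poly_norm 1 a"
proof -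
  let ?J = "prime_support a" and ?S = "{n. a n \<noteq> 0}"
  let ?e = "\<lambda>n j. multiplicity (nth_prime j) n"
  have J: "finite ?J" by (rule finite_prime_support[OF a])
  have S: "finite ?S" using dirichlet_polys_D[OF a] by simp
  have inj: "m = n" if mn: "m \<in> ?S" "n \<in> ?S" and eq: "\<And>j. j \<in> ?J \<Longrightarrow> ?e m j = ?e n j" for m n
  proof -
    have "(\<Prod>j\<in>?J. nth_prime j ^ ?e k j) = k" if "k \<in> ?S" for k
      using that dirichlet_polys_D[OF a] J
      by (intro prod_nth_prime_power_multiplicity) (auto simp: prime_support_def)
    note P = this
    have "m = (\<Prod>j\<in>?J. nth_prime j ^ ?e m j)" by (rule P[OF mn(1), symmetric])
    also have "\<dots> = (\<Prod>j\<in>?J. nth_prime j ^ ?e n j)"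
      by (rule prod.cong[OF refl]) (simp only: eq)
    also have "\<dots> = n" by (rule P[OF mn(2)])
    finally show ?thesis .
  qed
  have bl: "bohr_lift a z = (\<Sum>n\<in>?S. a n * (\<Prod>j\<in>?J. z j ^ ?e n j))" for z
    unfolding bohr_lift_def by (intro sum.cong refl) (simp add: mult_fun_prime_support[OF a])
  have "ennreal (\<Sum>n\<in>?S. cmod (a n) * (\<Prod>j\<in>?J. halfline_point \<sigma> j ^ ?e n j)) \<le>
      ennreal (\<Prod>j\<in>?J. 1 + (halfline_point \<sigma> j)\<^sup>2 + 15 * halfline_point \<sigma> j ^ 3) * ennreal (poly_norm 1 a)"
    unfolding nn_integral_bohr_lift[symmetric] bl
  proof (rule sum_norm_multivariate_coeff_le[OF J S])
    show "m = n" if "m \<in> ?S" "n \<in> ?S" "\<And>j. j \<in> ?J \<Longrightarrow> ?e m j = ?e n j" for m n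
      using that by (rule inj)
  qed (use \<sigma> halfline_point_bounds[of \<sigma>] in auto)
  also have "\<dots> \<le> ennreal (abs_sum_const \<sigma>) * ennreal (poly_norm 1 a)"
  proof (intro mult_right_mono ennreal_leI)
    have "(\<Prod>j\<in>?J. 1 + (halfline_point \<sigma> j)\<^sup>2 + 15 * halfline_point \<sigma> j ^ 3) \<le>
        (\<Prod>j\<in>?J. exp (real (nth_prime j) powr - (1 + (\<sigma> + \<sigma>)) + 15 * real (nth_prime j) powr - (1 + 1/2)))"
    proof (intro prod_mono conjI)
      fix j
      have b: "0 \<le> halfline_point \<sigma> j" "halfline_point \<sigma> j ^ 3 \<le> real (nth_prime j) powr - (1 + 1/2)"
        using \<sigma> halfline_point_bounds[of \<sigma> j] by auto
      show "0 \<le> 1 + (halfline_point \<sigma> j)\<^sup>2 + 15 * halfline_point \<sigma> j ^ 3" using b by simp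
      have "1 + (halfline_point \<sigma> j)\<^sup>2 + 15 * halfline_point \<sigma> j ^ 3 \<le>
          1 + (real (nth_prime j) powr - (1 + (\<sigma> + \<sigma>)) + 15 * real (nth_prime j) powr - (1 + 1/2))"
        unfolding power2_eq_square halfline_point_mult using b by linarith
      also have "\<dots> \<le> exp (real (nth_prime j) powr - (1 + (\<sigma> + \<sigma>)) + 15 * real (nth_prime j) powr - (1 + 1/2))"
        by (rule exp_ge_add_one_self)
      finally show "1 + (halfline_point \<sigma> j)\<^sup>2 + 15 * halfline_point \<sigma> j ^ 3 \<le> \<dots>" .
    qed
    also have "\<dots> = exp ((\<Sum>j\<in>?J. real (nth_prime j) powr - (1 + (\<sigma> + \<sigma>))) +
        15 * (\<Sum>j\<in>?J. real (nth_prime j) powr - (1 + 1/2)))"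
      by (simp only: exp_sum[OF J, symmetric] sum.distrib sum_distrib_left)
    also have "\<dots> \<le> exp ((ln (1 + 1 / (\<sigma> + \<sigma>)) + 2) + 15 * (1 + 1 / (1/2)))"
      using \<sigma> J unfolding exp_le_cancel_iff
      by (intro add_mono mult_left_mono sum_nth_prime_powr_le) auto
    also have "\<dots> = exp (47 + ln (1 + 1 / (\<sigma> + \<sigma>)))" by simp
    also have "\<dots> = abs_sum_const \<sigma>"
      using \<sigma> by (simp add: exp_add abs_sum_const_def add_pos_pos)
    finally show "(\<Prod>j\<in>?J. 1 + (halfline_point \<sigma> j)\<^sup>2 + 15 * halfline_point \<sigma> j ^ 3) \<le> abs_sum_const \<sigma>" .
  qed simp
  finally have "ennreal (\<Sum>n\<in>?S. cmod (a n) * (\<Prod>j\<in>?J. halfline_point \<sigma> j ^ ?e n j)) \<le>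
      ennreal (abs_sum_const \<sigma> * poly_norm 1 a)"
    using \<sigma> by (simp add: ennreal_mult abs_sum_const_nonneg poly_norm_nonneg)
  then have "(\<Sum>n\<in>?S. cmod (a n) * (\<Prod>j\<in>?J. halfline_point \<sigma> j ^ ?e n j)) \<le> abs_sum_const \<sigma> * poly_norm 1 a"
    using \<sigma> by (simp add: ennreal_le_iff abs_sum_const_nonneg poly_norm_nonneg)
  also have "(\<Sum>n\<in>?S. cmod (a n) * (\<Prod>j\<in>?J. halfline_point \<sigma> j ^ ?e n j)) =
      (\<Sum>n\<in>?S. cmod (a n) * real n powr - (1/2 + \<sigma>))"
    by (intro sum.cong refl arg_cong2[where f = "(*)"]) (rule prod_halfline_point[OF a], simp)
  finally have "(\<Sum>n\<in>?S. cmod (a n) * real n powr - (1/2 + \<sigma>)) \<le> abs_sum_const \<sigma> * poly_norm 1 a" .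
  moreover have "(\<Sum>n\<in>A. cmod (a n) * real n powr - (1/2 + \<sigma>)) =
      (\<Sum>n\<in>A \<inter> ?S. cmod (a n) * real n powr - (1/2 + \<sigma>))"
    using A by (intro sum.mono_neutral_right) auto
  moreover have "\<dots> \<le> (\<Sum>n\<in>?S. cmod (a n) * real n powr - (1/2 + \<sigma>))"
    using S by (intro sum_mono2) auto
  ultimately show ?thesis by linarith
qed

lemma norm_coeff_1_le:
  assumes a: "a \<in> dirichlet_polys"
  shows "cmod (a 1) \<le> abs_sum_const 1 * poly_norm 1 a"
  using sum_norm_dirichlet_coeff_le[OF a, of 1 "{1}"] by simp

section \<open>Sharp cut-offs\<close>

text \<open>The argument counts terms, so the frequencies run from 2 to m + 1, as in the partial
  sums of the series in the theorem.\<close>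

definition half_log_sum :: "(nat \<Rightarrow> complex) \<Rightarrow> nat \<Rightarrow> complex" where
  "half_log_sum a m = (\<Sum>n<m. a (n + 2) / of_real (sqrt (real (n + 2)) * ln (real (n + 2))))"

text \<open>The truncation becomes a 0/1 weight on a set independent of m, so that it can be
  compared with a smooth weight frequency by frequency.\<close>

lemma half_log_sum_eq:
  assumes S: "finite S" "{n. a n \<noteq> 0} - {0, 1} \<subseteq> S" "S \<inter> {0, 1} = {}"
  shows "half_log_sum a m =
    (\<Sum>n\<in>S. a n * of_real (real n powr (-1/2) * ((if n < m + 2 then 1 else 0) / ln (real n))))"
proof -
  have "half_log_sum a m = (\<Sum>n\<in>(\<lambda>n. n + 2) ` {..<m}. a n / of_real (sqrt (real n) * ln (real n)))"
    unfolding half_log_sum_def by (subst sum.reindex) (auto simp: inj_on_def)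
  also have "(\<lambda>n. n + 2) ` {..<m} = {2..<m + 2}"
    by (simp only: lessThan_atLeast0 image_add_atLeastLessThan' add_0)
  also have "(\<Sum>n\<in>{2..<m + 2}. a n / of_real (sqrt (real n) * ln (real n))) =
      (\<Sum>n\<in>S \<inter> {2..<m + 2}. a n / of_real (sqrt (real n) * ln (real n)))"
    using S(2) by (intro sum.mono_neutral_right) auto
  also have "\<dots> = (\<Sum>n\<in>S. if n < m + 2 then a n / of_real (sqrt (real n) * ln (real n)) else 0)"
  proof -
    have "S \<inter> {2..<m + 2} = {n \<in> S. n < m + 2}"
    proof -
      have "2 \<le> n" if "n \<in> S" for n
        using S(3) that by (cases "n = 0"; cases "n = 1") auto
      then show ?thesis by auto
    qed
    then show ?thesis by (simp only: sum.inter_filter[OF S(1)])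
  qed
  also have "\<dots> = (\<Sum>n\<in>S. a n * of_real (real n powr (-1/2) * ((if n < m + 2 then 1 else 0) / ln (real n))))"
  proof (intro sum.cong refl)
    fix n
    have "real n powr (-1/2) = 1 / sqrt (real n)"
      using powr_minus_divide[of "real n" "1/2"] by (simp add: powr_half_sqrt)
    then show "(if n < m + 2 then a n / of_real (sqrt (real n) * ln (real n)) else 0) =
        a n * of_real (real n powr (-1/2) * ((if n < m + 2 then 1 else 0) / ln (real n)))"
      by simp
  qed
  finally show ?thesis .
qed

text \<open>The weight \<open>1 / ln n\<close> is the integral of \<open>n powr - \<sigma>\<close>, and cutting that integral off
  at \<open>1 / ln N\<close> costs no more than the absolutely convergent sum at \<open>1/2 + 1 / ln N\<close>.\<close>

lemma cutoff_weight_le: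
  fixes x L :: real
  assumes x: "x \<ge> ln 2" and L: "L \<ge> 1" and i: "i = (if x \<le> L then 1 else 0)"
  shows "\<bar>i / x - (exp (- x / L) - exp (- x)) / x\<bar> \<le> 3 / L * exp (- x / L) + 2 * exp (- x)"
proof -
  have "ln (1 / 2 :: real) \<le> 1 / 2 - 1" by (rule ln_le_minus_one) simp
  then have "ln (2 :: real) \<ge> 1 / 2" by (simp add: ln_div)
  then have x2: "x \<ge> 1 / 2" using x by linarith
  have A: "\<bar>i - exp (- x / L)\<bar> \<le> x * (3 / L * exp (- x / L))"
  proof (cases "x \<le> L")
    case True
    \<comment> \<open>The factor 3 comes from exp 1 \<le> 3: below the cut-off, exp (- x / L) is at
      least 1/3.\<close>
    have "exp (- x / L) \<ge> exp (- 1)" using True L by simp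
    then have "3 * exp (- x / L) \<ge> 3 * exp (- 1)" by simp
    moreover have "3 * exp (- 1 :: real) \<ge> 1"
      using exp_le by (simp add: exp_minus divide_simps)
    ultimately have e: "1 \<le> 3 * exp (- x / L)" by linarith
    have "1 - exp (- x / L) \<le> x / L" using exp_ge_add_one_self[of "- x / L"] by simp
    also have "\<dots> \<le> x / L * (3 * exp (- x / L))"
      using e x2 L mult_left_mono[of 1 "3 * exp (- x / L)" "x / L"] by simp
    finally have "1 - exp (- x / L) \<le> x * (3 / L * exp (- x / L))" by simp
    moreover have "exp (- x / L) \<le> 1" using x2 L by simp
    ultimately show ?thesis using True i by simp
  next
    case False
    then have "1 \<le> x * (3 / L)" using L by (simp add: field_simps)
    then have "1 * exp (- x / L) \<le> x * (3 / L) * exp (- x / L)" by (intro mult_right_mono) auto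
    then show ?thesis using False i by (simp add: mult.assoc)
  qed
  have "i / x - (exp (- x / L) - exp (- x)) / x = (i - exp (- x / L)) / x + exp (- x) / x"
    by (simp add: diff_divide_distrib add_divide_distrib)
  then have "\<bar>i / x - (exp (- x / L) - exp (- x)) / x\<bar> \<le> \<bar>i - exp (- x / L)\<bar> / x + exp (- x) / x"
    using x2 abs_triangle_ineq[of "(i - exp (- x / L)) / x" "exp (- x) / x"] by simp
  also have "\<bar>i - exp (- x / L)\<bar> / x \<le> 3 / L * exp (- x / L)"
    using A x2 by (simp add: divide_le_eq mult.commute)
  also have "exp (- x) / x \<le> 2 * exp (- x)"
    using x2 by (simp add: divide_le_eq)
  finally show ?thesis by simp
qed

lemma has_integral_powr_exponent:
  fixes c d x :: real
  assumes "x > 0" "x \<noteq> 1" "c \<le> d"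
  shows "((\<lambda>\<sigma>. x powr - \<sigma>) has_integral ((x powr - c - x powr - d) / ln x)) {c..d}"
proof -
  have "((\<lambda>\<sigma>. x powr - \<sigma>) has_integral (- (x powr - d / ln x) - - (x powr - c / ln x))) {c..d}"
  proof (rule fundamental_theorem_of_calculus)
    fix \<sigma>
    have "((\<lambda>\<sigma>. - (exp (- \<sigma> * ln x) / ln x)) has_real_derivative exp (- \<sigma> * ln x)) (at \<sigma> within {c..d})"
      using assms by (auto intro!: derivative_eq_intros)
    then show "((\<lambda>\<sigma>. - (x powr - \<sigma> / ln x)) has_vector_derivative x powr - \<sigma>) (at \<sigma> within {c..d})"
      using assms by (simp add: powr_def has_real_derivative_iff_has_vector_derivative)
  qed (use assms in simp)
  then show ?thesis by (simp add: diff_divide_distrib)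
qed

text \<open>The partial sum is the integral of f(1/2 + \<sigma>) - a 1 over [\<delta>, 1] plus an
  error with weights v - w. \<open>C\<close> bounds the integral of |f|,
  \<open>abs_sum_const 1\<close> enters once for \<open>a 1\<close> and twice for the error term 2 /
  n, and 6 exp 47 comes from the error term at \<delta>.\<close>

lemma norm_half_log_sum_le:
  assumes a: "a \<in> dirichlet_polys" and m: "m \<ge> 2" and C: "C \<ge> 0"
    and emb: "(\<integral>\<^sup>+\<sigma>. ennreal (cmod (dirichlet_value a \<sigma>)) * indicator {0<..<1} \<sigma> \<partial>lborel) \<le>
      ennreal (C * poly_norm 1 a)"
  shows "cmod (half_log_sum a m) \<le> (C + 3 * abs_sum_const 1 + 6 * exp 47) * poly_norm 1 a"
proof -
  \<comment> \<open>The largest frequency in the partial sum; \<open>m \<ge> 2\<close> makes it at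
    least 3, hence ln N \<ge> 1 and \<delta> \<le> 1.\<close>
  define N where "N = m + 1"
  define L where "L = ln (real N)"
  define \<delta> where "\<delta> = 1 / L"
  \<comment> \<open>Frequency 1 is set aside: it has no weight 1 / ln n, and \<open>a 1\<close> is
    estimated separately.\<close>
  define S where "S = {n. a n \<noteq> 0} - {1}"
  have S: "finite S" "\<And>n. n \<in> S \<Longrightarrow> n \<ge> 2"
    using dirichlet_polys_D[OF a] by (auto simp: S_def Suc_le_eq numeral_2_eq_2) (metis One_nat_def Suc_lessI)
  have L: "L \<ge> 1"
  proof -
    have "exp 1 \<le> real N" using exp_le m by (simp add: N_def)
    then show ?thesis using m by (simp add: L_def N_def ln_ge_iff)
  qed
  have \<delta>: "0 < \<delta>" "\<delta> \<le> 1" using L by (auto simp: \<delta>_def)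
  \<comment> \<open>Here \<open>w n\<close> is the integral of n powr - \<sigma> over [\<delta>, 1],
    and \<open>v n\<close> below is the sharp weight of the partial sum.\<close>
  define w where "w n = (real n powr - \<delta> - real n powr - 1) / ln (real n)" for n
  define v where "v n = (if n < m + 2 then 1 else 0) / ln (real n)" for n
  have vw: "\<bar>v n - w n\<bar> \<le> 3 * \<delta> * real n powr - \<delta> + 2 * real n powr - 1" if n: "n \<in> S" for n
  proof -
    have n2: "n \<ge> 2" using S n by simp
    have p: "real n powr - \<delta> = exp (- ln (real n) / L)" "real n powr - 1 = exp (- ln (real n))"
      using n2 by (simp_all add: powr_def \<delta>_def)
    have d: "3 * \<delta> = 3 / L" by (simp add: \<delta>_def)
    have "n < m + 2 \<longleftrightarrow> ln (real n) \<le> L"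
      using n2 by (auto simp: L_def N_def)
    then show ?thesis
      unfolding v_def w_def p d using n2 L by (intro cutoff_weight_le) auto
  qed
  have int: "((\<lambda>\<sigma>. dirichlet_value a \<sigma> - a 1) has_integral (\<Sum>n\<in>S. a n * of_real (real n powr (-1/2) * w n))) {\<delta>..1}"
  proof -
    have eq: "dirichlet_value a \<sigma> - a 1 = (\<Sum>n\<in>S. a n * of_real (real n powr (-1/2) * real n powr - \<sigma>))" for \<sigma>
    proof -
      have "dirichlet_value a \<sigma> = (\<Sum>n\<in>insert 1 S. a n * of_real (real n powr - (1/2 + \<sigma>)))"
        unfolding dirichlet_value_def using S(1)
        by (intro sum.mono_neutral_left) (auto simp: S_def)
      also have "\<dots> = a 1 + (\<Sum>n\<in>S. a n * of_real (real n powr - (1/2 + \<sigma>)))"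
        using S(1) by (subst sum.insert) (auto simp: S_def)
      also have "(\<Sum>n\<in>S. a n * of_real (real n powr - (1/2 + \<sigma>))) =
          (\<Sum>n\<in>S. a n * of_real (real n powr (-1/2) * real n powr - \<sigma>))"
        by (simp flip: powr_add)
      finally show ?thesis by simp
    qed
    show ?thesis
      unfolding eq w_def
    proof (rule has_integral_sum[OF S(1)])
      fix n assume n: "n \<in> S"
      have "((\<lambda>\<sigma>. real n powr - \<sigma>) has_integral (real n powr - \<delta> - real n powr - 1) / ln (real n)) {\<delta>..1}"
        using S(2)[OF n] \<delta> by (intro has_integral_powr_exponent) auto
      from has_integral_mult_right[OF has_integral_of_real[OF has_integral_mult_right[OF this, of "real n powr (-1/2)"], where 'b=complex], of "a n"]
      show "((\<lambda>\<sigma>. a n * of_real (real n powr (-1/2) * real n powr - \<sigma>)) has_integral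
          a n * of_real (real n powr (-1/2) * ((real n powr - \<delta> - real n powr - 1) / ln (real n)))) {\<delta>..1}" .
    qed
  qed
  have cont: "continuous_on UNIV (dirichlet_value a)"
    unfolding dirichlet_value_def using dirichlet_polys_D[OF a]
    by (intro continuous_intros) auto
  have main: "cmod (\<Sum>n\<in>S. a n * of_real (real n powr (-1/2) * w n)) \<le> C * poly_norm 1 a + cmod (a 1)"
  proof -
    have i: "(\<lambda>\<sigma>. cmod (dirichlet_value a \<sigma>)) integrable_on {\<delta>..1}"
      by (intro integrable_continuous_interval continuous_intros continuous_on_subset[OF cont]) auto
    have ci: "(\<lambda>\<sigma>. cmod (a 1)) integrable_on {\<delta>..1}" by (rule integrable_const_ivl)
    have "cmod (\<Sum>n\<in>S. a n * of_real (real n powr (-1/2) * w n)) =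
        cmod (integral {\<delta>..1} (\<lambda>\<sigma>. dirichlet_value a \<sigma> - a 1))"
      using int by (simp add: integral_unique)
    also have "\<dots> \<le> integral {\<delta>..1} (\<lambda>\<sigma>. cmod (dirichlet_value a \<sigma>) + cmod (a 1))"
      using int i by (intro integral_norm_bound_integral integrable_add ci norm_triangle_ineq4) auto
    also have "\<dots> = integral {\<delta>..1} (\<lambda>\<sigma>. cmod (dirichlet_value a \<sigma>)) + (1 - \<delta>) * cmod (a 1)"
      using \<delta> by (subst Henstock_Kurzweil_Integration.integral_add[OF i ci]) simp
    also have "(1 - \<delta>) * cmod (a 1) \<le> 1 * cmod (a 1)" using \<delta> by (intro mult_right_mono) auto
    also have "integral {\<delta>..1} (\<lambda>\<sigma>. cmod (dirichlet_value a \<sigma>)) \<le> C * poly_norm 1 a"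
    proof -
      have "ennreal (integral {\<delta>..1} (\<lambda>\<sigma>. cmod (dirichlet_value a \<sigma>))) =
          (\<integral>\<^sup>+\<sigma>. ennreal (cmod (dirichlet_value a \<sigma>)) * indicator {\<delta>..1} \<sigma> \<partial>lborel)"
        using i by (intro nn_integral_has_integral_lebesgue'[symmetric]) (simp_all add: integrable_integral)
      also have "\<dots> \<le> (\<integral>\<^sup>+\<sigma>. ennreal (cmod (dirichlet_value a \<sigma>)) * indicator {0<..<1} \<sigma> \<partial>lborel)"
      proof (rule nn_integral_mono_AE)
        have "AE \<sigma> in lborel. \<sigma> \<noteq> (1::real)" by (rule AE_lborel_singleton)
        then show "AE \<sigma> in lborel. ennreal (cmod (dirichlet_value a \<sigma>)) * indicator {\<delta>..1} \<sigma> \<le>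
            ennreal (cmod (dirichlet_value a \<sigma>)) * indicator {0<..<1} \<sigma>"
          by eventually_elim (use \<delta> in \<open>auto split: split_indicator\<close>)
      qed
      also note emb
      finally show ?thesis using C by (simp add: ennreal_le_iff poly_norm_nonneg)
    qed
    finally show ?thesis by simp
  qed
  have rest: "cmod (\<Sum>n\<in>S. a n * of_real (real n powr (-1/2) * (v n - w n))) \<le>
      (6 * exp 47 + 2 * abs_sum_const 1) * poly_norm 1 a"
  proof -
    have "cmod (\<Sum>n\<in>S. a n * of_real (real n powr (-1/2) * (v n - w n))) \<le>
        (\<Sum>n\<in>S. 3 * \<delta> * (cmod (a n) * real n powr - (1/2 + \<delta>)) + 2 * (cmod (a n) * real n powr - (1/2 + 1)))"
    proof (rule sum_norm_le)
      fix n assume n: "n \<in> S"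
      have "cmod (a n * of_real (real n powr (-1/2) * (v n - w n))) = cmod (a n) * real n powr (-1/2) * \<bar>v n - w n\<bar>"
        by (simp only: norm_mult norm_of_real abs_mult) simp
      also have "\<dots> \<le> cmod (a n) * real n powr (-1/2) * (3 * \<delta> * real n powr - \<delta> + 2 * real n powr - 1)"
        by (intro mult_left_mono vw n) auto
      also have "\<dots> = 3 * \<delta> * (cmod (a n) * (real n powr (-1/2) * real n powr - \<delta>))
          + 2 * (cmod (a n) * (real n powr (-1/2) * real n powr - 1))"
        by (simp add: algebra_simps)
      also have "\<dots> = 3 * \<delta> * (cmod (a n) * real n powr - (1/2 + \<delta>)) + 2 * (cmod (a n) * real n powr - (1/2 + 1))"
        by (simp only: powr_add[symmetric]) simp
      finally show "cmod (a n * of_real (real n powr (-1/2) * (v n - w n))) \<le> \<dots>" .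
    qed
    also have "\<dots> = 3 * \<delta> * (\<Sum>n\<in>S. cmod (a n) * real n powr - (1/2 + \<delta>)) + 2 * (\<Sum>n\<in>S. cmod (a n) * real n powr - (1/2 + 1))"
      by (simp only: sum.distrib sum_distrib_left)
    also have "\<dots> \<le> 3 * \<delta> * (abs_sum_const \<delta> * poly_norm 1 a) + 2 * (abs_sum_const 1 * poly_norm 1 a)"
      using \<delta> by (intro add_mono mult_left_mono sum_norm_dirichlet_coeff_le a S) auto
    also have "\<dots> = (3 * (\<delta> * abs_sum_const \<delta>) + 2 * abs_sum_const 1) * poly_norm 1 a"
      by (simp add: algebra_simps)
    also have "\<dots> \<le> (3 * (2 * exp 47) + 2 * abs_sum_const 1) * poly_norm 1 a"
    proof (intro mult_right_mono add_mono mult_left_mono order_refl)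
      \<comment> \<open>The factor \<delta> of the weight error cancels the pole of
        \<open>abs_sum_const\<close> at 0.\<close>
      have "\<delta> * abs_sum_const \<delta> = exp 47 * (\<delta> + 1 / 2)"
        using \<delta> by (simp add: abs_sum_const_def field_simps)
      also have "\<dots> \<le> exp 47 * 2" using \<delta> by (intro mult_left_mono) auto
      finally show "\<delta> * abs_sum_const \<delta> \<le> 2 * exp 47" by simp
    qed (auto simp: poly_norm_nonneg abs_sum_const_nonneg)
    finally show ?thesis by simp
  qed
  have "half_log_sum a m = (\<Sum>n\<in>S. a n * of_real (real n powr (-1/2) * v n))"
    unfolding v_def
  proof (rule half_log_sum_eq)
    show "S \<inter> {0, 1} = {}" using S(2) by fastforce
  qed (use S(1) in \<open>auto simp: S_def\<close>)
  also have "\<dots> = (\<Sum>n\<in>S. a n * of_real (real n powr (-1/2) * w n)) +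
      (\<Sum>n\<in>S. a n * of_real (real n powr (-1/2) * (v n - w n)))"
    by (simp add: algebra_simps flip: sum.distrib)
  finally have "cmod (half_log_sum a m) \<le> cmod (\<Sum>n\<in>S. a n * of_real (real n powr (-1/2) * w n)) +
      cmod (\<Sum>n\<in>S. a n * of_real (real n powr (-1/2) * (v n - w n)))"
    by (simp only: norm_triangle_ineq)
  also have "\<dots> \<le> C * poly_norm 1 a + abs_sum_const 1 * poly_norm 1 a +
      (6 * exp 47 + 2 * abs_sum_const 1) * poly_norm 1 a"
    using main rest norm_coeff_1_le[OF a] by linarith
  finally show ?thesis by (simp add: algebra_simps)
qed

section \<open>Passage to the completion\<close>

lemma hardy_space_representative:
  assumes "f \<in> hardy_space p"
  obtains P where "P \<in> hardy_cauchy p" "\<And>Q. Q \<in> f \<longleftrightarrow> (P, Q) \<in> hardy_rel p"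
  using assms unfolding hardy_space_def by (elim quotientE) auto

lemma hardy_cauchy_polys: "P \<in> hardy_cauchy p \<Longrightarrow> P k \<in> dirichlet_polys"
  by (simp add: hardy_cauchy_def)

lemma hardy_rel_refl:
  assumes "P \<in> hardy_cauchy 1"
  shows "(P, P) \<in> hardy_rel 1"
  using assms by (simp add: hardy_rel_def poly_norm_def bohr_lift_def)

text \<open>Continuity of the coefficient functionals, from the absolute sum at \<sigma> = 1. The
  growth in n does no harm because limits are taken for each n separately.\<close>

lemma norm_coeff_le:
  assumes a: "a \<in> dirichlet_polys"
  shows "cmod (a n) \<le> abs_sum_const 1 * real n powr (3/2) * poly_norm 1 a"
proof (cases "n = 0")
  case True
  then show ?thesis using a by (simp add: dirichlet_polys_def)
next
  case False
  have "cmod (a n) * real n powr - (1/2 + 1) \<le> abs_sum_const 1 * poly_norm 1 a"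
    using sum_norm_dirichlet_coeff_le[OF a, of 1 "{n}"] by simp
  then have "cmod (a n) * real n powr - (1/2 + 1) * real n powr (3/2) \<le>
      abs_sum_const 1 * poly_norm 1 a * real n powr (3/2)"
    by (intro mult_right_mono) auto
  then show ?thesis
    using False by (simp add: mult_ac flip: powr_add)
qed

lemma hardy_cauchy_coeff_convergent:
  assumes P: "P \<in> hardy_cauchy 1"
  shows "convergent (\<lambda>k. P k n)"
proof (rule Cauchy_convergent, rule metric_CauchyI)
  fix e :: real assume e: "e > 0"
  define K where "K = abs_sum_const 1 * real n powr (3/2) + 1"
  have K: "K > 0" by (simp add: K_def abs_sum_const_nonneg add_nonneg_pos)
  obtain M where M: "\<And>k l. k \<ge> M \<Longrightarrow> l \<ge> M \<Longrightarrow> poly_norm 1 (\<lambda>n. P k n - P l n) < e / K"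
    using P divide_pos_pos[OF e K] unfolding hardy_cauchy_def by blast
  have "dist (P k n) (P l n) < e" if "k \<ge> M" "l \<ge> M" for k l
  proof -
    let ?d = "\<lambda>n. P k n - P l n"
    have "cmod (P k n - P l n) \<le> abs_sum_const 1 * real n powr (3/2) * poly_norm 1 ?d"
      using norm_coeff_le[OF dirichlet_polys_diff[OF hardy_cauchy_polys[OF P, of k] hardy_cauchy_polys[OF P, of l]]]
      by simp
    also have "\<dots> \<le> K * poly_norm 1 ?d"
      by (intro mult_right_mono poly_norm_nonneg) (simp add: K_def)
    also have "\<dots> < K * (e / K)"
      using M[OF that] K by (intro mult_strict_left_mono)
    also have "\<dots> = e" using K by simp
    finally show ?thesis by (simp add: dist_norm)
  qed
  then show "\<exists>M. \<forall>k\<ge>M. \<forall>l\<ge>M. dist (P k n) (P l n) < e" by blast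
qed

lemma hardy_rel_coeff_tendsto:
  assumes "(P, Q) \<in> hardy_rel 1" "(\<lambda>k. P k n) \<longlonglongrightarrow> c"
  shows "(\<lambda>k. Q k n) \<longlonglongrightarrow> c"
proof -
  have PQ: "P \<in> hardy_cauchy 1" "Q \<in> hardy_cauchy 1" "(\<lambda>k. poly_norm 1 (\<lambda>n. P k n - Q k n)) \<longlonglongrightarrow> 0"
    using assms(1) by (auto simp: hardy_rel_def)
  have "(\<lambda>k. abs_sum_const 1 * real n powr (3/2) * poly_norm 1 (\<lambda>n. P k n - Q k n)) \<longlonglongrightarrow> 0"
    using PQ(3) by (rule tendsto_mult_right_zero)
  then have "(\<lambda>k. P k n - Q k n) \<longlonglongrightarrow> 0"
  proof (rule Lim_null_comparison[rotated])
    show "\<forall>\<^sub>F k in sequentially. cmod (P k n - Q k n) \<le>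
        abs_sum_const 1 * real n powr (3/2) * poly_norm 1 (\<lambda>n. P k n - Q k n)"
      using norm_coeff_le[OF dirichlet_polys_diff[OF hardy_cauchy_polys[OF PQ(1)] hardy_cauchy_polys[OF PQ(2)]]]
      by (intro always_eventually) simp
  qed
  from tendsto_diff[OF assms(2) this] show ?thesis by simp
qed

lemma hardy_cauchy_norm_convergent:
  assumes P: "P \<in> hardy_cauchy 1"
  shows "convergent (\<lambda>k. poly_norm 1 (P k))"
proof (rule Cauchy_convergent, rule metric_CauchyI)
  fix e :: real assume e: "e > 0"
  obtain M where M: "\<And>k l. k \<ge> M \<Longrightarrow> l \<ge> M \<Longrightarrow> poly_norm 1 (\<lambda>n. P k n - P l n) < e"
    using P e unfolding hardy_cauchy_def by blast
  have "dist (poly_norm 1 (P k)) (poly_norm 1 (P l)) < e" if "k \<ge> M" "l \<ge> M" for k l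
    using poly_norm_diff_bound[OF hardy_cauchy_polys[OF P, of k] hardy_cauchy_polys[OF P, of l]] M[OF that]
    by (simp add: dist_real_def)
  then show "\<exists>M. \<forall>k\<ge>M. \<forall>l\<ge>M. dist (poly_norm 1 (P k)) (poly_norm 1 (P l)) < e" by blast
qed

lemma hardy_rel_norm_tendsto:
  assumes "(P, Q) \<in> hardy_rel 1" "(\<lambda>k. poly_norm 1 (P k)) \<longlonglongrightarrow> r"
  shows "(\<lambda>k. poly_norm 1 (Q k)) \<longlonglongrightarrow> r"
proof -
  have PQ: "P \<in> hardy_cauchy 1" "Q \<in> hardy_cauchy 1" "(\<lambda>k. poly_norm 1 (\<lambda>n. P k n - Q k n)) \<longlonglongrightarrow> 0"
    using assms(1) by (auto simp: hardy_rel_def)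
  have "(\<lambda>k. poly_norm 1 (P k) - poly_norm 1 (Q k)) \<longlonglongrightarrow> 0"
    using PQ(3)
  proof (rule Lim_null_comparison[rotated])
    show "\<forall>\<^sub>F k in sequentially. norm (poly_norm 1 (P k) - poly_norm 1 (Q k)) \<le> poly_norm 1 (\<lambda>n. P k n - Q k n)"
      using poly_norm_diff_bound[OF hardy_cauchy_polys[OF PQ(1)] hardy_cauchy_polys[OF PQ(2)]]
      by (intro always_eventually) simp
  qed
  from tendsto_diff[OF assms(2) this] show ?thesis by simp
qed

text \<open>The definite descriptions behind \<open>hardy_coeff\<close> and
  \<open>hardy_norm\<close> are resolved here: the limits exist along one representative and agree
  along all equivalent ones. Afterwards a single sequence of polynomials stands for f.\<close>

lemma hardy_space_1_limits:
  assumes f: "f \<in> hardy_space 1"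
  obtains P where "P \<in> hardy_cauchy 1" "\<And>n. (\<lambda>k. P k n) \<longlonglongrightarrow> hardy_coeff f n"
    "(\<lambda>k. poly_norm 1 (P k)) \<longlonglongrightarrow> hardy_norm 1 f"
proof -
  obtain P where P: "P \<in> hardy_cauchy 1" and mem: "\<And>Q. Q \<in> f \<longleftrightarrow> (P, Q) \<in> hardy_rel 1"
    using hardy_space_representative[OF f] by blast
  have Pf: "P \<in> f" using mem hardy_rel_refl[OF P] by simp
  have "(\<lambda>k. P k n) \<longlonglongrightarrow> hardy_coeff f n" for n
  proof -
    obtain c where c: "(\<lambda>k. P k n) \<longlonglongrightarrow> c"
      using hardy_cauchy_coeff_convergent[OF P] unfolding convergent_def by blast
    have "hardy_coeff f n = c"
      unfolding hardy_coeff_def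
      using c Pf mem hardy_rel_coeff_tendsto[where P = P and n = n, OF _ c] by (intro the_equality) (auto dest: LIMSEQ_unique)
    with c show ?thesis by simp
  qed
  moreover have "(\<lambda>k. poly_norm 1 (P k)) \<longlonglongrightarrow> hardy_norm 1 f"
  proof -
    obtain r where r: "(\<lambda>k. poly_norm 1 (P k)) \<longlonglongrightarrow> r"
      using hardy_cauchy_norm_convergent[OF P] unfolding convergent_def by blast
    have "hardy_norm 1 f = r"
      unfolding hardy_norm_def
      using r Pf mem hardy_rel_norm_tendsto[OF _ r] by (intro the_equality) (auto dest: LIMSEQ_unique)
    with r show ?thesis by simp
  qed
  ultimately show ?thesis using P that by blast
qed

section \<open>Absolute convergence and values in the half-plane\<close>

text \<open>Finite sets let the estimate pass to the limit term by term. It serves both for a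
  sequence representing f and, with k fixed, for the differences P k - P l as l grows.\<close>

lemma sum_norm_limit_coeff_le:
  assumes a: "\<And>l. a l \<in> dirichlet_polys" and c: "\<And>n. (\<lambda>l. a l n) \<longlonglongrightarrow> c n"
    and e: "\<forall>\<^sub>F l in sequentially. poly_norm 1 (a l) \<le> e" and \<sigma>: "\<sigma> > 0" and A: "finite A"
  shows "(\<Sum>n\<in>A. cmod (c n) * real n powr - (1/2 + \<sigma>)) \<le> abs_sum_const \<sigma> * e"
proof (rule tendsto_upperbound)
  show "(\<lambda>l. \<Sum>n\<in>A. cmod (a l n) * real n powr - (1/2 + \<sigma>)) \<longlonglongrightarrow> (\<Sum>n\<in>A. cmod (c n) * real n powr - (1/2 + \<sigma>))"
    by (intro tendsto_intros c)
  show "\<forall>\<^sub>F l in sequentially. (\<Sum>n\<in>A. cmod (a l n) * real n powr - (1/2 + \<sigma>)) \<le> abs_sum_const \<sigma> * e"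
    using e
  proof eventually_elim
    case (elim l)
    have "(\<Sum>n\<in>A. cmod (a l n) * real n powr - (1/2 + \<sigma>)) \<le> abs_sum_const \<sigma> * poly_norm 1 (a l)"
      by (rule sum_norm_dirichlet_coeff_le[OF a \<sigma> A])
    also have "\<dots> \<le> abs_sum_const \<sigma> * e"
      using elim \<sigma> by (intro mult_left_mono abs_sum_const_nonneg)
    finally show ?case .
  qed
qed simp

lemma summable_norm_limit_coeff:
  assumes a: "\<And>l. a l \<in> dirichlet_polys" and c: "\<And>n. (\<lambda>l. a l n) \<longlonglongrightarrow> c n"
    and e: "\<forall>\<^sub>F l in sequentially. poly_norm 1 (a l) \<le> e" and \<sigma>: "\<sigma> > 0"
  shows "summable (\<lambda>n. cmod (c (Suc n)) * real (Suc n) powr - (1/2 + \<sigma>))" (is "summable ?g")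
    and "(\<Sum>n. cmod (c (Suc n)) * real (Suc n) powr - (1/2 + \<sigma>)) \<le> abs_sum_const \<sigma> * e"
proof -
  have le: "(\<Sum>n<m. ?g n) \<le> abs_sum_const \<sigma> * e" for m
  proof -
    have "(\<Sum>n<m. ?g n) = (\<Sum>n\<in>Suc ` {..<m}. cmod (c n) * real n powr - (1/2 + \<sigma>))"
      by (subst sum.reindex) auto
    also have "\<dots> \<le> abs_sum_const \<sigma> * e"
      by (intro sum_norm_limit_coeff_le[OF a c e \<sigma>]) simp
    finally show ?thesis .
  qed
  show "summable ?g"
    by (rule summableI_nonneg_bounded[OF _ le]) simp
  then show "(\<Sum>n. ?g n) \<le> abs_sum_const \<sigma> * e"
    using le by (rule suminf_le_const)
qed

lemma hardy_term_eq:
  assumes "n > 0"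
  shows "hardy_term f (of_real (1/2 + \<sigma>)) n = hardy_coeff f n * of_real (real n powr - (1/2 + \<sigma>))"
  using assms powr_of_real[of "real n" "- (1/2 + \<sigma>)"] by (simp add: hardy_term_def)

lemma dirichlet_value_sums:
  assumes "a \<in> dirichlet_polys"
  shows "(\<lambda>n. a (Suc n) * of_real (real (Suc n) powr - (1/2 + \<sigma>))) sums dirichlet_value a \<sigma>"
proof -
  have "dirichlet_value a \<sigma> = (\<Sum>n\<in>Suc -` {n. a n \<noteq> 0}. a (Suc n) * of_real (real (Suc n) powr - (1/2 + \<sigma>)))"
  proof -
    have "{n. a n \<noteq> 0} = Suc ` (Suc -` {n. a n \<noteq> 0})"
      using dirichlet_polys_D[OF assms] by (auto simp: image_iff) (metis gr0_implies_Suc)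
    then have "dirichlet_value a \<sigma> = (\<Sum>n\<in>Suc ` (Suc -` {n. a n \<noteq> 0}). a n * of_real (real n powr - (1/2 + \<sigma>)))"
      unfolding dirichlet_value_def by (rule sum.cong) (rule refl)
    also have "\<dots> = (\<Sum>n\<in>Suc -` {n. a n \<noteq> 0}. a (Suc n) * of_real (real (Suc n) powr - (1/2 + \<sigma>)))"
      by (subst sum.reindex) auto
    finally show ?thesis .
  qed
  moreover have "finite (Suc -` {n. a n \<noteq> 0})"
    using dirichlet_polys_D[OF assms] by (intro finite_vimageI) auto
  ultimately show ?thesis
    by (metis (mono_tags, lifting) mem_Collect_eq mult_eq_0_iff sums_finite vimageI2)
qed

text \<open>Letting l tend to infinity in P k - P l bounds the whole series of differences by
  \<open>abs_sum_const \<sigma>\<close> times a small norm. Hence the sum of the Dirichlet series is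
  also the limit of the polynomial values.\<close>

lemma hardy_space_1_summable_and_value_tendsto:
  assumes P: "P \<in> hardy_cauchy 1" and c: "\<And>n. (\<lambda>k. P k n) \<longlonglongrightarrow> hardy_coeff f n"
    and r: "(\<lambda>k. poly_norm 1 (P k)) \<longlonglongrightarrow> hardy_norm 1 f" and \<sigma>: "\<sigma> > 0"
  shows "summable (\<lambda>n. hardy_term f (of_real (1/2 + \<sigma>)) (Suc n))"
    and "(\<lambda>k. dirichlet_value (P k) \<sigma>) \<longlonglongrightarrow> hardy_value f (of_real (1/2 + \<sigma>))"
proof -
  let ?w = "\<lambda>n. real n powr - (1/2 + \<sigma>)"
  let ?c = "hardy_coeff f"
  have eq: "(\<lambda>n. hardy_term f (of_real (1/2 + \<sigma>)) (Suc n)) = (\<lambda>n. ?c (Suc n) * of_real (?w (Suc n)))"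
    by (simp only: hardy_term_eq zero_less_Suc)
  have "\<forall>\<^sub>F l in sequentially. poly_norm 1 (P l) < hardy_norm 1 f + 1"
    using r by (rule order_tendstoD) simp
  then have "\<forall>\<^sub>F l in sequentially. poly_norm 1 (P l) \<le> hardy_norm 1 f + 1"
    by eventually_elim simp
  from summable_norm_limit_coeff(1)[OF hardy_cauchy_polys[OF P] c this \<sigma>]
  have sm: "summable (\<lambda>n. cmod (?c (Suc n) * of_real (?w (Suc n))))"
    by (simp add: norm_mult)
  then show s: "summable (\<lambda>n. hardy_term f (of_real (1/2 + \<sigma>)) (Suc n))"
    unfolding eq by (rule summable_norm_cancel)
  show "(\<lambda>k. dirichlet_value (P k) \<sigma>) \<longlonglongrightarrow> hardy_value f (of_real (1/2 + \<sigma>))"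
  proof (rule metric_LIMSEQ_I)
    fix e :: real assume e: "e > 0"
    define K where "K = abs_sum_const \<sigma> + 1"
    have K: "K > 0" "abs_sum_const \<sigma> < K" using \<sigma> by (auto simp: K_def abs_sum_const_nonneg add_nonneg_pos)
    obtain M where M: "\<And>k l. k \<ge> M \<Longrightarrow> l \<ge> M \<Longrightarrow> poly_norm 1 (\<lambda>n. P k n - P l n) < e / K"
      using P divide_pos_pos[OF e K(1)] unfolding hardy_cauchy_def by blast
    have "dist (dirichlet_value (P k) \<sigma>) (hardy_value f (of_real (1/2 + \<sigma>))) < e" if k: "k \<ge> M" for k
    proof -
      have ev: "\<forall>\<^sub>F l in sequentially. poly_norm 1 (\<lambda>n. P k n - P l n) \<le> e / K"
        using M[OF k] by (auto simp: eventually_sequentially intro!: exI[of _ M] less_imp_le)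
      have lim: "(\<lambda>l. P k n - P l n) \<longlonglongrightarrow> P k n - ?c n" for n
        by (intro tendsto_intros c)
      note S = summable_norm_limit_coeff[OF dirichlet_polys_diff[OF hardy_cauchy_polys[OF P] hardy_cauchy_polys[OF P]] lim ev \<sigma>]
      have "(\<lambda>n. P k (Suc n) * of_real (?w (Suc n)) - ?c (Suc n) * of_real (?w (Suc n))) sums
          (dirichlet_value (P k) \<sigma> - hardy_value f (of_real (1/2 + \<sigma>)))"
        using summable_sums[OF s] unfolding hardy_value_def eq
        by (intro sums_diff dirichlet_value_sums hardy_cauchy_polys[OF P])
      then have "dirichlet_value (P k) \<sigma> - hardy_value f (of_real (1/2 + \<sigma>)) =
          (\<Sum>n. (P k (Suc n) - ?c (Suc n)) * of_real (?w (Suc n)))"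
        by (simp add: sums_iff left_diff_distrib)
      also have "cmod \<dots> \<le> (\<Sum>n. cmod ((P k (Suc n) - ?c (Suc n)) * of_real (?w (Suc n))))"
        using S(1) by (intro summable_norm) (simp add: norm_mult)
      also have "\<dots> \<le> abs_sum_const \<sigma> * (e / K)"
        using S(2) by (simp add: norm_mult)
      also have "\<dots> < K * (e / K)"
        using K e by (intro mult_strict_right_mono) auto
      also have "\<dots> = e" using K by simp
      finally show ?thesis by (simp add: dist_norm)
    qed
    then show "\<exists>M. \<forall>k\<ge>M. dist (dirichlet_value (P k) \<sigma>) (hardy_value f (of_real (1/2 + \<sigma>))) < e" by blast
  qed
qed

lemma dirichlet_value_measurable: "dirichlet_value a \<in> borel_measurable borel"
  unfolding dirichlet_value_def by measurable

text \<open>Fatou's lemma carries the polynomial bound to the limit; pointwise convergence of the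
  values also provides measurability.\<close>

lemma hardy_value_integral_le:
  assumes P: "P \<in> hardy_cauchy 1" and c: "\<And>n. (\<lambda>k. P k n) \<longlonglongrightarrow> hardy_coeff f n"
    and r: "(\<lambda>k. poly_norm 1 (P k)) \<longlonglongrightarrow> hardy_norm 1 f" and C: "C \<ge> 0"
    and emb: "\<And>a. a \<in> dirichlet_polys \<Longrightarrow>
      (\<integral>\<^sup>+\<sigma>. ennreal (cmod (dirichlet_value a \<sigma>)) * indicator {0<..<1} \<sigma> \<partial>lborel) \<le> ennreal (C * poly_norm 1 a)"
  shows "set_integrable lborel {0<..<1::real} (\<lambda>\<sigma>. cmod (hardy_value f (of_real (1/2 + \<sigma>))))"
    and "(LBINT \<sigma>:{0<..<1}. cmod (hardy_value f (of_real (1/2 + \<sigma>)))) \<le> C * hardy_norm 1 f"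
proof -
  let ?V = "\<lambda>\<sigma>::real. indicator {0<..<1} \<sigma> *\<^sub>R cmod (hardy_value f (of_real (1/2 + \<sigma>)))"
  let ?D = "\<lambda>k \<sigma>::real. indicator {0<..<1} \<sigma> *\<^sub>R cmod (dirichlet_value (P k) \<sigma>)"
  note [measurable] = dirichlet_value_measurable
  have lim: "(\<lambda>k. ?D k \<sigma>) \<longlonglongrightarrow> ?V \<sigma>" for \<sigma>
  proof (cases "\<sigma> \<in> {0<..<1}")
    case True
    then have "(\<lambda>k. dirichlet_value (P k) \<sigma>) \<longlonglongrightarrow> hardy_value f (of_real (1/2 + \<sigma>))"
      by (intro hardy_space_1_summable_and_value_tendsto(2)[OF P c r]) simp
    then show ?thesis using True by (auto intro: tendsto_norm)
  qed simp
  have V: "?V \<in> borel_measurable lborel"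
    by (rule borel_measurable_LIMSEQ_real[OF lim]) measurable
  have h0: "hardy_norm 1 f \<ge> 0"
    using r by (rule LIMSEQ_le_const) (auto simp: poly_norm_nonneg)
  have nn: "(\<integral>\<^sup>+\<sigma>. ennreal (?V \<sigma>) \<partial>lborel) \<le> ennreal (C * hardy_norm 1 f)"
  proof -
    have "(\<integral>\<^sup>+\<sigma>. ennreal (?V \<sigma>) \<partial>lborel) = (\<integral>\<^sup>+\<sigma>. liminf (\<lambda>k. ennreal (?D k \<sigma>)) \<partial>lborel)"
      by (intro nn_integral_cong lim_imp_Liminf[symmetric] tendsto_ennrealI lim) simp
    also have "\<dots> \<le> liminf (\<lambda>k. \<integral>\<^sup>+\<sigma>. ennreal (?D k \<sigma>) \<partial>lborel)"
      by (rule nn_integral_liminf) measurable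
    also have "\<dots> \<le> liminf (\<lambda>k. ennreal (C * poly_norm 1 (P k)))"
    proof (intro Liminf_mono always_eventually allI)
      fix k
      have "(\<integral>\<^sup>+\<sigma>. ennreal (?D k \<sigma>) \<partial>lborel) =
          (\<integral>\<^sup>+\<sigma>. ennreal (cmod (dirichlet_value (P k) \<sigma>)) * indicator {0<..<1} \<sigma> \<partial>lborel)"
        by (intro nn_integral_cong) (auto split: split_indicator)
      also have "\<dots> \<le> ennreal (C * poly_norm 1 (P k))"
        by (intro emb hardy_cauchy_polys[OF P])
      finally show "(\<integral>\<^sup>+\<sigma>. ennreal (?D k \<sigma>) \<partial>lborel) \<le> ennreal (C * poly_norm 1 (P k))" .
    qed
    also have "\<dots> = ennreal (C * hardy_norm 1 f)"
      by (intro lim_imp_Liminf tendsto_ennrealI tendsto_mult_left r) simp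
    finally show ?thesis .
  qed
  have int: "integrable lborel ?V"
    by (rule integrableI_nonneg[OF V]) (use nn in \<open>auto intro: le_less_trans\<close>)
  then show "set_integrable lborel {0<..<1::real} (\<lambda>\<sigma>. cmod (hardy_value f (of_real (1/2 + \<sigma>))))"
    by (simp add: set_integrable_def)
  have "ennreal (\<integral>\<sigma>. ?V \<sigma> \<partial>lborel) = (\<integral>\<^sup>+\<sigma>. ennreal (?V \<sigma>) \<partial>lborel)"
    by (intro nn_integral_eq_integral[symmetric] int) auto
  also note nn
  finally have "(\<integral>\<sigma>. ?V \<sigma> \<partial>lborel) \<le> C * hardy_norm 1 f"
    using C h0 by (simp add: ennreal_le_iff)
  then show "(LBINT \<sigma>:{0<..<1}. cmod (hardy_value f (of_real (1/2 + \<sigma>)))) \<le> C * hardy_norm 1 f"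
    by (simp add: set_lebesgue_integral_def)
qed

section \<open>Convergence of the logarithmically weighted series\<close>

lemma half_log_sum_diff:
  "half_log_sum (\<lambda>n. a n - b n) m = half_log_sum a m - half_log_sum b m"
  by (simp add: half_log_sum_def diff_divide_distrib sum_subtractf)

lemma half_log_sum_tendsto:
  "(\<And>n. (\<lambda>l. a l n) \<longlonglongrightarrow> c n) \<Longrightarrow> (\<lambda>l. half_log_sum (a l) m) \<longlonglongrightarrow> half_log_sum c m"
  unfolding half_log_sum_def divide_inverse by (intro tendsto_intros)

lemma half_log_sum_eventually_const:
  assumes "a \<in> dirichlet_polys"
  obtains N where "\<And>m m'. m \<ge> N \<Longrightarrow> m' \<ge> N \<Longrightarrow> half_log_sum a m = half_log_sum a m'"
proof -
  obtain N where N: "{n. a n \<noteq> 0} \<subseteq> {..<N}"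
    using dirichlet_polys_D(1)[OF assms] finite_nat_iff_bounded by blast
  have "half_log_sum a m = half_log_sum a N" if "m \<ge> N" for m
    unfolding half_log_sum_def
    by (rule sum.mono_neutral_right) (use that N in auto)
  then show ?thesis using that[of N] by metis
qed

text \<open>No absolute convergence is used. The partial sums are functionals bounded uniformly in m
  and, on each polynomial, eventually constant in m; hence they form a Cauchy sequence at every
  limit of polynomials.\<close>

lemma half_log_series:
  assumes P: "P \<in> hardy_cauchy 1" and c: "\<And>n. (\<lambda>k. P k n) \<longlonglongrightarrow> hardy_coeff f n"
    and r: "(\<lambda>k. poly_norm 1 (P k)) \<longlonglongrightarrow> hardy_norm 1 f" and C: "C > 0"
    and T: "\<And>a m. a \<in> dirichlet_polys \<Longrightarrow> m \<ge> 2 \<Longrightarrow> cmod (half_log_sum a m) \<le> C * poly_norm 1 a"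
  shows "summable (\<lambda>n. hardy_coeff f (n + 2) / of_real (sqrt (real (n + 2)) * ln (real (n + 2))))"
    (is "summable ?g")
    and "cmod (hardy_coeff f 1 +
       (\<Sum>n. hardy_coeff f (n + 2) / of_real (sqrt (real (n + 2)) * ln (real (n + 2)))))
      \<le> (abs_sum_const 1 + C) * hardy_norm 1 f"
proof -
  let ?c = "hardy_coeff f"
  have part: "(\<Sum>n<m. ?g n) = half_log_sum ?c m" for m
    by (simp add: half_log_sum_def)
  have "Cauchy (half_log_sum ?c)"
  proof (rule metric_CauchyI)
    fix e :: real assume e: "e > 0"
    obtain M where M: "\<And>k l. k \<ge> M \<Longrightarrow> l \<ge> M \<Longrightarrow> poly_norm 1 (\<lambda>n. P k n - P l n) < e / (3 * C)"
      using P divide_pos_pos[of e "3 * C"] e C unfolding hardy_cauchy_def by force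
    \<comment> \<open>The bound \<open>T\<close> is uniform in m, so the single polynomial
      \<open>P M\<close> serves all partial sums at once.\<close>
    have near: "cmod (half_log_sum (P M) m - half_log_sum ?c m) \<le> e / 3" if m: "m \<ge> 2" for m
    proof (rule tendsto_upperbound)
      show "(\<lambda>l. cmod (half_log_sum (P M) m - half_log_sum (P l) m)) \<longlonglongrightarrow>
          cmod (half_log_sum (P M) m - half_log_sum ?c m)"
        by (intro tendsto_intros half_log_sum_tendsto c)
      show "\<forall>\<^sub>F l in sequentially. cmod (half_log_sum (P M) m - half_log_sum (P l) m) \<le> e / 3"
        using eventually_ge_at_top[of M]
      proof eventually_elim
        case (elim l)
        have "cmod (half_log_sum (\<lambda>n. P M n - P l n) m) \<le> C * poly_norm 1 (\<lambda>n. P M n - P l n)"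
          by (intro T m dirichlet_polys_diff hardy_cauchy_polys[OF P])
        also have "\<dots> \<le> C * (e / (3 * C))"
          using M[of M l] elim C by (intro mult_left_mono) auto
        also have "\<dots> = e / 3" using C by simp
        finally show ?case by (simp add: half_log_sum_diff)
      qed
    qed simp
    obtain N where N: "\<And>m m'. m \<ge> N \<Longrightarrow> m' \<ge> N \<Longrightarrow> half_log_sum (P M) m = half_log_sum (P M) m'"
      using half_log_sum_eventually_const[OF hardy_cauchy_polys[OF P, of M]] by blast
    have "dist (half_log_sum ?c m) (half_log_sum ?c m') < e" if "m \<ge> max 2 N" "m' \<ge> max 2 N" for m m'
    proof -
      have "dist (half_log_sum ?c m) (half_log_sum ?c m') \<le>
          cmod (half_log_sum (P M) m - half_log_sum ?c m) + cmod (half_log_sum (P M) m' - half_log_sum ?c m')"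
        using N[of m m'] that norm_triangle_ineq4[of "half_log_sum (P M) m' - half_log_sum ?c m'" "half_log_sum (P M) m - half_log_sum ?c m"]
        by (simp add: dist_norm add.commute)
      also have "\<dots> \<le> e / 3 + e / 3"
        using that by (intro add_mono near) auto
      also have "\<dots> < e" using e by simp
      finally show ?thesis .
    qed
    then show "\<exists>M. \<forall>m\<ge>M. \<forall>n\<ge>M. dist (half_log_sum ?c m) (half_log_sum ?c n) < e" by blast
  qed
  then have "convergent (\<lambda>m. \<Sum>n<m. ?g n)"
    unfolding part by (rule Cauchy_convergent)
  then show sm: "summable ?g" by (simp add: summable_iff_convergent)
  have lim: "half_log_sum ?c \<longlonglongrightarrow> suminf ?g"
    using summable_LIMSEQ[OF sm] unfolding part .
  have "cmod (half_log_sum ?c m) \<le> C * hardy_norm 1 f" if "m \<ge> 2" for m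
  proof (rule LIMSEQ_le)
    show "(\<lambda>l. cmod (half_log_sum (P l) m)) \<longlonglongrightarrow> cmod (half_log_sum ?c m)"
      by (intro tendsto_norm half_log_sum_tendsto c)
    show "(\<lambda>l. C * poly_norm 1 (P l)) \<longlonglongrightarrow> C * hardy_norm 1 f"
      by (intro tendsto_mult_left r)
  qed (use T hardy_cauchy_polys[OF P] that in auto)
  then have 1: "cmod (suminf ?g) \<le> C * hardy_norm 1 f"
    by (intro LIMSEQ_le_const2[OF tendsto_norm[OF lim]]) blast
  have 2: "cmod (?c 1) \<le> abs_sum_const 1 * hardy_norm 1 f"
  proof (rule LIMSEQ_le)
    show "(\<lambda>l. cmod (P l 1)) \<longlonglongrightarrow> cmod (?c 1)"
      by (intro tendsto_norm c)
    show "(\<lambda>l. abs_sum_const 1 * poly_norm 1 (P l)) \<longlonglongrightarrow> abs_sum_const 1 * hardy_norm 1 f"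
      by (intro tendsto_mult_left r)
  qed (use norm_coeff_1_le[OF hardy_cauchy_polys[OF P]] in auto)
  have "cmod (?c 1 + suminf ?g) \<le> cmod (?c 1) + cmod (suminf ?g)" by (rule norm_triangle_ineq)
  also have "\<dots> \<le> (abs_sum_const 1 + C) * hardy_norm 1 f"
    using 1 2 by (simp add: distrib_right)
  finally show "cmod (?c 1 + suminf ?g) \<le> (abs_sum_const 1 + C) * hardy_norm 1 f" .
qed

text \<open>Summability and integrability are claimed along with the bounds, because
  \<open>suminf\<close> and the Lebesgue integral carry no information on divergent series and
  non-integrable functions. Omitting the endpoints 0 and 1 does not change the integral.\<close>

theorem theorem1p1:
  shows "(\<exists>C0>0. \<forall>f\<in>hardy_space 1.
            (\<forall>\<sigma>>0. summable (\<lambda>n. hardy_term f (of_real (1/2 + \<sigma>)) (Suc n))) \<and>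
            set_integrable lborel {0<..<1::real} (\<lambda>\<sigma>. cmod (hardy_value f (of_real (1/2 + \<sigma>)))) \<and>
            (LBINT \<sigma>:{0<..<1}. cmod (hardy_value f (of_real (1/2 + \<sigma>)))) \<le> C0 * hardy_norm 1 f)
       \<and> (\<exists>C0'>0. \<forall>f\<in>hardy_space 1.
            summable (\<lambda>n. hardy_coeff f (n + 2) / of_real (sqrt (real (n + 2)) * ln (real (n + 2)))) \<and>
            cmod (hardy_coeff f 1 +
              (\<Sum>n. hardy_coeff f (n + 2) / of_real (sqrt (real (n + 2)) * ln (real (n + 2)))))
              \<le> C0' * hardy_norm 1 f)"
proof -
  define C where "C = 8 * exp (762004 :: real)"
  define C' where "C' = C + 3 * abs_sum_const 1 + 6 * exp 47"
  have C: "C > 0" by (simp add: C_def)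
  have C': "C' > 0"
    using C abs_sum_const_nonneg[of 1] unfolding C'_def by (intro add_nonneg_pos) auto
  have emb: "(\<integral>\<^sup>+\<sigma>. ennreal (cmod (dirichlet_value a \<sigma>)) * indicator {0<..<1} \<sigma> \<partial>lborel) \<le>
      ennreal (C * poly_norm 1 a)" if "a \<in> dirichlet_polys" for a
    using nn_integral_dirichlet_value_le[OF that] by (simp only: C_def)
  have T: "cmod (half_log_sum a m) \<le> C' * poly_norm 1 a" if "a \<in> dirichlet_polys" "m \<ge> 2" for a m
    unfolding C'_def using norm_half_log_sum_le[OF that less_imp_le[OF C] emb[OF that(1)]] .
  have embed: "(\<forall>\<sigma>>0. summable (\<lambda>n. hardy_term f (of_real (1/2 + \<sigma>)) (Suc n))) \<and>
      set_integrable lborel {0<..<1::real} (\<lambda>\<sigma>. cmod (hardy_value f (of_real (1/2 + \<sigma>)))) \<and>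
      (LBINT \<sigma>:{0<..<1}. cmod (hardy_value f (of_real (1/2 + \<sigma>)))) \<le> C * hardy_norm 1 f"
    and series: "summable (\<lambda>n. hardy_coeff f (n + 2) / of_real (sqrt (real (n + 2)) * ln (real (n + 2)))) \<and>
      cmod (hardy_coeff f 1 +
        (\<Sum>n. hardy_coeff f (n + 2) / of_real (sqrt (real (n + 2)) * ln (real (n + 2)))))
        \<le> (abs_sum_const 1 + C') * hardy_norm 1 f" if f: "f \<in> hardy_space 1" for f
  proof -
    obtain P where P: "P \<in> hardy_cauchy 1" "\<And>n. (\<lambda>k. P k n) \<longlonglongrightarrow> hardy_coeff f n"
      "(\<lambda>k. poly_norm 1 (P k)) \<longlonglongrightarrow> hardy_norm 1 f"
      using hardy_space_1_limits[OF f] by blast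
    show "(\<forall>\<sigma>>0. summable (\<lambda>n. hardy_term f (of_real (1/2 + \<sigma>)) (Suc n))) \<and>
        set_integrable lborel {0<..<1::real} (\<lambda>\<sigma>. cmod (hardy_value f (of_real (1/2 + \<sigma>)))) \<and>
        (LBINT \<sigma>:{0<..<1}. cmod (hardy_value f (of_real (1/2 + \<sigma>)))) \<le> C * hardy_norm 1 f"
      using hardy_space_1_summable_and_value_tendsto(1)[OF P]
        hardy_value_integral_le[OF P less_imp_le[OF C] emb] by blast
    show "summable (\<lambda>n. hardy_coeff f (n + 2) / of_real (sqrt (real (n + 2)) * ln (real (n + 2)))) \<and>
        cmod (hardy_coeff f 1 +
          (\<Sum>n. hardy_coeff f (n + 2) / of_real (sqrt (real (n + 2)) * ln (real (n + 2)))))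
          \<le> (abs_sum_const 1 + C') * hardy_norm 1 f"
      using half_log_series[OF P C' T] by blast
  qed
  have pos: "abs_sum_const 1 + C' > 0"
    using C' abs_sum_const_nonneg[of 1] by simp
  show ?thesis
    by (rule conjI)
      (rule exI[of _ C], rule conjI[OF C], rule ballI, erule embed,
       rule exI[of _ "abs_sum_const 1 + C'"], rule conjI[OF pos], rule ballI, erule series)
qed

end
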